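(* Let $\mathbf{X}_{t-n+1},\dots,\mathbf{X}_t$ be conditionally independent given $(\boldsymbol\mu,\boldsymbol\Sigma)$ with $\mathbf{X}_i|\boldsymbol\mu,\boldsymbol\Sigma\sim\mathcal N_k(\boldsymbol\mu,\boldsymbol\Sigma)$ for $i=t-n+1,\dots,t$, with $n>k$. Let $\mathbf{w}_t=C_t\boldsymbol\Sigma^{-1}(\boldsymbol\mu-r_{f,t+1}\mathbf 1)$ and let $\mathbf L$ be a $p\times k$ matrix of constants. (a) Under the diffuse prior, the posterior distribution of $\mathbf L\mathbf w_t$ given $\mathbf x_{t,n}$ has the stochastic representation $$\mathbf L\mathbf w_t\stackrel{d}{=}C_t\eta\,\mathbf L\boldsymbol\zeta_d+C_t\sqrt\eta\left(\epsilon_d\,\mathbf L\boldsymbol\Upsilon_d\mathbf L^\top-\mathbf L\boldsymbol\zeta_d\boldsymbol\zeta_d^\top\mathbf L^\top\right)^{1/2}\mathbf z_0,$$ with $$\epsilon_d=(\overline{\mathbf x}_{t,d}-r_{f,t+1}\mathbf 1)^\top\mathbf S_{t,d}^{-1}(\overline{\mathbf x}_{t,d}-r_{f,t+1}\mathbf 1)+\frac{2}{\sqrt n}\frac{\sqrt{kQ/(n-k)}}{1+kQ/(n-k)}(\overline{\mathbf x}_{t,d}-r_{f,t+1}\mathbf 1)^\top\mathbf S_{t,d}^{-1/2}\mathbf u$$ $$\qquad+\frac1n\frac{kQ/(n-k)}{1+kQ/(n-k)}-\frac{kQ/(n-k)}{1+kQ/(n-k)}\left((\overline{\mathbf x}_{t,d}-r_{f,t+1}\mathbf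 1)^\top\mathbf S_{t,d}^{-1/2}\mathbf u\right)^2,$$ $$\boldsymbol\zeta_d=\mathbf S_{t,d}^{-1}(\overline{\mathbf x}_{t,d}-r_{f,t+1}\mathbf 1)+\frac1{\sqrt n}\frac{\sqrt{kQ/(n-k)}}{1+kQ/(n-k)}\mathbf S_{t,d}^{-1/2}\mathbf u-\frac{kQ/(n-k)}{1+kQ/(n-k)}\mathbf S_{t,d}^{-1/2}\mathbf u\mathbf u^\top\mathbf S_{t,d}^{-1/2}(\overline{\mathbf x}_{t,d}-r_{f,t+1}\mathbf 1),$$ $$\boldsymbol\Upsilon_d=\mathbf S_{t,d}^{-1}-\frac{kQ/(n-k)}{1+kQ/(n-k)}\mathbf S_{t,d}^{-1/2}\mathbf u\mathbf u^\top\mathbf S_{t,d}^{-1/2},$$ where $\eta\sim\chi^2_n$, $\mathbf z_0\sim\mathcal N_p(\mathbf 0,\mathbf I_p)$, $Q\sim\mathcal F(k,n-k)$, $\mathbf u$ is uniformly distributed on the unit sphere in $\mathbb R^k$, and $\eta,\mathbf z_0,Q,\mathbf u$ are mutually independent. (b) Under the conjugate prior, the posterior distribution of $\mathbf L\mathbf w_t$ given $\mathbf x_{t,n}$ has the stochastic representation $$\mathbf L\mathbf w_t\stackrel{d}{=}C_t\eta\,\mathbf L\boldsymbol\zeta_c+C_t\sqrt\eta\left(\epsilon_c\,\mathbf L\boldsymbol\Upsilon_c\mathbf L^\top-\mathbf L\boldsymbol\zeta_c\boldsymbol\zeta_c^\top\mathbf L^\top\right)^{1/2}\mathbf z_0,$$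 with $$\epsilon_c=(\overline{\mathbf x}_{t,c}-r_{f,t+1}\mathbf 1)^\top\mathbf S_{t,c}^{-1}(\overline{\mathbf x}_{t,c}-r_{f,t+1}\mathbf 1)+\frac{2}{\sqrt{n+r_0}}\frac{\sqrt{kQ/(n+d_0-2k)}}{1+kQ/(n+d_0-2k)}(\overline{\mathbf x}_{t,c}-r_{f,t+1}\mathbf 1)^\top\mathbf S_{t,c}^{-1/2}\mathbf u$$ $$\qquad+\frac1{n+r_0}\frac{kQ/(n+d_0-2k)}{1+kQ/(n+d_0-2k)}-\frac{kQ/(n+d_0-2k)}{1+kQ/(n+d_0-2k)}\left((\overline{\mathbf x}_{t,c}-r_{f,t+1}\mathbf 1)^\top\mathbf S_{t,c}^{-1/2}\mathbf u\right)^2,$$ $$\boldsymbol\zeta_c=\mathbf S_{t,c}^{-1}(\overline{\mathbf x}_{t,c}-r_{f,t+1}\mathbf 1)+\frac1{\sqrt{n+r_0}}\frac{\sqrt{kQ/(n+d_0-2k)}}{1+kQ/(n+d_0-2k)}\mathbf S_{t,c}^{-1/2}\mathbf u-\frac{kQ/(n+d_0-2k)}{1+kQ/(n+d_0-2k)}\mathbf S_{t,c}^{-1/2}\mathbf u\mathbf u^\top\mathbf S_{t,c}^{-1/2}(\overline{\mathbf x}_{t,c}-r_{f,t+1}\mathbf 1),$$ $$\boldsymbol\Upsilon_c=\mathbf S_{t,c}^{-1}-\frac{kQ/(n+d_0-2k)}{1+kQ/(n+d_0-2k)}\mathbf S_{t,c}^{-1/2}\mathbf u\mathbf u^\top\mathbf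 S_{t,c}^{-1/2},$$ where $\eta\sim\chi^2_{n+d_0-k}$, $\mathbf z_0\sim\mathcal N_p(\mathbf 0,\mathbf I_p)$, $Q\sim\mathcal F(k,n+d_0-2k)$, $\mathbf u$ is uniformly distributed on the unit sphere in $\mathbb R^k$, and $\eta,\mathbf z_0,Q,\mathbf u$ are mutually independent.
   Context: Setting. $\boldsymbol\mu\in\mathbb R^k$ and the positive definite $k\times k$ matrix $\boldsymbol\Sigma$ are unknown parameters endowed with a prior $\pi(\boldsymbol\mu,\boldsymbol\Sigma)$; the posterior given the observation matrix $\mathbf x_{t,n}=(\mathbf x_{t-n+1},\dots,\mathbf x_t)$ (realizations of $\mathbf X_{t-n+1},\dots,\mathbf X_t$) is $\pi(\boldsymbol\mu,\boldsymbol\Sigma|\mathbf x_{t,n})\propto L(\mathbf x_{t,n}|\boldsymbol\mu,\boldsymbol\Sigma)\pi(\boldsymbol\mu,\boldsymbol\Sigma)$, with $L$ the normal likelihood. Weights. $\mathbf w_t$ ($t\in\{0,\dots,T-1\}$) is the multi-period optimal portfolio weight vector for exponential utility, with $C_t=(\gamma W_t\prod_{i=t+2}^T R_{f,i})^{-1}$, where $\gamma>0$ is the risk aversion, $W_t$ is the current wealth, $r_{f,i}$ is the risk-free return in period $i$, $R_{f,i}=1+r_{f,i}$, and $\prod_{i=T+1}^T R_{f,i}\equiv1$. $C_t$ and $r_{f,t+1}$ are treated as known constants; $\mathbf 1$ is the $k$-vector of ones. Priors. Diffuse (Jeffreys) prior: $\pi(\boldsymbol\mu,\boldsymbol\Sigma)\propto|\boldsymbol\Sigma|^{-(k+1)/2}$.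 Conjugate prior: $\boldsymbol\mu|\boldsymbol\Sigma\sim\mathcal N_k(\mathbf m_0,\frac1{r_0}\boldsymbol\Sigma)$, $\boldsymbol\Sigma\sim\mathcal{IW}_k(d_0,\mathbf S_0)$ with hyperparameters $\mathbf m_0\in\mathbb R^k$, $r_0>0$, $d_0$, and $\mathbf S_0$ positive definite. Here $\mathcal{IW}_k(d,\mathbf S)$ (with $d>2k$) is the inverse Wishart distribution with density proportional to $|\boldsymbol\Sigma|^{-d/2}\exp(-\frac12\mathrm{tr}(\mathbf S\boldsymbol\Sigma^{-1}))$; equivalently $\boldsymbol\Sigma^{-1}$ is Wishart with $d-k-1$ degrees of freedom and scale matrix $\mathbf S^{-1}$. Data quantities. $\overline{\mathbf x}_t=\frac1n\sum_{i=t-n+1}^t\mathbf x_i$, $\mathbf S_t=\frac1{n-1}\sum_{i=t-n+1}^t(\mathbf x_i-\overline{\mathbf x}_t)(\mathbf x_i-\overline{\mathbf x}_t)^\top$; $\overline{\mathbf x}_{t,d}=\overline{\mathbf x}_t$, $\mathbf S_{t,d}=(n-1)\mathbf S_t$ (positive definite almost surely since $n>k$); $\overline{\mathbf x}_{t,c}=\frac{n\overline{\mathbf x}_t+r_0\mathbf m_0}{n+r_0}$, $\mathbf S_{t,c}=\mathbf S_{t,d}+\mathbf S_0+\frac{nr_0}{n+r_0}(\mathbf m_0-\overline{\mathbf x}_t)(\mathbf m_0-\overline{\mathbf x}_t)^\top$. Notation. $\mathcal F(d_1,d_2)$ is the $F$-distribution with $d_1$ and $d_2$ degrees of freedom. $\stackrel{d}{=}$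 is equality in distribution (conditionally on the data). $(\cdot)^{1/2}$ of a positive semidefinite matrix is its symmetric square root and $\mathbf S^{-1/2}=(\mathbf S^{-1})^{1/2}$. *)

theory Defs
  imports "HOL-Probability.Probability"
begin

section \<open>Matrices\<close>

definition pos_def :: "real^'n^'n \<Rightarrow> bool" where
  "pos_def A \<longleftrightarrow> transpose A = A \<and> (\<forall>v. v \<noteq> 0 \<longrightarrow> v \<bullet> (A *v v) > 0)"

definition pos_semidef :: "real^'n^'n \<Rightarrow> bool" where
  "pos_semidef A \<longleftrightarrow> transpose A = A \<and> (\<forall>v. v \<bullet> (A *v v) \<ge> 0)"

text \<open>Only meaningful for positive semidefinite arguments, where the root exists and is unique.\<close>

definition matrix_sqrt :: "real^'n^'n \<Rightarrow> real^'n^'n" where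
  "matrix_sqrt A = (THE B. pos_semidef B \<and> B ** B = A)"

definition outer :: "real^'m \<Rightarrow> real^'n \<Rightarrow> real^'n^'m" where
  "outer v w = (\<chi> i j. v $ i * w $ j)"

section \<open>Measures and distributions\<close>

text \<open>
  Lebesgue measure on the space of symmetric matrices, i.e. the product of one-dimensional Lebesgue
  measures over the distinct entries. These are indexed by the unordered pairs
  \<open>{i, j}\<close> (with \<open>{i}\<close> for a diagonal entry), so that no order on the index type is needed.
\<close>

definition lebesgue_sym :: "(real^'n^'n) measure" where
  "lebesgue_sym =
     distr (\<Pi>\<^sub>M e\<in>{{i, j} | i j. True}. (lborel :: real measure)) borel
           (\<lambda>s. \<chi> i j. s {i, j :: 'n})"

text \<open>The probability measure proportional to a measure \<open>M\<close> of finite non-zero total mass.\<close>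

definition normalized :: "'a measure \<Rightarrow> 'a measure" where
  "normalized M = scale_measure (1 / emeasure M (space M)) M"

text \<open>Density of the normal distribution with mean \<open>m\<close> and positive definite covariance matrix \<open>V\<close>.\<close>

definition mvn_density :: "real^'n \<Rightarrow> real^'n^'n \<Rightarrow> real^'n \<Rightarrow> real" where
  "mvn_density m V x =
     exp (- (1/2) * ((x - m) \<bullet> (matrix_inv V *v (x - m)))) / sqrt ((2 * pi) ^ CARD('n) * det V)"

definition chi_square_density :: "real \<Rightarrow> real \<Rightarrow> real" where
  "chi_square_density \<nu> x =
     (if x > 0 then x powr (\<nu>/2 - 1) * exp (- x/2) / (2 powr (\<nu>/2) * Gamma (\<nu>/2)) else 0)"

definition F_density :: "real \<Rightarrow> real \<Rightarrow> real \<Rightarrow> real" where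
  "F_density d1 d2 x =
     (if x > 0 then (d1/d2) powr (d1/2) * x powr (d1/2 - 1) * (1 + d1/d2 * x) powr (- (d1 + d2)/2)
                      / Beta (d1/2) (d2/2)
      else 0)"

text \<open>
  The uniform distribution on the unit sphere, as the cone measure: the radial projection
  (\<open>sgn v = v / norm v\<close>) of the uniform distribution on the unit ball.
\<close>

definition uniform_sphere :: "(real^'n) measure" where
  "uniform_sphere = distr (uniform_measure lborel (ball 0 1)) borel sgn"

definition inv_wishart :: "real \<Rightarrow> real^'n^'n \<Rightarrow> (real^'n^'n) measure" where
  "inv_wishart d S = normalized (density lebesgue_sym
     (\<lambda>\<Sigma>. ennreal (if pos_def \<Sigma>
                   then det \<Sigma> powr (- d/2) * exp (- (1/2) * trace (S ** matrix_inv \<Sigma>)) else 0)))"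

text \<open>
  Mutual independence of four variables with different codomains; \<open>indep_vars\<close> requires a
  common one.
\<close>

definition mutually_indep4 ::
  "'w measure \<Rightarrow> ('w \<Rightarrow> 'a::topological_space) \<Rightarrow> ('w \<Rightarrow> 'b::topological_space) \<Rightarrow>
   ('w \<Rightarrow> 'c::topological_space) \<Rightarrow> ('w \<Rightarrow> 'd::topological_space) \<Rightarrow> bool" where
  "mutually_indep4 M X1 X2 X3 X4 \<longleftrightarrow>
     prob_space.indep_sets M
       (\<lambda>i. [{X1 -` A \<inter> space M | A. A \<in> sets borel}, {X2 -` A \<inter> space M | A. A \<in> sets borel},
             {X3 -` A \<inter> space M | A. A \<in> sets borel}, {X4 -` A \<inter> space M | A. A \<in> sets borel}] ! i)
       {..<4}"

section \<open>The Bayesian model\<close>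

text \<open>
  The data are \<open>x i\<close> for the integers \<open>i\<close> in the following window; \<open>t - n + 1\<close> may be negative.
\<close>

definition window :: "int \<Rightarrow> nat \<Rightarrow> int set" where
  "window t n = {t - int n + 1..t}"

definition sampling_law :: "int \<Rightarrow> nat \<Rightarrow> real^'k \<Rightarrow> real^'k^'k \<Rightarrow> (int \<Rightarrow> real^'k) measure" where
  "sampling_law t n \<mu> \<Sigma> = (\<Pi>\<^sub>M i\<in>window t n. density lborel (\<lambda>y. ennreal (mvn_density \<mu> \<Sigma> y)))"

definition likelihood ::
  "int \<Rightarrow> nat \<Rightarrow> (int \<Rightarrow> real^'k) \<Rightarrow> real^'k \<Rightarrow> real^'k^'k \<Rightarrow> real" where
  "likelihood t n x \<mu> \<Sigma> = (\<Prod>i\<in>window t n. mvn_density \<mu> \<Sigma> (x i))"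

text \<open>
  An improper prior, determined up to a constant factor which cancels in the posterior.
\<close>

definition diffuse_prior :: "((real^'k) \<times> (real^'k^'k)) measure" where
  "diffuse_prior = density (lborel \<Otimes>\<^sub>M lebesgue_sym)
     (\<lambda>(\<mu>, \<Sigma>). ennreal (if pos_def \<Sigma> then det \<Sigma> powr (- (real CARD('k) + 1)/2) else 0))"

definition conjugate_prior ::
  "real^'k \<Rightarrow> real \<Rightarrow> real \<Rightarrow> real^'k^'k \<Rightarrow> ((real^'k) \<times> (real^'k^'k)) measure" where
  "conjugate_prior m0 r0 d0 S0 = density (lborel \<Otimes>\<^sub>M inv_wishart d0 S0)
     (\<lambda>(\<mu>, \<Sigma>). ennreal (mvn_density m0 ((1/r0) *\<^sub>R \<Sigma>) \<mu>))"

definition posterior ::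
  "((real^'k) \<times> (real^'k^'k)) measure \<Rightarrow> int \<Rightarrow> nat \<Rightarrow> (int \<Rightarrow> real^'k) \<Rightarrow>
   ((real^'k) \<times> (real^'k^'k)) measure" where
  "posterior P t n x = normalized (density P (\<lambda>(\<mu>, \<Sigma>). ennreal (likelihood t n x \<mu> \<Sigma>)))"

section \<open>Portfolio weights\<close>

definition C_const :: "real \<Rightarrow> real \<Rightarrow> (int \<Rightarrow> real) \<Rightarrow> int \<Rightarrow> int \<Rightarrow> real" where
  "C_const \<gamma> W rf t T = inverse (\<gamma> * W * (\<Prod>i = t + 2..T. 1 + rf i))"

definition weights :: "real \<Rightarrow> real \<Rightarrow> real^'k \<Rightarrow> real^'k^'k \<Rightarrow> real^'k" where
  "weights C r \<mu> \<Sigma> = C *\<^sub>R (matrix_inv \<Sigma> *v (\<mu> - r *\<^sub>R 1))"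

section \<open>Data quantities\<close>

definition sample_mean :: "int \<Rightarrow> nat \<Rightarrow> (int \<Rightarrow> real^'k) \<Rightarrow> real^'k" where
  "sample_mean t n x = (1 / real n) *\<^sub>R (\<Sum>i\<in>window t n. x i)"

definition sample_cov :: "int \<Rightarrow> nat \<Rightarrow> (int \<Rightarrow> real^'k) \<Rightarrow> real^'k^'k" where
  "sample_cov t n x = (1 / (real n - 1)) *\<^sub>R
     (\<Sum>i\<in>window t n. outer (x i - sample_mean t n x) (x i - sample_mean t n x))"

definition S_diffuse :: "int \<Rightarrow> nat \<Rightarrow> (int \<Rightarrow> real^'k) \<Rightarrow> real^'k^'k" where
  "S_diffuse t n x = (real n - 1) *\<^sub>R sample_cov t n x"

definition mean_conj :: "real^'k \<Rightarrow> real \<Rightarrow> int \<Rightarrow> nat \<Rightarrow> (int \<Rightarrow> real^'k) \<Rightarrow> real^'k" where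
  "mean_conj m0 r0 t n x = (1 / (real n + r0)) *\<^sub>R (real n *\<^sub>R sample_mean t n x + r0 *\<^sub>R m0)"

definition S_conj ::
  "real^'k \<Rightarrow> real \<Rightarrow> real^'k^'k \<Rightarrow> int \<Rightarrow> nat \<Rightarrow> (int \<Rightarrow> real^'k) \<Rightarrow> real^'k^'k" where
  "S_conj m0 r0 S0 t n x = S_diffuse t n x + S0 +
     (real n * r0 / (real n + r0)) *\<^sub>R outer (m0 - sample_mean t n x) (m0 - sample_mean t n x)"

section \<open>The stochastic representation\<close>

text \<open>
  The diffuse and the conjugate case have the same form and differ only in the parameters: the
  location \<open>m\<close>, the matrix \<open>S\<close>, the (effective) sample size \<open>N\<close> (\<open>n\<close> or \<open>n + r0\<close>), and the second
  degrees of freedom \<open>\<nu>\<close> of the \<open>F\<close>-distribution (\<open>n - k\<close> or \<open>n + d0 - 2 k\<close>). The argument \<open>r\<close> is the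
  risk-free return.
\<close>

definition eps_rep ::
  "real^'k \<Rightarrow> real^'k^'k \<Rightarrow> real \<Rightarrow> real \<Rightarrow> real \<Rightarrow> real \<Rightarrow> real^'k \<Rightarrow> real" where
  "eps_rep m S N \<nu> r Q u =
     (let a = m - r *\<^sub>R 1; R = matrix_sqrt (matrix_inv S); q = real CARD('k) * Q / \<nu> in
        a \<bullet> (matrix_inv S *v a)
        + 2 / sqrt N * (sqrt q / (1 + q)) * (a \<bullet> (R *v u))
        + 1 / N * (q / (1 + q))
        - q / (1 + q) * (a \<bullet> (R *v u))\<^sup>2)"

definition zeta_rep ::
  "real^'k \<Rightarrow> real^'k^'k \<Rightarrow> real \<Rightarrow> real \<Rightarrow> real \<Rightarrow> real \<Rightarrow> real^'k \<Rightarrow> real^'k" where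
  "zeta_rep m S N \<nu> r Q u =
     (let a = m - r *\<^sub>R 1; R = matrix_sqrt (matrix_inv S); q = real CARD('k) * Q / \<nu> in
        matrix_inv S *v a
        + (1 / sqrt N * (sqrt q / (1 + q))) *\<^sub>R (R *v u)
        - (q / (1 + q)) *\<^sub>R ((R ** outer u u ** R) *v a))"

definition Upsilon_rep :: "real^'k^'k \<Rightarrow> real \<Rightarrow> real \<Rightarrow> real^'k \<Rightarrow> real^'k^'k" where
  "Upsilon_rep S \<nu> Q u =
     (let R = matrix_sqrt (matrix_inv S); q = real CARD('k) * Q / \<nu> in
        matrix_inv S - (q / (1 + q)) *\<^sub>R (R ** outer u u ** R))"

definition weights_rep ::
  "real \<Rightarrow> real^'k^'p \<Rightarrow> real \<Rightarrow> real^'k \<Rightarrow> real^'k^'k \<Rightarrow> real^'p \<Rightarrow> real \<Rightarrow> real^'p" where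
  "weights_rep C L \<epsilon> \<zeta> \<Upsilon> z0 \<eta> =
     (C * \<eta>) *\<^sub>R (L *v \<zeta>)
     + (C * sqrt \<eta>) *\<^sub>R
       (matrix_sqrt (\<epsilon> *\<^sub>R (L ** \<Upsilon> ** transpose L) - L ** outer \<zeta> \<zeta> ** transpose L) *v z0)"

definition driving_variables ::
  "'w measure \<Rightarrow> real \<Rightarrow> real \<Rightarrow> ('w \<Rightarrow> real) \<Rightarrow> ('w \<Rightarrow> real^'p) \<Rightarrow> ('w \<Rightarrow> real) \<Rightarrow> ('w \<Rightarrow> real^'k) \<Rightarrow>
   bool" where
  "driving_variables M \<nu>\<^sub>\<eta> \<nu> \<eta> z0 Q u \<longleftrightarrow>
     prob_space M \<and>
     distributed M lborel \<eta> (\<lambda>y. ennreal (chi_square_density \<nu>\<^sub>\<eta> y)) \<and>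
     distributed M lborel z0 (\<lambda>y. ennreal (mvn_density 0 (mat 1) y)) \<and>
     distributed M lborel Q (\<lambda>y. ennreal (F_density (real CARD('k)) \<nu> y)) \<and>
     u \<in> borel_measurable M \<and> distr M borel u = uniform_sphere \<and>
     mutually_indep4 M \<eta> z0 Q u"

end

theory Submission
  imports Defs
begin

text \<open>
  With \<open>k\<close> the dimension, both priors give a posterior density of \<open>(\<mu>, \<Sigma>)\<close> that is proportional to
  \<open>det \<Sigma> powr (- D/2) * exp (- (tr (S \<Sigma>\<^sup>-\<^sup>1) + N (\<mu> - m) \<bullet> \<Sigma>\<^sup>-\<^sup>1 (\<mu> - m)) / 2)\<close>, where \<open>D = n + k + 1\<close> for the
  diffuse and \<open>D = n + d0 + 1\<close> for the conjugate prior. The quadratic form is linear in \<open>\<Sigma>\<^sup>-\<^sup>1\<close>, so for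
  fixed \<open>\<mu>\<close> this is an inverse Wishart kernel with the scale matrix
  \<open>S\<^sub>\<mu> = S + N (\<mu> - m) (\<mu> - m)\<^sup>T\<close>. The weights are \<open>\<Sigma>\<^sup>-\<^sup>1 b\<close> with \<open>b = \<mu> - r 1\<close>, up to a constant. Their
  law is found first for fixed \<open>\<mu>\<close> and then by averaging over \<open>\<mu>\<close>.

  For fixed \<open>\<mu>\<close>, with \<open>V = S\<^sub>\<mu>\<^sup>-\<^sup>1\<close>, the vector \<open>\<Sigma>\<^sup>-\<^sup>1 b\<close> is distributed as
  \<open>\<eta> V b + \<surd>\<eta> K z\<close>, where \<open>\<eta>\<close> is chi-square, \<open>z\<close> is standard normal and
  \<open>K K\<^sup>T = (b \<bullet> V b) V - V b (V b)\<^sup>T\<close> (\<open>iw_vector_law\<close>). The proof uses symmetry only. The congruence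
  \<open>\<Sigma> \<mapsto> A \<Sigma> A\<^sup>T\<close> multiplies Lebesgue measure on symmetric matrices by \<open>\<bar>det A\<bar> ^ (k + 1)\<close>
  (\<open>has_jacobian_congruence\<close>), and reduces the claim to \<open>S\<^sub>\<mu> = 1\<close> and a unit vector \<open>b = e\<close>. The shears
  \<open>1 + e v\<^sup>T\<close> with \<open>v\<close> orthogonal to \<open>e\<close> then translate the part of \<open>\<Sigma>\<^sup>-\<^sup>1 e\<close> orthogonal to \<open>e\<close>, and
  stretching the axis \<open>e\<close> rescales \<open>e \<bullet> \<Sigma>\<^sup>-\<^sup>1 e\<close>; both change the exponent in an explicit way. Averaging
  over these two groups of substitutions produces the Gaussian factor (\<open>iw_column_gaussian\<close>) and the
  chi-square factor (\<open>iw_quadratic_form_law\<close>).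

  The mass of the kernel depends on \<open>\<mu>\<close> through a power of \<open>det S\<^sub>\<mu> = det S (1 + N (\<mu> - m) \<bullet> S\<^sup>-\<^sup>1 (\<mu> - m))\<close>,
  so \<open>\<mu>\<close> has a multivariate Student density. In polar coordinates this means that
  \<open>\<surd>N S\<^sup>-\<^sup>1\<^sup>/\<^sup>2 (\<mu> - m) = \<surd>(k Q / \<nu>) u\<close> with \<open>Q\<close> and \<open>u\<close> as in the theorem
  (\<open>nn_integral_student_polar\<close>). Now \<open>S\<^sub>\<mu>\<close> is a rank-one perturbation of \<open>S\<close>, and the Sherman--Morrison
  formula turns \<open>V\<close>, \<open>V b\<close> and \<open>b \<bullet> V b\<close> into \<open>\<Upsilon>\<close>, \<open>\<zeta>\<close> and \<open>\<epsilon>\<close> (\<open>rep_identities\<close>). Finally, the law of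
  \<open>L K z\<close> depends only on \<open>L K (L K)\<^sup>T = \<epsilon> L \<Upsilon> L\<^sup>T - L \<zeta> \<zeta>\<^sup>T L\<^sup>T\<close>, so \<open>L K\<close> may be replaced by the square
  root of this matrix (\<open>nn_integral_gauss_linear_image\<close>).

  Each law is determined up to a constant factor, which cancels on normalization; what has to be shown
  is that the masses are neither zero nor infinite (\<open>iw_mass_finite\<close>, \<open>iw_mass_nonzero\<close>). The Jacobians
  rest on one fact, that two translation-invariant measures are proportional
  (\<open>translation_invariant_proportional\<close>).

  The scatter matrix of the data is singular only if the differences of the observations lie in a
  hyperplane, an event of probability zero (\<open>AE_pos_def_S_diffuse\<close>).
\<close>

section \<open>Matrix algebra\<close>

(* Transposes stay explicit, so that adjoints can be moved across inner products. *)
declare transpose_matrix_vector [simp del]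

lemma inner_mult_transpose: "(x :: real^'m) \<bullet> (A *v y) = (transpose A *v x) \<bullet> y"
  by (simp add: dot_lmul_matrix transpose_matrix_vector)

lemma inner_mult_symmetric: "transpose A = A \<Longrightarrow> (x :: real^'n) \<bullet> (A *v y) = (A *v x) \<bullet> y"
  by (metis inner_mult_transpose)

lemma transpose_scaleR: "transpose (c *\<^sub>R A) = c *\<^sub>R transpose (A :: real^'n^'m)"
  by (simp add: transpose_def vec_eq_iff)

lemma transpose_add: "transpose (A + B) = transpose A + transpose (B :: real^'n^'m)"
  by (simp add: transpose_def vec_eq_iff)

lemma transpose_diff: "transpose (A - B) = transpose A - transpose (B :: real^'n^'m)"
  by (simp add: transpose_def vec_eq_iff)

lemma matrix_mul_scaleR_left: "(c *\<^sub>R A) ** B = c *\<^sub>R ((A :: real^'n^'m) ** (B :: real^'k^'n))"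
  by (simp add: matrix_matrix_mult_def vec_eq_iff sum_distrib_left mult.assoc)

lemma matrix_mul_scaleR_right: "A ** (c *\<^sub>R B) = c *\<^sub>R ((A :: real^'n^'m) ** (B :: real^'k^'n))"
  by (simp add: matrix_matrix_mult_def vec_eq_iff sum_distrib_left mult_ac)

lemma matrix_add_rdistrib: "(A + B) ** C = A ** C + B ** (C :: real^'k^'n)"
  by (simp add: matrix_matrix_mult_def vec_eq_iff sum.distrib algebra_simps)

lemma matrix_sub_rdistrib: "(A - B) ** C = A ** C - B ** (C :: real^'k^'n)"
  by (simp add: matrix_matrix_mult_def vec_eq_iff sum_subtractf algebra_simps)

lemma matrix_sub_ldistrib: "C ** (A - B) = C ** A - C ** (B :: real^'k^'n)"
  by (simp add: matrix_matrix_mult_def vec_eq_iff sum_subtractf algebra_simps)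

lemma transpose_outer: "transpose (outer v w) = outer w v"
  by (simp add: outer_def transpose_def vec_eq_iff mult.commute)

lemma outer_mult_vec: "outer v w *v x = (w \<bullet> x) *\<^sub>R v"
  by (simp add: outer_def matrix_vector_mult_def inner_vec_def vec_eq_iff sum_distrib_left mult_ac)

lemma matrix_mul_outer: "A ** outer v w = outer (A *v v) w"
  by (simp add: matrix_eq matrix_vector_mul_assoc[symmetric] outer_mult_vec matrix_vector_mult_scaleR)

lemma outer_matrix_mul: "outer v w ** A = outer v (transpose A *v w)"
  by (simp add: matrix_eq matrix_vector_mul_assoc[symmetric] outer_mult_vec inner_mult_transpose)

lemma trace_outer: "trace (outer v w) = v \<bullet> (w :: real^'n)"
  by (simp add: trace_def outer_def inner_vec_def)

lemma trace_mul_outer: "trace (A ** outer v w) = w \<bullet> (A *v v)"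
  by (simp add: matrix_mul_outer trace_outer inner_commute)

lemma trace_outer_mul: "trace (outer v w ** A) = w \<bullet> (A *v v)"
  by (metis trace_mul_sym trace_mul_outer)

lemma trace_scaleR: "trace (c *\<^sub>R A) = c * trace (A :: real^'n^'n)"
  by (simp add: trace_def sum_distrib_left)

lemma matrix_inv_eqI:
  fixes A :: "real^'n^'n"
  assumes "A ** B = mat 1"
  shows "matrix_inv A = B"
proof -
  have B: "B ** A = mat 1" using assms matrix_left_right_inverse by blast
  show ?thesis unfolding matrix_inv_def
  proof (rule some_equality)
    show "A ** B = mat 1 \<and> B ** A = mat 1" using assms B by blast
    fix C assume "A ** C = mat 1 \<and> C ** A = mat 1"
    then show "C = B" by (metis assms matrix_mul_assoc matrix_mul_rid matrix_mul_lid)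
  qed
qed

lemma matrix_inv_right: "invertible (A :: real^'n^'n) \<Longrightarrow> A ** matrix_inv A = mat 1"
  unfolding invertible_def using matrix_inv_eqI by metis

lemma matrix_inv_left: "invertible (A :: real^'n^'n) \<Longrightarrow> matrix_inv A ** A = mat 1"
  using matrix_inv_right matrix_left_right_inverse by blast

lemma matrix_inv_mul:
  fixes A B :: "real^'n^'n"
  assumes "invertible A" "invertible B"
  shows "matrix_inv (A ** B) = matrix_inv B ** matrix_inv A"
proof (rule matrix_inv_eqI)
  have "A ** B ** (matrix_inv B ** matrix_inv A) = A ** (B ** matrix_inv B) ** matrix_inv A"
    by (simp add: matrix_mul_assoc)
  then show "A ** B ** (matrix_inv B ** matrix_inv A) = mat 1"
    using assms by (simp add: matrix_inv_right)
qed

lemma invertible_matrix_inv: "invertible (A :: real^'n^'n) \<Longrightarrow> invertible (matrix_inv A)"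
  using invertible_def matrix_inv_left matrix_inv_right by blast

lemma matrix_inv_transpose:
  "invertible (A :: real^'n^'n) \<Longrightarrow> matrix_inv (transpose A) = transpose (matrix_inv A)"
  by (rule matrix_inv_eqI) (metis matrix_transpose_mul matrix_inv_left transpose_mat)

lemma invertible_matrix_mul: "invertible (A::real^'n^'n) \<Longrightarrow> invertible (B::real^'n^'n) \<Longrightarrow> invertible (A ** B)"
  by (simp add: invertible_det_nz det_mul)

text \<open>A rotation moves \<open>b\<close> to a multiple of a coordinate axis. The matrix then differs from the identity in
  one column only, and Cramer's rule evaluates its determinant.\<close>

lemma det_mat_1_plus_outer: "det (mat 1 + outer a b :: real^'n^'n) = 1 + a \<bullet> b"
proof -
  obtain k :: 'n where True by blast
  define e :: "real^'n" where "e = axis k 1"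
  have ne: "norm e = 1" by (simp add: e_def)
  obtain f where f: "orthogonal_transformation f" "f (norm b *\<^sub>R e) = b"
    using orthogonal_transformation_exists[of "norm b *\<^sub>R e" b] ne by auto
  define Q where "Q = matrix f"
  have Q: "orthogonal_matrix Q" "\<And>x. Q *v x = f x"
    using f(1) by (auto simp: Q_def orthogonal_transformation_matrix matrix_works)
  define c where "c = norm b *\<^sub>R (transpose Q *v a)"
  have b: "b = norm b *\<^sub>R (Q *v e)" using f(2) f(1) Q by (metis matrix_vector_mult_scaleR)
  have QT: "Q ** transpose Q = mat 1" using Q(1) by (simp add: orthogonal_matrix_def)
  have "Q *v c = norm b *\<^sub>R a"
    unfolding c_def by (simp add: matrix_vector_mult_scaleR matrix_vector_mul_assoc QT)
  moreover have "outer (norm b *\<^sub>R a) (Q *v e) = outer a b"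
    by (subst (2) b) (simp add: outer_def vec_eq_iff)
  ultimately have "mat 1 + outer a b = Q ** (mat 1 + outer c e) ** transpose Q"
    by (simp add: matrix_add_ldistrib matrix_add_rdistrib QT matrix_mul_outer outer_matrix_mul)
  then have "det (mat 1 + outer a b) = det (mat 1 + outer c e) * det (Q ** transpose Q)"
    by (simp add: det_mul)
  also have "\<dots> = det (mat 1 + outer c e)" by (simp add: QT)
  also have "mat 1 + outer c e = (\<chi> i j. if j = k then (e + c) $ i else (mat 1 :: real^'n^'n) $ i $ j)"
    by (auto simp: vec_eq_iff e_def outer_def axis_def mat_def)
  also have "det \<dots> = (e + c) $ k" using cramer_lemma[of k "mat 1 :: real^'n^'n" "e + c"]
    unfolding matrix_vector_mul_lid by (simp only: det_I mult.right_neutral)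
  also have "\<dots> = 1 + c \<bullet> e" by (simp add: e_def inner_axis)
  also have "c \<bullet> e = a \<bullet> b"
    by (subst b) (simp add: c_def inner_mult_transpose)
  finally show ?thesis .
qed

subsection \<open>Positive definite matrices\<close>

lemma pos_def_imp_invertible: assumes "pos_def A" shows "invertible A"
proof -
  have "x = 0" if "A *v x = 0" for x
    using assms that unfolding pos_def_def by (metis inner_zero_right less_irrefl)
  then show ?thesis
    by (metis invertible_left_inverse matrix_left_invertible_ker)
qed

lemma pos_def_congruence:
  fixes A S :: "real^'n^'n"
  assumes "pos_def S" "invertible A" shows "pos_def (A ** S ** transpose A)"
  unfolding pos_def_def
proof safe
  show "transpose (A ** S ** transpose A) = A ** S ** transpose A"
    using assms by (simp add: pos_def_def matrix_transpose_mul matrix_mul_assoc)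
  fix v :: "real^'n" assume "v \<noteq> 0"
  have "transpose A *v v \<noteq> 0"
  proof
    assume 0: "transpose A *v v = 0"
    have "v = transpose (matrix_inv A) *v (transpose A *v v)"
      by (simp add: matrix_vector_mul_assoc matrix_transpose_mul[symmetric] assms matrix_inv_right)
    with 0 \<open>v \<noteq> 0\<close> show False by simp
  qed
  then show "v \<bullet> (A ** S ** transpose A *v v) > 0"
    using assms(1) by (simp add: pos_def_def matrix_vector_mul_assoc[symmetric] inner_mult_transpose[of v])
qed

text \<open>The positive definite cone is invariant under every congruence, which makes it a domain for the
  substitutions below.\<close>

lemma pos_def_congruence_iff:
  fixes A S :: "real^'n^'n"
  assumes "invertible A" shows "pos_def (A ** S ** transpose A) \<longleftrightarrow> pos_def S"
proof
  let ?B = "matrix_inv A"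
  assume "pos_def (A ** S ** transpose A)"
  then have "pos_def (?B ** (A ** S ** transpose A) ** transpose ?B)"
    by (rule pos_def_congruence) (simp add: assms invertible_matrix_inv)
  also have "?B ** (A ** S ** transpose A) ** transpose ?B = (?B ** A) ** S ** transpose (?B ** A)"
    by (simp add: matrix_transpose_mul matrix_mul_assoc)
  finally show "pos_def S" by (simp add: matrix_inv_left assms)
qed (use assms pos_def_congruence in blast)

lemma pos_def_matrix_inv: assumes "pos_def A" shows "pos_def (matrix_inv A)"
proof -
  have i: "invertible A" using assms by (rule pos_def_imp_invertible)
  have s: "transpose A = A" using assms by (simp add: pos_def_def)
  have "pos_def (matrix_inv A ** A ** transpose (matrix_inv A))"
    using assms i by (simp add: pos_def_congruence invertible_matrix_inv)
  then show ?thesis by (metis i s matrix_inv_left matrix_inv_transpose matrix_mul_lid)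
qed

lemma pos_def_mat_1: "pos_def (mat 1)"
  by (simp add: pos_def_def)

lemma pos_def_add_outer:
  assumes "pos_def S" "c \<ge> 0" shows "pos_def (S + c *\<^sub>R outer v v)"
proof -
  have "x \<bullet> (S *v x) + c * (v \<bullet> x)\<^sup>2 > 0" if "x \<noteq> 0" for x
    using assms that by (simp add: pos_def_def add_pos_nonneg)
  moreover have "x \<bullet> ((S + c *\<^sub>R outer v v) *v x) = x \<bullet> (S *v x) + c * (v \<bullet> x)\<^sup>2" for x
    by (simp add: matrix_vector_mult_add_rdistrib inner_add_right scaleR_matrix_vector_assoc[symmetric]
        outer_mult_vec power2_eq_square inner_commute)
  ultimately show ?thesis using assms
    by (simp add: pos_def_def transpose_add transpose_scaleR transpose_outer)
qed

lemma pos_def_imp_semidef: "pos_def A \<Longrightarrow> pos_semidef A"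
  unfolding pos_def_def pos_semidef_def by (metis inner_zero_left less_eq_real_def)

lemma pos_semidef_mult_transpose: "pos_semidef (B ** transpose B)"
  by (simp add: pos_semidef_def matrix_transpose_mul matrix_vector_mul_assoc[symmetric] inner_mult_transpose[of _ B])

subsection \<open>Spectral theorem\<close>

text \<open>The maximum of the quadratic form on the unit sphere of an invariant subspace is attained at an
  eigenvector, since the form cannot increase to first order in any direction of the subspace.\<close>

lemma symmetric_eigenvector_exists:
  fixes A :: "real^'n^'n"
  assumes sym: "transpose A = A" and S: "subspace S" "\<And>x. x \<in> S \<Longrightarrow> A *v x \<in> S" and ne: "S \<noteq> {0}"
  obtains v l where "v \<in> S" "norm v = 1" "A *v v = l *\<^sub>R v"
proof -
  obtain x where "x \<in> S" "x \<noteq> 0" using ne S(1) subspace_0 by blast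
  then have "(1 / norm x) *\<^sub>R x \<in> S \<inter> sphere 0 1" using S(1) by (simp add: subspace_scale)
  then have n: "S \<inter> sphere 0 1 \<noteq> {}" by blast
  have c: "compact (S \<inter> sphere 0 1)" using S(1) by (simp add: closed_Int_compact closed_subspace)
  obtain v where v: "v \<in> S" "norm v = 1" and m: "\<And>y. y \<in> S \<Longrightarrow> norm y = 1 \<Longrightarrow> y \<bullet> (A *v y) \<le> v \<bullet> (A *v v)"
    using continuous_attains_sup[OF c n, of "\<lambda>y. y \<bullet> (A *v y)"]
    by (force intro!: continuous_intros)
  define l where "l = v \<bullet> (A *v v)"
  have le: "y \<bullet> (A *v y) \<le> l * (y \<bullet> y)" if "y \<in> S" for y
  proof (cases "y = 0")
    case False
    have "((1 / norm y) *\<^sub>R y) \<bullet> (A *v ((1 / norm y) *\<^sub>R y)) \<le> l"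
      unfolding l_def by (rule m) (use that S(1) False in \<open>auto simp: subspace_scale\<close>)
    then have "(y \<bullet> (A *v y)) / (norm y)\<^sup>2 \<le> l"
      by (simp add: matrix_vector_mult_scaleR power2_eq_square)
    then show ?thesis using False by (simp add: divide_le_eq dot_square_norm)
  qed simp
  define u where "u = A *v v - l *\<^sub>R v"
  have uS: "u \<in> S" unfolding u_def using v S by (simp add: subspace_diff subspace_scale)
  have vv: "v \<bullet> v = 1" using v(2) by (simp add: norm_eq_1)
  (* Comparing the form at v + t u with its maximum for every t: the linear term in t cannot be
     dominated by the quadratic one for small t, unless it vanishes. *)
  have key: "2 * t * (u \<bullet> u) \<le> t\<^sup>2 * (l * (u \<bullet> u) - u \<bullet> (A *v u))" for t
  proof -
    have "(v + t *\<^sub>R u) \<bullet> (A *v (v + t *\<^sub>R u)) \<le> l * ((v + t *\<^sub>R u) \<bullet> (v + t *\<^sub>R u))"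
      by (rule le) (use v uS S(1) in \<open>simp add: subspace_add subspace_scale\<close>)
    moreover have "v \<bullet> (A *v u) = u \<bullet> (A *v v)"
      by (metis inner_mult_symmetric sym inner_commute)
    moreover have "u \<bullet> (A *v v) = u \<bullet> u + l * (u \<bullet> v)"
      by (simp add: u_def algebra_simps)
    ultimately show ?thesis
      using l_def vv by (simp add: matrix_vector_right_distrib matrix_vector_mult_scaleR inner_add_left inner_add_right
         power2_eq_square algebra_simps inner_commute[of v u])
  qed
  have "u \<bullet> u = 0"
  proof (rule ccontr)
    assume "u \<bullet> u \<noteq> 0"
    then have p: "u \<bullet> u > 0" by (simp add: less_le)
    define K where "K = \<bar>l * (u \<bullet> u) - u \<bullet> (A *v u)\<bar> + 1"
    have K: "K > 0" "l * (u \<bullet> u) - u \<bullet> (A *v u) \<le> K" by (auto simp: K_def)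
    define t where "t = (u \<bullet> u) / K"
    have t: "t > 0" using p K by (simp add: t_def)
    have "2 * t * (u \<bullet> u) \<le> t\<^sup>2 * K" using key[of t] K(2)
      by (meson order_trans mult_left_mono zero_le_power2)
    also have "\<dots> = t * (u \<bullet> u)" using K by (simp add: t_def power2_eq_square)
    finally show False using t p by simp
  qed
  then have "A *v v = l *\<^sub>R v" by (simp add: u_def)
  with v that show thesis by blast
qed

text \<open>Induction on the dimension: split off one eigenvector; its orthogonal complement is again invariant
  because the matrix is symmetric.\<close>

lemma symmetric_orthonormal_eigenbasis:
  fixes A :: "real^'n^'n"
  assumes sym: "transpose A = A"
  shows "subspace S \<Longrightarrow> (\<And>x. x \<in> S \<Longrightarrow> A *v x \<in> S) \<Longrightarrow>
    \<exists>B. pairwise orthogonal B \<and> (\<forall>b\<in>B. norm b = 1 \<and> (\<exists>l. A *v b = l *\<^sub>R b)) \<and> span B = S"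
proof (induction "dim S" arbitrary: S rule: less_induct)
  case less
  show ?case
  proof (cases "S = {0}")
    case True
    then show ?thesis by (intro exI[of _ "{}"]) auto
  next
    case False
    obtain v l where v: "v \<in> S" "norm v = 1" "A *v v = l *\<^sub>R v"
      using symmetric_eigenvector_exists[OF sym less.prems False] by blast
    define S' where "S' = {w \<in> S. v \<bullet> w = 0}"
    have sub: "subspace S'" using less.prems(1)
      by (auto simp: S'_def subspace_def inner_add_right)
    have inv: "A *v w \<in> S'" if "w \<in> S'" for w
      using that less.prems(2) inner_mult_symmetric[OF sym, of v w] by (simp add: S'_def v)
    have vv: "v \<bullet> v = 1" using v(2) by (simp add: norm_eq_1)
    then have "v \<notin> S'" by (simp add: S'_def)
    then have "S' \<subset> S" using v(1) unfolding S'_def by blast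
    then have "span S' \<subset> span S" using sub less.prems(1) by (simp add: span_eq_iff[THEN iffD2])
    then have "dim S' < dim S" by (rule dim_psubset)
    from less.hyps[OF this sub inv] obtain B where B: "pairwise orthogonal B"
      "\<forall>b\<in>B. norm b = 1 \<and> (\<exists>l. A *v b = l *\<^sub>R b)" "span B = S'" by blast
    have BS: "B \<subseteq> S'" using B(3) span_superset by blast
    show ?thesis
    proof (intro exI[of _ "insert v B"] conjI)
      show "pairwise orthogonal (insert v B)"
        using B(1) BS by (auto simp: pairwise_insert S'_def orthogonal_def inner_commute)
      show "\<forall>b\<in>insert v B. norm b = 1 \<and> (\<exists>l. A *v b = l *\<^sub>R b)" using B(2) v by auto
      show "span (insert v B) = S"
      proof
        have "insert v B \<subseteq> S" using BS v(1) by (auto simp: S'_def)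
        then show "span (insert v B) \<subseteq> S" using less.prems(1) by (simp add: span_minimal)
        show "S \<subseteq> span (insert v B)"
        proof
          fix w assume w: "w \<in> S"
          have "w - (v \<bullet> w) *\<^sub>R v \<in> S'" using w v less.prems(1)
            by (simp add: S'_def subspace_diff subspace_scale inner_diff_right vv)
          then have "w - (v \<bullet> w) *\<^sub>R v \<in> span B" using B(3) by simp
          then show "w \<in> span (insert v B)" using span_breakdown_eq by blast
        qed
      qed
    qed
  qed
qed

definition diag_matrix :: "('n \<Rightarrow> real) \<Rightarrow> real^'n^'n" where
  "diag_matrix d = (\<chi> i j. if i = j then d i else 0)"

lemma diag_matrix_mul: "diag_matrix d ** diag_matrix e = diag_matrix (\<lambda>i. d i * e i)"
proof -
  have "(\<Sum>k\<in>UNIV. (if i = k then d i else 0) * (if k = j then e k else 0)) = (if i = j then d i * e i else 0)" for i j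
    by (subst sum.cong[where h = "\<lambda>k. if k = i then (if i = j then d i * e i else 0) else 0"]) auto
  then show ?thesis by (simp add: diag_matrix_def matrix_matrix_mult_def vec_eq_iff)
qed

lemma transpose_diag_matrix: "transpose (diag_matrix d) = diag_matrix d"
  by (auto simp: diag_matrix_def transpose_def vec_eq_iff)

lemma det_diag_matrix: "det (diag_matrix d) = (\<Prod>i\<in>UNIV. d i)"
  by (subst det_diagonal) (auto simp: diag_matrix_def)

lemma diag_matrix_mult_vec: "diag_matrix d *v x = (\<chi> i. d i * x $ i)"
proof -
  have "(\<Sum>k\<in>UNIV. (if i = k then d i else 0) * x $ k) = d i * x $ i" for i
    by (subst sum.cong[where h = "\<lambda>k. if k = i then d i * x $ i else 0"]) auto
  then show ?thesis by (simp add: diag_matrix_def matrix_vector_mult_def vec_eq_iff)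
qed

theorem spectral_theorem_symmetric:
  fixes A :: "real^'n^'n"
  assumes sym: "transpose A = A"
  obtains Q d where "orthogonal_matrix Q" "A = Q ** diag_matrix d ** transpose Q"
proof -
  obtain B where B: "pairwise orthogonal B" "\<forall>b\<in>B. norm b = 1 \<and> (\<exists>l. A *v b = l *\<^sub>R b)"
      "span B = (UNIV :: (real^'n) set)"
    using symmetric_orthonormal_eigenbasis[OF sym, of UNIV] by (auto simp: subspace_UNIV)
  have "0 \<notin> B" using B(2) by fastforce
  then have ind: "independent B" using B(1) by (rule pairwise_orthogonal_independent[rotated])
  then have "card B = CARD('n)" "finite B"
    using dim_span_eq_card_independent[OF ind] B(3) by (auto simp: independent_imp_finite)
  then obtain f :: "'n \<Rightarrow> real^'n" where f: "bij_betw f UNIV B"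
    by (metis finite_same_card_bij finite)
  obtain d where d: "\<And>b. b \<in> B \<Longrightarrow> A *v b = d b *\<^sub>R b" using B(2) by metis
  define Q :: "real^'n^'n" where "Q = (\<chi> i j. f j $ i)"
  have fB: "f j \<in> B" for j using f by (auto simp: bij_betw_def)
  have "transpose Q ** Q = mat 1"
  proof -
    have "f i \<bullet> f j = (if i = j then 1 else 0)" for i j
    proof (cases "i = j")
      case True
      then show ?thesis using fB B(2) by (simp add: norm_eq_1)
    next
      case False
      then have "f i \<noteq> f j" using f by (auto simp: bij_betw_def inj_on_def)
      then show ?thesis using False B(1) fB by (auto simp: pairwise_def orthogonal_def)
    qed
    then show ?thesis
      by (simp add: Q_def transpose_def matrix_matrix_mult_def inner_vec_def mat_def vec_eq_iff)
  qed
  then have Q: "orthogonal_matrix Q" by (simp add: orthogonal_matrix)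
  then have QT: "Q ** transpose Q = mat 1" by (simp add: orthogonal_matrix_def)
  have "A ** Q = Q ** diag_matrix (d \<circ> f)"
  proof -
    have "(A ** Q) $ i $ j = (A *v f j) $ i" for i j
      by (simp add: Q_def matrix_matrix_mult_def matrix_vector_mult_def)
    moreover have "(Q ** diag_matrix (d \<circ> f)) $ i $ j = d (f j) * f j $ i" for i j
    proof -
      have "(Q ** diag_matrix (d \<circ> f)) $ i $ j = (\<Sum>k\<in>UNIV. f k $ i * (if k = j then d (f k) else 0))"
        by (simp add: matrix_matrix_mult_def diag_matrix_def Q_def comp_def)
      also have "\<dots> = (\<Sum>k\<in>UNIV. if k = j then d (f j) * f j $ i else 0)"
        by (rule sum.cong) auto
      finally have "(Q ** diag_matrix (d \<circ> f)) $ i $ j = (\<Sum>k\<in>UNIV. if k = j then d (f j) * f j $ i else 0)" .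
      then show ?thesis by simp
    qed
    ultimately show ?thesis using d fB by (simp add: vec_eq_iff)
  qed
  then have "A = Q ** diag_matrix (d \<circ> f) ** transpose Q"
    by (metis QT matrix_mul_assoc matrix_mul_rid)
  with Q that show thesis by blast
qed

lemma spectral_theorem_pos_semidef:
  assumes "pos_semidef A"
  obtains Q d where "orthogonal_matrix Q" "A = Q ** diag_matrix d ** transpose Q" "\<And>i. d i \<ge> 0"
proof -
  obtain Q d where Q: "orthogonal_matrix Q" "A = Q ** diag_matrix d ** transpose Q"
    using assms spectral_theorem_symmetric pos_semidef_def by metis
  have "d i \<ge> 0" for i
  proof -
    have QQ: "transpose Q ** Q = mat 1" using Q(1) by (simp add: orthogonal_matrix)
    have "0 \<le> (Q *v axis i 1) \<bullet> (A *v (Q *v axis i 1))" using assms by (simp add: pos_semidef_def)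
    also have "\<dots> = (Q *v axis i 1) \<bullet> (Q *v (diag_matrix d *v axis i 1))"
      by (simp add: Q(2) matrix_vector_mul_assoc matrix_mul_assoc[symmetric] QQ)
    also have "\<dots> = axis i 1 \<bullet> (diag_matrix d *v axis i 1)"
      by (subst inner_mult_transpose) (simp add: matrix_vector_mul_assoc[of "transpose Q"] QQ)
    also have "\<dots> = d i" by (simp add: diag_matrix_mult_vec inner_axis')
    finally show ?thesis .
  qed
  with Q that show thesis by blast
qed

lemma det_pos_def: assumes "pos_def A" shows "det A > 0"
proof -
  obtain Q d where Q: "orthogonal_matrix Q" "A = Q ** diag_matrix d ** transpose Q" "\<And>i. d i \<ge> 0"
    using spectral_theorem_pos_semidef[OF pos_def_imp_semidef[OF assms]] by blast
  have "det A = det (Q ** transpose Q) * det (diag_matrix d)" by (simp add: Q(2) det_mul)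
  also have "\<dots> = (\<Prod>i\<in>UNIV. d i)" using Q(1) by (simp add: orthogonal_matrix_def det_diag_matrix)
  finally have "det A \<ge> 0" using Q(3) by (simp add: prod_nonneg)
  moreover have "det A \<noteq> 0" using assms pos_def_imp_invertible invertible_det_nz by blast
  ultimately show ?thesis by simp
qed

subsection \<open>The square root of a positive semidefinite matrix\<close>

lemma pos_semidef_sqrt_exists:
  assumes "pos_semidef A" obtains B where "pos_semidef B" "B ** B = A"
proof -
  obtain Q d where Q: "orthogonal_matrix Q" "A = Q ** diag_matrix d ** transpose Q" "\<And>i. d i \<ge> 0"
    using spectral_theorem_pos_semidef[OF assms] by blast
  have QQ: "transpose Q ** Q = mat 1" using Q(1) by (simp add: orthogonal_matrix)
  define B where "B = Q ** diag_matrix (\<lambda>i. sqrt (d i)) ** transpose Q"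
  have "B ** B = Q ** diag_matrix (\<lambda>i. sqrt (d i)) ** (transpose Q ** Q) ** diag_matrix (\<lambda>i. sqrt (d i)) ** transpose Q"
    by (simp only: B_def matrix_mul_assoc)
  also have "\<dots> = Q ** (diag_matrix (\<lambda>i. sqrt (d i)) ** diag_matrix (\<lambda>i. sqrt (d i))) ** transpose Q"
    by (simp add: QQ matrix_mul_assoc)
  also have "\<dots> = A" by (simp add: Q(2,3) diag_matrix_mul)
  finally have "B ** B = A" .
  moreover have "pos_semidef B"
  proof -
    let ?E = "diag_matrix (\<lambda>i. sqrt (sqrt (d i)))"
    have "B = Q ** (?E ** ?E) ** transpose Q"
      using Q(3) by (simp add: B_def diag_matrix_mul)
    also have "\<dots> = (Q ** ?E) ** transpose (Q ** ?E)"
      by (simp add: matrix_transpose_mul matrix_mul_assoc transpose_diag_matrix)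
    finally have "B = (Q ** ?E) ** transpose (Q ** ?E)" .
    then show ?thesis using pos_semidef_mult_transpose by metis
  qed
  ultimately show thesis using that by blast
qed

text \<open>If \<open>v\<close> is an eigenvector of \<open>D = B - C\<close> with eigenvalue \<open>l\<close>, then \<open>0 = v \<bullet> (B\<^sup>2 - C\<^sup>2) v = l (v \<bullet> B v + v \<bullet> C v)\<close>.
  So \<open>l = 0\<close>, or both forms vanish at \<open>v\<close> and with them \<open>l = v \<bullet> D v\<close>. Hence all eigenvalues of \<open>D\<close> are zero.\<close>

lemma pos_semidef_sqrt_unique:
  fixes B C :: "real^'n^'n"
  assumes B: "pos_semidef B" and C: "pos_semidef C" and eq: "B ** B = C ** C"
  shows "B = C"
proof -
  define D where "D = B - C"
  have Bs: "transpose B = B" and Cs: "transpose C = C" using B C by (auto simp: pos_semidef_def)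
  then have Ds: "transpose D = D" by (simp add: D_def transpose_diff)
  obtain Q d where Q: "orthogonal_matrix Q" "D = Q ** diag_matrix d ** transpose Q"
    using spectral_theorem_symmetric[OF Ds] by blast
  have QQ: "transpose Q ** Q = mat 1" using Q(1) by (simp add: orthogonal_matrix)
  have "d i = 0" for i
  proof -
    define v where "v = Q *v axis i 1"
    have ax: "diag_matrix d *v axis i 1 = d i *\<^sub>R axis i 1"
      by (auto simp: diag_matrix_mult_vec axis_def vec_eq_iff)
    have Dv: "D *v v = d i *\<^sub>R v"
      unfolding v_def Q(2) using ax
      by (metis QQ matrix_mul_assoc matrix_mul_rid matrix_vector_mul_assoc matrix_vector_mult_scaleR)
    have vv: "v \<bullet> v = 1"
      unfolding v_def by (simp add: inner_mult_transpose[of "Q *v _" Q] matrix_vector_mul_assoc QQ inner_axis')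
    have "B ** D + D ** C = 0"
      by (simp add: D_def eq matrix_sub_ldistrib matrix_sub_rdistrib)
    then have "v \<bullet> ((B ** D + D ** C) *v v) = 0" by simp
    then have "v \<bullet> (B *v (D *v v)) + v \<bullet> (D *v (C *v v)) = 0"
      by (simp add: matrix_vector_mult_add_rdistrib matrix_vector_mul_assoc inner_add_right)
    moreover have "v \<bullet> (D *v (C *v v)) = (D *v v) \<bullet> (C *v v)" by (rule inner_mult_symmetric[OF Ds])
    ultimately have "d i * (v \<bullet> (B *v v) + v \<bullet> (C *v v)) = 0"
      by (simp add: Dv matrix_vector_mult_scaleR algebra_simps)
    moreover have "v \<bullet> (B *v v) - v \<bullet> (C *v v) = d i"
      using arg_cong[OF Dv, of "\<lambda>x. v \<bullet> x"] vv
      by (simp add: D_def matrix_vector_mult_diff_rdistrib inner_diff_right)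
    moreover have "v \<bullet> (B *v v) \<ge> 0" "v \<bullet> (C *v v) \<ge> 0" using B C by (auto simp: pos_semidef_def)
    ultimately show ?thesis by (smt (verit) mult_eq_0_iff)
  qed
  then have "diag_matrix d = 0" by (simp add: diag_matrix_def vec_eq_iff)
  then have "D = 0" by (simp add: Q(2) matrix_matrix_mult_def vec_eq_iff)
  then show ?thesis by (simp add: D_def)
qed

lemma matrix_sqrt_eqI: "pos_semidef B \<Longrightarrow> B ** B = A \<Longrightarrow> matrix_sqrt A = B"
  unfolding matrix_sqrt_def by (rule the_equality) (auto intro: pos_semidef_sqrt_unique)

lemma
  assumes "pos_semidef A"
  shows pos_semidef_matrix_sqrt: "pos_semidef (matrix_sqrt A)"
    and matrix_sqrt_square: "matrix_sqrt A ** matrix_sqrt A = A"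
  using pos_semidef_sqrt_exists[OF assms] matrix_sqrt_eqI by metis+

text \<open>Off the positive semidefinite matrices the square root takes a constant default value, which is what
  makes it measurable everywhere.\<close>

lemma matrix_sqrt_not_pos_semidef:
  assumes "\<not> pos_semidef A" shows "matrix_sqrt A = (THE B. False)"
proof -
  have "\<not> (pos_semidef B \<and> B ** B = A)" for B
    using assms pos_semidef_mult_transpose[of B] pos_semidef_def[of B] by auto
  then have "(\<lambda>B. pos_semidef B \<and> B ** B = A) = (\<lambda>B. False)" by (simp add: fun_eq_iff)
  then show ?thesis unfolding matrix_sqrt_def by (rule arg_cong)
qed

lemma invertible_sqrt: "B ** B = A \<Longrightarrow> invertible A \<Longrightarrow> invertible (B :: real^'n^'n)"
  by (auto simp: invertible_det_nz det_mul)

lemma polar_decomposition: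
  fixes A :: "real^'n^'n"
  assumes "invertible A"
  obtains Q P where "orthogonal_matrix Q" "pos_semidef P" "A = Q ** P"
proof -
  have "pos_semidef (transpose A ** A)"
    using pos_semidef_mult_transpose[of "transpose A"] by simp
  then obtain P where P: "pos_semidef P" "P ** P = transpose A ** A"
    using pos_semidef_sqrt_exists by blast
  have i: "invertible P" 
    by (rule invertible_sqrt[OF P(2)]) (use assms in \<open>simp add: invertible_det_nz det_mul\<close>)
  have Ps: "transpose P = P" using P(1) by (simp add: pos_semidef_def)
  let ?R = "matrix_inv P"
  have Rs: "transpose ?R = ?R" by (metis Ps i matrix_inv_transpose)
  have "transpose (A ** ?R) ** (A ** ?R) = ?R ** (transpose A ** A) ** ?R"
    by (simp add: matrix_transpose_mul Rs matrix_mul_assoc)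
  also have "\<dots> = (?R ** P) ** (P ** ?R)" by (simp only: P(2)[symmetric] matrix_mul_assoc)
  also have "\<dots> = mat 1" by (simp add: matrix_inv_left matrix_inv_right i)
  finally have "orthogonal_matrix (A ** ?R)" by (simp add: orthogonal_matrix)
  moreover have "A = (A ** ?R) ** P"
    by (simp add: matrix_mul_assoc[symmetric] matrix_inv_left i)
  ultimately show thesis using that P(1) by blast
qed

section \<open>Measurability of matrix operations\<close>

lemma borel_measurable_vec_lambda [measurable (raw)]:
  fixes f :: "'a \<Rightarrow> 'n::finite \<Rightarrow> 'b::euclidean_space"
  assumes "\<And>i. (\<lambda>x. f x i) \<in> borel_measurable M"
  shows "(\<lambda>x. \<chi> i. f x i) \<in> borel_measurable M"
proof (subst borel_measurable_euclidean_space, intro ballI)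
  fix b :: "'b^'n" assume "b \<in> Basis"
  then obtain i u where b: "b = axis i u" by (auto simp: Basis_vec_def)
  have "(\<lambda>x. f x i \<bullet> u) \<in> borel_measurable M" using assms by measurable
  then show "(\<lambda>x. (\<chi> i. f x i) \<bullet> b) \<in> borel_measurable M" by (simp add: b inner_axis)
qed

lemma borel_measurable_vec_nth [measurable (raw)]:
  fixes f :: "'a \<Rightarrow> 'b::euclidean_space^'n"
  assumes "f \<in> borel_measurable M" shows "(\<lambda>x. f x $ i) \<in> borel_measurable M"
proof -
  have "(\<lambda>v :: 'b^'n. v $ i) \<in> borel_measurable borel"
    by (intro borel_measurable_continuous_onI continuous_intros)
  then show ?thesis using assms by measurable
qed

lemma borel_measurable_matrix_vector_mult [measurable (raw)]:
  fixes A :: "'a \<Rightarrow> real^'n^'m"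
  assumes [measurable]: "A \<in> borel_measurable M" "v \<in> borel_measurable M"
  shows "(\<lambda>x. A x *v v x) \<in> borel_measurable M"
  unfolding matrix_vector_mult_def by measurable

lemma borel_measurable_matrix_matrix_mult [measurable (raw)]:
  fixes A :: "'a \<Rightarrow> real^'n^'m" and B :: "'a \<Rightarrow> real^'k^'n"
  assumes [measurable]: "A \<in> borel_measurable M" "B \<in> borel_measurable M"
  shows "(\<lambda>x. A x ** B x) \<in> borel_measurable M"
  unfolding matrix_matrix_mult_def by measurable

lemma borel_measurable_outer [measurable (raw)]:
  fixes v :: "'a \<Rightarrow> real^'n" and w :: "'a \<Rightarrow> real^'m"
  assumes [measurable]: "v \<in> borel_measurable M" "w \<in> borel_measurable M"
  shows "(\<lambda>x. outer (v x) (w x)) \<in> borel_measurable M"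
  unfolding outer_def by measurable

lemma borel_measurable_transpose [measurable (raw)]:
  fixes A :: "'a \<Rightarrow> real^'n^'m"
  assumes [measurable]: "A \<in> borel_measurable M"
  shows "(\<lambda>x. transpose (A x)) \<in> borel_measurable M"
  unfolding transpose_def by measurable

lemma borel_measurable_trace [measurable (raw)]:
  fixes A :: "'a \<Rightarrow> real^'n^'n"
  assumes [measurable]: "A \<in> borel_measurable M"
  shows "(\<lambda>x. trace (A x)) \<in> borel_measurable M"
  unfolding trace_def by measurable

lemma borel_measurable_det [measurable (raw)]:
  fixes A :: "'a \<Rightarrow> real^'n^'n"
  assumes [measurable]: "A \<in> borel_measurable M"
  shows "(\<lambda>x. det (A x)) \<in> borel_measurable M"
  unfolding det_def by measurable

text \<open>Cramer's rule exhibits the inverse as a rational function of the entries, hence as a measurable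
  function.\<close>

lemma matrix_inv_cramer:
  fixes A :: "real^'n^'n"
  assumes "det A \<noteq> 0"
  shows "matrix_inv A = (\<chi> i j. det (\<chi> p q. if q = i then (axis j 1 :: real^'n) $ p else A $ p $ q) / det A)"
proof -
  have "A *v (matrix_inv A *v axis j 1) = axis j 1" for j
    using assms by (simp add: matrix_vector_mul_assoc matrix_inv_right invertible_det_nz)
  then have "matrix_inv A *v axis j 1 = (\<chi> k. det (\<chi> p q. if q = k then (axis j 1 :: real^'n) $ p else A $ p $ q) / det A)" for j
    using cramer[OF assms] by blast
  moreover have "(matrix_inv A *v axis j 1) $ i = matrix_inv A $ i $ j" for i j
    by (simp add: matrix_vector_mult_basis column_def)
  ultimately show ?thesis by (simp add: vec_eq_iff)
qed

lemma borel_measurable_matrix_inv [measurable (raw)]: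
  fixes A :: "'a \<Rightarrow> real^'n^'n"
  assumes [measurable]: "A \<in> borel_measurable M"
  shows "(\<lambda>x. matrix_inv (A x)) \<in> borel_measurable M"
proof -
  have "matrix_inv B = (SOME C. False)" if "det B = 0" for B :: "real^'n^'n"
  proof -
    have "\<not> (B ** C = mat 1 \<and> C ** B = mat 1)" for C
      using that by (metis det_I det_mul mult_zero_left zero_neq_one)
    then have "(\<lambda>C. B ** C = mat 1 \<and> C ** B = mat 1) = (\<lambda>C. False)" by (simp add: fun_eq_iff)
    then show ?thesis unfolding matrix_inv_def by (rule arg_cong)
  qed
  then have "matrix_inv B = (if det B = 0 then (SOME C. False) else
     (\<chi> i j. det (\<chi> p q. if q = i then (axis j 1 :: real^'n) $ p else B $ p $ q) / det B))" for B :: "real^'n^'n"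
    using matrix_inv_cramer[of B] by simp
  then show ?thesis by simp
qed

lemma closed_pos_semidef: "closed {A :: real^'n^'n. pos_semidef A}"
proof -
  have "{A :: real^'n^'n. pos_semidef A} =
      (\<Inter>i. \<Inter>j. {A. A $ i $ j = A $ j $ i}) \<inter> (\<Inter>v. {A. v \<bullet> (A *v v) \<ge> 0})"
    by (auto simp: pos_semidef_def transpose_def vec_eq_iff)
  moreover have "continuous_on UNIV (\<lambda>A :: real^'n^'n. v \<bullet> (A *v v))" for v
    unfolding matrix_vector_mult_def by (intro continuous_intros)
  ultimately show ?thesis
    by (simp only:) (intro closed_Int closed_INT ballI closed_Collect_eq closed_Collect_le continuous_on_const,
      auto intro!: continuous_intros)
qed

lemma pos_semidef_measurable [measurable]: "Measurable.pred borel (\<lambda>A :: real^'n^'n. pos_semidef A)"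
  using borel_closed[OF closed_pos_semidef] by (simp add: pred_def)

lemma pos_def_iff_semidef_det: "pos_def A \<longleftrightarrow> pos_semidef A \<and> det A \<noteq> 0"
proof
  assume "pos_def A"
  then show "pos_semidef A \<and> det A \<noteq> 0" using pos_def_imp_semidef det_pos_def by fastforce
next
  assume A: "pos_semidef A \<and> det A \<noteq> 0"
  then obtain B where B: "pos_semidef B" "B ** B = A" using pos_semidef_sqrt_exists by blast
  then have s: "transpose B = B" by (simp add: pos_semidef_def)
  have "invertible B" using A B(2) invertible_sqrt invertible_det_nz by blast
  then have "pos_def (B ** mat 1 ** transpose B)" by (intro pos_def_congruence pos_def_mat_1)
  then show "pos_def A" by (simp add: s B(2))
qed

lemma pos_def_measurable [measurable]: "Measurable.pred borel (\<lambda>A :: real^'n^'n. pos_def A)"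
  unfolding pos_def_iff_semidef_det by measurable

text \<open>Squaring maps compact sets of positive semidefinite matrices to compact sets, so the preimage of a
  closed set under the square root is a countable union of compact sets.\<close>

lemma borel_measurable_matrix_sqrt_borel: "(matrix_sqrt :: real^'n^'n \<Rightarrow> _) \<in> borel_measurable borel"
proof (rule borel_measurableI)
  fix S :: "(real^'n^'n) set" assume "open S"
  define K where "K = - S"
  have K: "closed K" using \<open>open S\<close> by (simp add: K_def closed_Compl)
  let ?PS = "{A :: real^'n^'n. pos_semidef A}"
  let ?U = "\<Union>n::nat. (\<lambda>B. B ** B) ` (K \<inter> ?PS \<inter> cball 0 (real n))"
  have eq: "{A. pos_semidef A \<and> matrix_sqrt A \<in> K} = ?U"
  proof safe
    fix A :: "real^'n^'n" assume A: "pos_semidef A" "matrix_sqrt A \<in> K"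
    obtain n where "norm (matrix_sqrt A) \<le> real n" using real_arch_simple by blast
    then show "A \<in> ?U" using A pos_semidef_matrix_sqrt[OF A(1)] matrix_sqrt_square[OF A(1)]
      by (intro UN_I[of n] UNIV_I image_eqI[of _ _ "matrix_sqrt A"]) auto
  next
    fix B :: "real^'n^'n" assume B: "pos_semidef B" "B \<in> K"
    have "pos_semidef (B ** B)" using B(1) pos_semidef_mult_transpose[of B] by (simp add: pos_semidef_def)
    then show "pos_semidef (B ** B)" .
    show "matrix_sqrt (B ** B) \<in> K" using matrix_sqrt_eqI[OF B(1) refl] B(2) by simp
  qed
  have "compact ((\<lambda>B. B ** B) ` (K \<inter> ?PS \<inter> cball 0 (real n)))" for n
    unfolding matrix_matrix_mult_def
    by (intro compact_continuous_image continuous_intros closed_Int_compact closed_Int K closed_pos_semidef compact_cball)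
  then have "?U \<in> sets borel" by (intro sets.countable_UN) (auto intro: compact_imp_closed borel_closed)
  then have 1: "{A. pos_semidef A \<and> matrix_sqrt A \<in> K} \<in> sets borel" using eq by simp
  have "matrix_sqrt -` S = - ({A. pos_semidef A \<and> matrix_sqrt A \<in> K} \<union>
     (if (THE B. False) \<in> K then - ?PS else {}))"
  proof -
    have "x \<in> matrix_sqrt -` S \<longleftrightarrow> x \<in> - ({A. pos_semidef A \<and> matrix_sqrt A \<in> K} \<union>
        (if (THE B. False) \<in> K then - ?PS else {}))" for x
      using matrix_sqrt_not_pos_semidef[of x] by (cases "pos_semidef x") (auto simp: K_def)
    then show ?thesis by blast
  qed
  moreover have "?PS \<in> sets borel" by (rule borel_closed[OF closed_pos_semidef])
  ultimately show "matrix_sqrt -` S \<inter> space borel \<in> sets borel" using 1 by auto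
qed

lemma borel_measurable_matrix_sqrt [measurable (raw)]:
  fixes A :: "'a \<Rightarrow> real^'n^'n"
  assumes "A \<in> borel_measurable M"
  shows "(\<lambda>x. matrix_sqrt (A x)) \<in> borel_measurable M"
  using assms borel_measurable_matrix_sqrt_borel by (rule measurable_compose)

section \<open>Uniqueness of translation-invariant measures and Jacobians\<close>

text \<open>The set \<open>V\<close> carries the measure and supplies the translations. It is all of the space for Lebesgue
  measure and the subspace of symmetric matrices for \<open>lebesgue_sym\<close>, which is concentrated on it.\<close>

definition translation_invariant :: "'a::euclidean_space set \<Rightarrow> 'a measure \<Rightarrow> bool" where
  "translation_invariant V M \<longleftrightarrow> sigma_finite_measure M \<and> sets M = sets borel \<and> (AE x in M. x \<in> V) \<and>
     (\<forall>v\<in>V. - v \<in> V \<and> distr M borel (\<lambda>x. v + x) = M)"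

lemma translation_invariant_nn_integral:
  assumes "translation_invariant V M" "v \<in> V" "f \<in> borel_measurable borel"
  shows "(\<integral>\<^sup>+x. f (v + x) \<partial>M) = (\<integral>\<^sup>+x. f x \<partial>M)"
proof -
  have s: "sets M = sets borel" and d: "distr M borel (\<lambda>x. v + x) = M"
    using assms unfolding translation_invariant_def by auto
  have "(\<lambda>x. v + x) \<in> measurable M borel" by (simp cong: measurable_cong_sets add: s)
  then have "(\<integral>\<^sup>+x. f x \<partial>distr M borel (\<lambda>x. v + x)) = (\<integral>\<^sup>+x. f (v + x) \<partial>M)"
    using assms(3) by (simp add: nn_integral_distr)
  then show ?thesis using d by simp
qed

text \<open>Haar measure is unique: \<open>M'\<close> is a constant multiple of \<open>M\<close>, since a fixed \<open>g\<close> determines the factor. The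
  proof translates the inner variable of the double integral \<open>\<integral>\<integral> f x g y\<close> twice, with Fubini's theorem
  in between.\<close>

lemma translation_invariant_proportional:
  fixes M M' :: "'a::euclidean_space measure"
  assumes M: "translation_invariant V M" and M': "translation_invariant V M'"
    and [measurable]: "f \<in> borel_measurable borel" "g \<in> borel_measurable borel"
  shows "(\<integral>\<^sup>+x. f x \<partial>M') * (\<integral>\<^sup>+x. g x \<partial>M) = (\<integral>\<^sup>+x. f x \<partial>M) * (\<integral>\<^sup>+x. g (- x) \<partial>M')"
proof -
  have sM [measurable_cong]: "sets M = sets borel" "sets M' = sets borel"
    and sf: "sigma_finite_measure M" "sigma_finite_measure M'"
    and ae: "AE x in M. x \<in> V" "AE x in M'. x \<in> V" and neg: "\<And>v. v \<in> V \<Longrightarrow> - v \<in> V"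
    using M M' by (auto simp: translation_invariant_def)
  interpret pair_sigma_finite M' M using sf by (simp add: pair_sigma_finite_def)
  have "(\<integral>\<^sup>+x. f x \<partial>M') * (\<integral>\<^sup>+x. g x \<partial>M) = (\<integral>\<^sup>+x. f x * (\<integral>\<^sup>+y. g y \<partial>M) \<partial>M')"
    by (simp add: nn_integral_multc)
  also have "\<dots> = (\<integral>\<^sup>+x. f x * (\<integral>\<^sup>+y. g (- x + y) \<partial>M) \<partial>M')"
    by (intro nn_integral_cong_AE eventually_mono[OF ae(2)])
       (simp only: translation_invariant_nn_integral[OF M neg assms(4)])
  also have "\<dots> = (\<integral>\<^sup>+x. (\<integral>\<^sup>+y. f x * g (- x + y) \<partial>M) \<partial>M')"
    by (simp add: nn_integral_cmult)
  also have "\<dots> = (\<integral>\<^sup>+y. (\<integral>\<^sup>+x. f x * g (- x + y) \<partial>M') \<partial>M)"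
    by (rule Fubini'[symmetric]) measurable
  also have "\<dots> = (\<integral>\<^sup>+y. (\<integral>\<^sup>+x. f (y + x) * g (- (y + x) + y) \<partial>M') \<partial>M)"
  proof (rule nn_integral_cong_AE, rule eventually_mono[OF ae(1)])
    fix y assume y: "y \<in> V"
    have "(\<lambda>x. f x * g (- x + y)) \<in> borel_measurable borel" by measurable
    from translation_invariant_nn_integral[OF M' y this, symmetric]
    show "(\<integral>\<^sup>+x. f x * g (- x + y) \<partial>M') = (\<integral>\<^sup>+x. f (y + x) * g (- (y + x) + y) \<partial>M')" .
  qed
  also have "\<dots> = (\<integral>\<^sup>+y. (\<integral>\<^sup>+x. f (y + x) * g (- x) \<partial>M') \<partial>M)" by simp
  also have "\<dots> = (\<integral>\<^sup>+x. (\<integral>\<^sup>+y. f (y + x) * g (- x) \<partial>M) \<partial>M')"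
    by (rule Fubini') measurable
  also have "\<dots> = (\<integral>\<^sup>+x. (\<integral>\<^sup>+y. f (x + y) \<partial>M) * g (- x) \<partial>M')"
    by (simp add: nn_integral_multc add.commute)
  also have "\<dots> = (\<integral>\<^sup>+x. (\<integral>\<^sup>+y. f y \<partial>M) * g (- x) \<partial>M')"
    by (intro nn_integral_cong_AE eventually_mono[OF ae(2)])
       (simp only: translation_invariant_nn_integral[OF M _ assms(3)])
  finally show ?thesis by (simp add: nn_integral_cmult)
qed

text \<open>The substitution rule for \<open>T\<close> with a constant factor; for a linear map of Euclidean space the
  factor is the absolute value of the determinant.\<close>

definition has_jacobian :: "'a::euclidean_space measure \<Rightarrow> ('a \<Rightarrow> 'a) \<Rightarrow> real \<Rightarrow> bool" where
  "has_jacobian M T c \<longleftrightarrow>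
     (\<forall>f\<in>borel_measurable borel. (\<integral>\<^sup>+x. f x \<partial>M) = ennreal c * (\<integral>\<^sup>+x. f (T x) \<partial>M))"

lemma has_jacobianD:
  "has_jacobian M T c \<Longrightarrow> f \<in> borel_measurable borel \<Longrightarrow> (\<integral>\<^sup>+x. f x \<partial>M) = ennreal c * (\<integral>\<^sup>+x. f (T x) \<partial>M)"
  unfolding has_jacobian_def by blast

text \<open>The image of a translation-invariant measure under a linear automorphism of the set of translations
  is translation invariant again, hence proportional to the original measure. The factor can be read
  off any single function whose integrals before and after the substitution are known.\<close>

lemma has_jacobianI:
  fixes M :: "'a::euclidean_space measure"
  assumes M: "translation_invariant V M" and T: "linear T" "linear T'" "\<And>x. T (T' x) = x"
    and V: "\<And>v. v \<in> V \<Longrightarrow> T v \<in> V" "\<And>v. v \<in> V \<Longrightarrow> T' v \<in> V"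
    and g [measurable]: "g \<in> borel_measurable borel"
    and fin: "(\<integral>\<^sup>+x. g (T x) \<partial>M) \<noteq> 0" "(\<integral>\<^sup>+x. g (T x) \<partial>M) \<noteq> \<infinity>"
    and c: "(\<integral>\<^sup>+x. g (- x) \<partial>M) = ennreal c * (\<integral>\<^sup>+x. g (T x) \<partial>M)"
  shows "has_jacobian M T c"
proof -
  have sM [measurable_cong]: "sets M = sets borel" and sf: "sigma_finite_measure M"
    and ae: "AE x in M. x \<in> V" and neg: "\<And>v. v \<in> V \<Longrightarrow> - v \<in> V"
    using M by (auto simp: translation_invariant_def)
  have Tm [measurable]: "T \<in> borel_measurable borel" "T' \<in> borel_measurable borel"
    using T by (auto intro!: borel_measurable_continuous_onI simp: linear_continuous_on linear_conv_bounded_linear)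
  have TT: "T' (T x) = x" for x
    using T by (metis (no_types, opaque_lifting) linear_surjective_imp_injective injD surjI)
  define N where "N = distr M borel T"
  have N: "translation_invariant V N"
    unfolding translation_invariant_def
  proof (intro conjI ballI)
    show "sets N = sets borel" by (simp add: N_def)
    have "AE x in M. T x \<in> V" using ae V(1) by auto
    obtain Z where Z: "Z \<in> null_sets M" "{x \<in> space M. x \<notin> V} \<subseteq> Z" using ae by (auto simp: eventually_ae_filter)
    have "T' -` Z \<in> null_sets N"
    proof -
      have zb: "Z \<in> sets borel" using Z(1) sM by auto
      then have "T' -` Z \<in> sets borel" using measurable_sets[OF Tm(2), of Z] by simp
      moreover have "emeasure N (T' -` Z) = emeasure M Z"
        unfolding N_def using zb \<open>T' -` Z \<in> sets borel\<close> TT sM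
        by (subst emeasure_distr) (auto simp: vimage_def sets_eq_imp_space_eq[OF sM])
      ultimately show ?thesis using Z(1) by (auto simp: null_sets_def N_def)
    qed
    moreover have "{x \<in> space N. x \<notin> V} \<subseteq> T' -` Z"
      using Z(2) V(1) T(3) sets_eq_imp_space_eq[OF sM] by (auto simp: N_def) (metis subsetD mem_Collect_eq)
    ultimately show "AE x in N. x \<in> V" by (rule AE_I')
    show "sigma_finite_measure N"
    proof
      obtain A where A: "countable A" "A \<subseteq> sets M" "\<Union>A = space M" "\<forall>a\<in>A. emeasure M a \<noteq> \<infinity>"
        using sf sigma_finite_measure.sigma_finite_countable by metis
      have eN: "emeasure N (T' -` a) = emeasure M a" if "a \<in> sets M" for a
        unfolding N_def using measurable_sets[OF Tm(2), of a] that TT sM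
        by (subst emeasure_distr) (auto simp: vimage_def sets_eq_imp_space_eq[OF sM])
      then have e: "\<forall>b\<in>(\<lambda>a. T' -` a) ` A. emeasure N b \<noteq> \<infinity>" using A(2,4) by (auto simp: eN subset_eq)
      have "T' -` a \<in> sets N" if "a \<in> A" for a
        using measurable_sets[OF Tm(2), of a] that A(2) sM by (auto simp: N_def)
      then have "(\<lambda>a. T' -` a) ` A \<subseteq> sets N" by blast
      moreover have "\<Union>((\<lambda>a. T' -` a) ` A) = space N"
        using A(3) sets_eq_imp_space_eq[OF sM] unfolding N_def by (simp flip: vimage_Union)
      ultimately show "\<exists>A. countable A \<and> A \<subseteq> sets N \<and> \<Union>A = space N \<and> (\<forall>a\<in>A. emeasure N a \<noteq> \<infinity>)"
        using A(1) e countable_image by blast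
    qed
    fix v assume v: "v \<in> V"
    show "- v \<in> V" using neg v .
    have "distr N borel (\<lambda>x. v + x) = distr M borel (\<lambda>x. v + T x)"
      unfolding N_def by (subst distr_distr) (auto simp: comp_def)
    also have "\<dots> = distr M borel (\<lambda>x. T (T' v + x))"
      using T by (simp add: linear_add)
    also have "\<dots> = distr (distr M borel (\<lambda>x. T' v + x)) borel T"
      by (subst distr_distr) (auto simp: comp_def)
    also have "distr M borel (\<lambda>x. T' v + x) = M" using M V(2)[OF v] by (simp add: translation_invariant_def)
    finally show "distr N borel (\<lambda>x. v + x) = N" by (simp add: N_def)
  qed
  have "(\<integral>\<^sup>+x. f x \<partial>M) = ennreal c * (\<integral>\<^sup>+x. f (T x) \<partial>M)" if [measurable]: "f \<in> borel_measurable borel" for f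
  proof -
    have nN: "(\<integral>\<^sup>+x. h x \<partial>N) = (\<integral>\<^sup>+x. h (T x) \<partial>M)" if [measurable]: "h \<in> borel_measurable borel" for h
      unfolding N_def by (subst nn_integral_distr) auto
    have "(\<integral>\<^sup>+x. f x \<partial>M) * (\<integral>\<^sup>+x. g x \<partial>N) = (\<integral>\<^sup>+x. f x \<partial>N) * (\<integral>\<^sup>+x. g (- x) \<partial>M)"
      by (rule translation_invariant_proportional[OF N M]) measurable
    then have eq: "(\<integral>\<^sup>+x. f x \<partial>M) * (\<integral>\<^sup>+x. g (T x) \<partial>M) = (ennreal c * (\<integral>\<^sup>+x. f (T x) \<partial>M)) * (\<integral>\<^sup>+x. g (T x) \<partial>M)"
      by (simp add: nN c mult_ac)
    have "(a :: ennreal) * d = b * d \<Longrightarrow> d \<noteq> 0 \<Longrightarrow> d \<noteq> \<infinity> \<Longrightarrow> a = b" for a b d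
      by (metis ennreal_mult_divide_eq infinity_ennreal_def)
    then show ?thesis using eq fin by blast
  qed
  then show ?thesis unfolding has_jacobian_def by blast
qed

text \<open>By the polar decomposition and the spectral theorem, every invertible matrix is a product of rotations
  and of positive scalings of single axes. So a multiplicative factor is determined by its values on
  these.\<close>

lemma multiplicative_factor_eq_det_power:
  fixes R :: "real^'n^'n \<Rightarrow> real \<Rightarrow> bool"
  assumes mult: "\<And>A B a b. R A a \<Longrightarrow> R B b \<Longrightarrow> 0 \<le> a \<Longrightarrow> 0 \<le> b \<Longrightarrow> R (A ** B) (a * b)"
    and orth: "\<And>Q. orthogonal_matrix Q \<Longrightarrow> R Q 1"
    and axis: "\<And>i t. t > 0 \<Longrightarrow> R (diag_matrix (\<lambda>j. if j = i then t else 1)) (t ^ m)"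
    and inv: "invertible A"
  shows "R A (\<bar>det A\<bar> ^ m)"
proof -
  have diag: "R (diag_matrix (\<lambda>j. if j \<in> I then d j else 1)) ((\<Prod>j\<in>I. d j) ^ m)"
    if "\<And>j. d j > 0" for d and I :: "'n set"
    using finite[of I]
  proof (induction I)
    case empty
    have "diag_matrix (\<lambda>j. 1) = (mat 1 :: real^'n^'n)" by (simp add: diag_matrix_def mat_def)
    then show ?case using orth[OF orthogonal_matrix_id] by simp
  next
    case (insert i I)
    have "R (diag_matrix (\<lambda>j. if j = i then d i else 1) ** diag_matrix (\<lambda>j. if j \<in> I then d j else 1))
       (d i ^ m * (\<Prod>j\<in>I. d j) ^ m)"
      using that by (intro mult axis insert.IH zero_le_power prod_nonneg) (auto intro: less_imp_le)
    moreover have "(\<lambda>j. (if j = i then d i else 1) * (if j \<in> I then d j else 1)) = (\<lambda>j. if j \<in> insert i I then d j else 1)"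
      using insert.hyps by auto
    ultimately show ?case using insert.hyps by (simp add: diag_matrix_mul power_mult_distrib)
  qed
  obtain Q P where QP: "orthogonal_matrix Q" "pos_semidef P" "A = Q ** P"
    using polar_decomposition[OF inv] by blast
  obtain U d where U: "orthogonal_matrix U" "P = U ** diag_matrix d ** transpose U" "\<And>i. d i \<ge> 0"
    using spectral_theorem_pos_semidef[OF QP(2)] by blast
  have UU: "det U * det (transpose U) = 1"
    using U(1) by (metis det_I det_mul orthogonal_matrix_def)
  then have dP: "det P = (\<Prod>i\<in>UNIV. d i)" by (simp add: U(2) det_mul det_diag_matrix)
  have "det A \<noteq> 0" using inv invertible_det_nz by blast
  then have "det P \<noteq> 0" by (auto simp: QP(3) det_mul)
  then have "d i > 0" for i using dP U(3)[of i] by (metis UNIV_I finite less_eq_real_def prod_zero)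
  then have "R (diag_matrix d) ((\<Prod>i\<in>UNIV. d i) ^ m)" using diag[of d UNIV] by simp
  then have "R (Q ** (U ** diag_matrix d ** transpose U)) (1 * (1 * (\<Prod>i\<in>UNIV. d i) ^ m * 1))"
    using U by (intro mult orth QP(1) zero_le_power prod_nonneg mult_nonneg_nonneg) auto
  moreover have "\<bar>det A\<bar> = \<bar>det P\<bar>" using det_orthogonal_matrix[OF QP(1)] by (auto simp: QP(3) det_mul abs_mult)
  ultimately show ?thesis using U(3) by (simp add: QP(3) U(2) dP[unfolded U(2)] prod_nonneg)
qed

subsection \<open>Lebesgue measure on Euclidean space\<close>

lemma translation_invariant_lborel: "translation_invariant UNIV (lborel :: 'a::euclidean_space measure)"
  by (simp add: translation_invariant_def sigma_finite_lborel lborel_distr_plus)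

text \<open>Both sides of the substitution agree on the indicator function of the unit ball.\<close>

lemma has_jacobian_lborel_orthogonal:
  fixes T :: "'a::euclidean_space \<Rightarrow> 'a"
  assumes T: "orthogonal_transformation T"
  shows "has_jacobian lborel T 1"
proof (rule has_jacobianI[OF translation_invariant_lborel, where T' = "inv T" and g = "indicator (cball 0 1)"])
  show "linear T" "linear (inv T)" using T orthogonal_transformation_linear orthogonal_transformation_inv by blast+
  show "T (inv T x) = x" for x using T by (meson orthogonal_transformation_surj surj_f_inv_f)
  have *: "(\<integral>\<^sup>+x. indicator (cball (0::'a) 1) x \<partial>lborel) = emeasure lborel (cball (0::'a) 1)" by simp
  have T1: "indicator (cball 0 1) (T x) = (indicator (cball 0 1) x :: ennreal)"
    and T2: "indicator (cball 0 1) (- x) = (indicator (cball 0 1) x :: ennreal)" for x :: 'a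
    using orthogonal_transformation_norm[OF T] by (auto simp: indicator_def)
  have fin: "emeasure lborel (cball (0::'a) 1) \<noteq> \<infinity>"
    using emeasure_lborel_cball_finite[of "0::'a" 1] by simp
  have pos: "emeasure lborel (cball (0::'a) 1) \<noteq> 0"
    using content_cball_pos[of 1 "0::'a"] by (auto simp: measure_def)
  show "(\<integral>\<^sup>+x. indicator (cball 0 1) (T x) \<partial>lborel) \<noteq> 0" unfolding T1 * using pos .
  show "(\<integral>\<^sup>+x. indicator (cball 0 1) (T x) \<partial>lborel) \<noteq> \<infinity>" unfolding T1 * using fin .
  show "(\<integral>\<^sup>+x. indicator (cball (0::'a) 1) (- x) \<partial>lborel) = ennreal 1 * (\<integral>\<^sup>+x. indicator (cball 0 1) (T x) \<partial>lborel)"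
    unfolding T1 T2 by simp
  show "indicator (cball 0 1) \<in> borel_measurable (borel :: 'a measure)"
    by (rule borel_measurable_indicator, rule borel_closed, rule closed_cball)
qed auto

lemma has_jacobian_compose:
  assumes "has_jacobian M S a" "has_jacobian M T b" "0 \<le> a" "S \<in> borel_measurable borel"
  shows "has_jacobian M (\<lambda>x. S (T x)) (a * b)"
  unfolding has_jacobian_def
proof
  fix f :: "'a \<Rightarrow> ennreal" assume [measurable]: "f \<in> borel_measurable borel"
  note [measurable] = assms(4)
  have "(\<integral>\<^sup>+x. f x \<partial>M) = ennreal a * (\<integral>\<^sup>+x. f (S x) \<partial>M)"
    by (rule has_jacobianD[OF assms(1)]) measurable
  also have "(\<integral>\<^sup>+x. f (S x) \<partial>M) = ennreal b * (\<integral>\<^sup>+x. f (S (T x)) \<partial>M)"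
    by (rule has_jacobianD[OF assms(2)]) measurable
  finally show "(\<integral>\<^sup>+x. f x \<partial>M) = ennreal (a * b) * (\<integral>\<^sup>+x. f (S (T x)) \<partial>M)"
    using assms(3) by (simp add: ennreal_mult' mult.assoc)
qed

lemma has_jacobian_lborel_affine:
  assumes "c \<noteq> 0" shows "has_jacobian lborel (\<lambda>x :: 'a::euclidean_space. t + c *\<^sub>R x) (\<bar>c\<bar> ^ DIM('a))"
  unfolding has_jacobian_def
proof
  fix f :: "'a \<Rightarrow> ennreal" assume [measurable]: "f \<in> borel_measurable borel"
  show "(\<integral>\<^sup>+x. f x \<partial>lborel) = ennreal (\<bar>c\<bar> ^ DIM('a)) * (\<integral>\<^sup>+x. f (t + c *\<^sub>R x) \<partial>lborel)"
    by (subst lborel_affine[OF assms, of t])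
       (simp add: nn_integral_density nn_integral_distr nn_integral_cmult)
qed

theorem has_jacobian_lborel_matrix:
  fixes A :: "real^'n^'n"
  assumes "invertible A"
  shows "has_jacobian lborel (\<lambda>x. A *v x) \<bar>det A\<bar>"
proof -
  have "has_jacobian lborel (\<lambda>x. A *v x) (\<bar>det A\<bar> ^ 1)"
  proof (rule multiplicative_factor_eq_det_power[OF _ _ _ assms])
    fix A B :: "real^'n^'n" and a b :: real
    assume "has_jacobian lborel ((*v) A) a" "has_jacobian lborel ((*v) B) b" "0 \<le> a"
    from has_jacobian_compose[OF this] show "has_jacobian lborel ((*v) (A ** B)) (a * b)"
      by (simp add: matrix_vector_mul_assoc)
  next
    fix Q :: "real^'n^'n" assume "orthogonal_matrix Q"
    then have "orthogonal_transformation ((*v) Q)"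
      by (simp add: orthogonal_transformation_matrix)
    then show "has_jacobian lborel ((*v) Q) 1" by (rule has_jacobian_lborel_orthogonal)
  next
    fix i :: 'n and t :: real assume t: "t > 0"
    define d where "d = diag_matrix (\<lambda>j. if j = i then t else 1)"
    define c where "c = (\<lambda>b :: real^'n. if b = axis i 1 then t else 1)"
    have c: "c b \<noteq> 0" for b using t by (simp add: c_def)
    have T: "0 + (\<Sum>j\<in>Basis. (c j * (x \<bullet> j)) *\<^sub>R j) = d *v x" for x
    proof -
      have "(\<Sum>j\<in>Basis. (c j * (x \<bullet> j)) *\<^sub>R j) = (\<Sum>j\<in>UNIV. (c (axis j 1) * (x $ j)) *\<^sub>R axis j 1)"
      proof -
        have "Basis = range (\<lambda>j::'n. axis j (1::real))" by (auto simp: Basis_vec_def)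
        moreover have "inj (\<lambda>j::'n. axis j (1::real))" by (auto simp: inj_def axis_eq_axis)
        ultimately show ?thesis
          using sum.reindex[of "\<lambda>j::'n. axis j (1::real)" UNIV "\<lambda>j. (c j * (x \<bullet> j)) *\<^sub>R j"]
          by (simp add: inner_axis)
      qed
      also have "\<dots> = d *v x"
      proof (subst vec_eq_iff, intro allI)
        fix p
        have "(\<Sum>j\<in>UNIV. (c (axis j 1) * (x $ j)) *\<^sub>R axis j 1) $ p =
            (\<Sum>j\<in>UNIV. if j = p then c (axis p 1) * x $ p else 0)"
          unfolding sum_component by (rule sum.cong) (auto simp: axis_def)
        then show "(\<Sum>j\<in>UNIV. (c (axis j 1) * (x $ j)) *\<^sub>R axis j 1) $ p = (d *v x) $ p"
          by (simp add: d_def diag_matrix_mult_vec c_def axis_eq_axis)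
      qed
      finally show ?thesis by simp
    qed
    have "(\<Prod>j\<in>Basis. \<bar>c j\<bar>) = (\<Prod>j\<in>Basis. if j = (axis i 1 :: real^'n) then t else 1)"
      using t by (intro prod.cong) (auto simp: c_def)
    also have "\<dots> = t" by (simp add: axis_in_Basis_iff)
    finally have P: "(\<Prod>j\<in>Basis. \<bar>c j\<bar>) = t" .
    show "has_jacobian lborel ((*v) (diag_matrix (\<lambda>j. if j = i then t else 1))) (t ^ 1)"
      unfolding has_jacobian_def d_def[symmetric]
    proof
      fix f :: "real^'n \<Rightarrow> ennreal" assume [measurable]: "f \<in> borel_measurable borel"
      show "(\<integral>\<^sup>+x. f x \<partial>lborel) = ennreal (t ^ 1) * (\<integral>\<^sup>+x. f (d *v x) \<partial>lborel)"
        by (subst lborel_affine_euclidean[of c 0, OF c], unfold T P)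
           (simp add: nn_integral_density nn_integral_distr nn_integral_cmult)
    qed
  qed
  then show ?thesis by simp
qed

subsection \<open>Lebesgue measure on symmetric matrices\<close>

definition sym_entries :: "'n::finite set set" where
  "sym_entries = {{i, j} | i j. True}"

definition sym_of_entries :: "('n set \<Rightarrow> real) \<Rightarrow> real^'n^'n" where
  "sym_of_entries s = (\<chi> i j. s {i, j})"

abbreviation entries_measure :: "('n::finite set \<Rightarrow> real) measure" where
  "entries_measure \<equiv> \<Pi>\<^sub>M e\<in>sym_entries. (lborel :: real measure)"

lemma finite_sym_entries [simp]: "finite (sym_entries :: 'n::finite set set)"
  by (rule finite_subset[of _ UNIV]) auto

lemma pair_in_sym_entries [simp]: "{i, j} \<in> sym_entries"
  by (auto simp: sym_entries_def)

lemma lebesgue_sym_eq: "lebesgue_sym = distr entries_measure borel sym_of_entries"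
  by (simp add: lebesgue_sym_def sym_entries_def sym_of_entries_def[abs_def])

interpretation entries: product_sigma_finite "\<lambda>_::'n::finite set. (lborel :: real measure)" ..

lemma measurable_sym_of_entries [measurable]: "(sym_of_entries :: _ \<Rightarrow> real^'n^'n) \<in> borel_measurable entries_measure"
proof -
  have "(\<lambda>s. s {i, j}) \<in> borel_measurable (entries_measure :: ('n set \<Rightarrow> real) measure)" for i j :: 'n
    using measurable_component_singleton[of "{i, j}" sym_entries "\<lambda>_. lborel :: real measure"] by simp
  then show ?thesis unfolding sym_of_entries_def[abs_def] by measurable
qed

lemma sets_lebesgue_sym [measurable_cong, simp]: "sets lebesgue_sym = sets borel"
  by (simp add: lebesgue_sym_eq)

lemma space_lebesgue_sym [simp]: "space lebesgue_sym = UNIV"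
  by (simp add: lebesgue_sym_eq)

lemma nn_integral_lebesgue_sym:
  "f \<in> borel_measurable borel \<Longrightarrow> (\<integral>\<^sup>+X. f X \<partial>lebesgue_sym) = (\<integral>\<^sup>+s. f (sym_of_entries s) \<partial>entries_measure)"
  unfolding lebesgue_sym_eq by (rule nn_integral_distr) auto

lemma AE_lebesgue_sym_symmetric: "AE X in lebesgue_sym. transpose X = X"
  unfolding lebesgue_sym_eq
  by (subst AE_distr_iff) (auto simp: sym_of_entries_def transpose_def insert_commute)

text \<open>Boxes in the entries are the test sets from which all constants for \<open>lebesgue_sym\<close> are computed.\<close>

lemma emeasure_lebesgue_sym_box:
  fixes a b :: "'n::finite set \<Rightarrow> real"
  assumes "\<And>e. a e \<le> b e"
  shows "emeasure lebesgue_sym {X. \<forall>i j. a {i, j} \<le> X $ i $ j \<and> X $ i $ j \<le> b {i, j}} =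
    ennreal (\<Prod>e\<in>sym_entries. b e - a e)"
proof -
  let ?B = "{X :: real^'n^'n. \<forall>i j. a {i, j} \<le> X $ i $ j \<and> X $ i $ j \<le> b {i, j}}"
  have "?B \<in> sets borel" by measurable
  then have "emeasure lebesgue_sym ?B = emeasure entries_measure (sym_of_entries -` ?B \<inter> space entries_measure)"
    unfolding lebesgue_sym_eq by (subst emeasure_distr) auto
  also have "sym_of_entries -` ?B \<inter> space entries_measure = Pi\<^sub>E sym_entries (\<lambda>e. {a e..b e})"
    by (auto simp: sym_of_entries_def space_PiM PiE_def Pi_def sym_entries_def)
  also have "emeasure entries_measure \<dots> = (\<Prod>e\<in>sym_entries. emeasure lborel {a e..b e})"
    by (rule entries.emeasure_PiM) auto
  also have "\<dots> = ennreal (\<Prod>e\<in>sym_entries. b e - a e)"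
    using assms by (simp add: prod_ennreal)
  finally show ?thesis .
qed

lemma entry_le_norm: "\<bar>X $ i $ j\<bar> \<le> norm (X :: real^'n^'m)"
  by (rule order_trans[OF component_le_norm_cart Finite_Cartesian_Product.norm_nth_le])

lemma translation_invariant_lebesgue_sym: "translation_invariant {X. transpose X = X} lebesgue_sym"
  unfolding translation_invariant_def
proof (intro conjI ballI)
  show "AE X in lebesgue_sym. X \<in> {X. transpose X = X}" using AE_lebesgue_sym_symmetric by simp
  show "sigma_finite_measure (lebesgue_sym :: (real^'n^'n) measure)"
  proof
    let ?B = "\<lambda>n::nat. {X :: real^'n^'n. \<forall>i j. - real n \<le> X $ i $ j \<and> X $ i $ j \<le> real n}"
    have b: "?B n \<in> sets borel" for n by measurable
    have e: "emeasure lebesgue_sym (?B n) \<noteq> \<infinity>" for n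
      using emeasure_lebesgue_sym_box[of "\<lambda>_::'n set. - real n" "\<lambda>_. real n"] by simp
    have "\<exists>n. X \<in> ?B n" for X
    proof -
      obtain n where n: "norm X \<le> real n" using real_arch_simple by blast
      have "\<bar>X $ i $ j\<bar> \<le> real n" for i j using entry_le_norm[of X i j] n by linarith
      then show ?thesis by (intro exI[of _ n]) (auto simp: abs_le_iff minus_le_iff)
    qed
    then have "\<Union>(range ?B) = UNIV" by blast
    with b e show "\<exists>A. countable A \<and> A \<subseteq> sets (lebesgue_sym :: (real^'n^'n) measure) \<and> \<Union>A = space lebesgue_sym \<and> (\<forall>a\<in>A. emeasure lebesgue_sym a \<noteq> \<infinity>)"
      by (intro exI[of _ "range ?B"]) auto
  qed
  fix v :: "real^'n^'n" assume v: "v \<in> {X. transpose X = X}"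
  show "- v \<in> {X. transpose X = X}" using v by (auto simp: transpose_def vec_eq_iff)
  have vs: "v $ i $ j = v $ j $ i" for i j using v by (auto simp: transpose_def vec_eq_iff)
  (* The entries of the symmetric matrix v as a function of the unordered index pairs. *)
  define w where "w = (\<lambda>e :: 'n set. SOME a. \<exists>i j. e = {i, j} \<and> a = v $ i $ j)"
  have w: "w {i, j} = v $ i $ j" for i j
    unfolding w_def by (rule some_equality) (auto simp: doubleton_eq_iff vs)
  let ?t = "\<lambda>s. \<lambda>e\<in>sym_entries. w e + s e"
  have t [measurable]: "?t \<in> measurable entries_measure entries_measure"
    by (rule measurable_restrict) (simp, measurable)
  have "distr entries_measure entries_measure ?t = entries_measure"
  proof (rule entries.PiM_eqI)
    fix A :: "'n set \<Rightarrow> real set" assume A: "\<And>e. e \<in> sym_entries \<Longrightarrow> A e \<in> sets lborel"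
    let ?A' = "\<lambda>e. (\<lambda>x. w e + x) -` A e"
    have A': "?A' e \<in> sets lborel" if "e \<in> sym_entries" for e
      using measurable_sets[of "(+) (w e)" borel borel "A e"] A[OF that] by simp
    have "emeasure (distr entries_measure entries_measure ?t) (Pi\<^sub>E sym_entries A) =
        emeasure entries_measure (?t -` Pi\<^sub>E sym_entries A \<inter> space entries_measure)"
      using A by (intro emeasure_distr t sets_PiM_I_finite) auto
    also have "?t -` Pi\<^sub>E sym_entries A \<inter> space entries_measure = Pi\<^sub>E sym_entries ?A'"
      by (auto simp: space_PiM PiE_def Pi_def)
    also have "emeasure entries_measure \<dots> = (\<Prod>e\<in>sym_entries. emeasure lborel (?A' e))"
      using A' by (intro entries.emeasure_PiM) auto
    also have "\<dots> = (\<Prod>e\<in>sym_entries. emeasure lborel (A e))"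
    proof (rule prod.cong[OF refl])
      fix e :: "'n set" assume e: "e \<in> sym_entries"
      have "emeasure lborel (A e) = emeasure (distr lborel borel ((+) (w e))) (A e)"
        by (simp add: lborel_distr_plus)
      also have "\<dots> = emeasure lborel (?A' e)"
        using A[OF e] by (subst emeasure_distr) (auto simp: vimage_def)
      finally show "emeasure lborel (?A' e) = emeasure lborel (A e)" ..
    qed
    finally show "emeasure (distr entries_measure entries_measure ?t) (Pi\<^sub>E sym_entries A) =
        (\<Prod>e\<in>sym_entries. emeasure lborel (A e))" .
  qed auto
  then have "lebesgue_sym = distr (distr entries_measure entries_measure ?t) borel sym_of_entries"
    by (simp add: lebesgue_sym_eq)
  also have "\<dots> = distr entries_measure borel (\<lambda>s. sym_of_entries (?t s))"
    by (subst distr_distr) (auto simp: comp_def)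
  also have "\<dots> = distr entries_measure borel (\<lambda>s. v + sym_of_entries s)"
    by (intro distr_cong) (auto simp: sym_of_entries_def vec_eq_iff w)
  also have "\<dots> = distr lebesgue_sym borel (\<lambda>X. v + X)"
    unfolding lebesgue_sym_eq by (subst distr_distr) (auto simp: comp_def)
  finally show "distr lebesgue_sym borel (\<lambda>X. v + X) = lebesgue_sym" by simp
qed simp

lemma sigma_finite_lebesgue_sym: "sigma_finite_measure (lebesgue_sym :: (real^'n^'n) measure)"
  using translation_invariant_lebesgue_sym[where 'a = 'n] by (simp add: translation_invariant_def)

lemma norm_matrix_eq_trace: "norm (X :: real^'n^'n) = sqrt (trace (X ** transpose X))"
  by (simp add: norm_eq_sqrt_inner inner_vec_def trace_def matrix_matrix_mult_def transpose_def)

lemma linear_congruence: "linear (\<lambda>X. A ** X ** transpose (A :: real^'n^'n))"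
  by (rule linearI) (simp_all add: matrix_add_ldistrib matrix_add_rdistrib matrix_mul_scaleR_left matrix_mul_scaleR_right)

text \<open>Congruence by a rotation preserves the Frobenius norm, so the ball for this norm is a test set; it lies
  between two boxes and therefore has positive finite measure.\<close>

lemma has_jacobian_congruence_orthogonal:
  fixes Q :: "real^'n^'n"
  assumes Q: "orthogonal_matrix Q"
  shows "has_jacobian lebesgue_sym (\<lambda>X. Q ** X ** transpose Q) 1"
proof -
  let ?T = "\<lambda>X. Q ** X ** transpose Q" and ?T' = "\<lambda>X. transpose Q ** X ** Q"
  have QQ: "transpose Q ** Q = mat 1" "Q ** transpose Q = mat 1" using Q by (auto simp: orthogonal_matrix_def)
  have n: "norm (?T X) = norm X" for X
  proof -
    have "?T X ** transpose (?T X) = Q ** X ** (transpose Q ** Q) ** transpose X ** transpose Q"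
      by (simp only: matrix_transpose_mul transpose_transpose matrix_mul_assoc)
    then have "trace (?T X ** transpose (?T X)) = trace (Q ** (X ** transpose X ** transpose Q))"
      by (simp add: QQ matrix_mul_assoc)
    also have "\<dots> = trace (X ** transpose X ** (transpose Q ** Q))"
      by (subst trace_mul_sym) (simp only: matrix_mul_assoc)
    finally show ?thesis by (simp add: QQ norm_matrix_eq_trace)
  qed
  let ?g = "indicator {X :: real^'n^'n. norm X \<le> 1} :: _ \<Rightarrow> ennreal"
  have gm: "{X :: real^'n^'n. norm X \<le> 1} \<in> sets borel" by measurable
  have T1: "?g (?T x) = ?g x" and T2: "?g (- x) = ?g x" for x using n by (auto simp: indicator_def)
  have *: "(\<integral>\<^sup>+x. ?g x \<partial>lebesgue_sym) = emeasure lebesgue_sym {X :: real^'n^'n. norm X \<le> 1}" using gm by simp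
  (* With this bound on the k * k entries, the norm is at most 1. *)
  define c where "c = 1 / (real CARD('n) * real CARD('n))"
  have c0: "c > 0" by (simp add: c_def)
  have sub: "{X :: real^'n^'n. \<forall>i j. - c \<le> X $ i $ j \<and> X $ i $ j \<le> c} \<subseteq> {X. norm X \<le> 1}"
  proof safe
    fix X :: "real^'n^'n" assume X: "\<forall>i j. - c \<le> X $ i $ j \<and> X $ i $ j \<le> c"
    have "norm X \<le> (\<Sum>i\<in>UNIV. norm (X $ i))" unfolding norm_vec_def by (rule L2_set_le_sum) simp
    also have "\<dots> \<le> (\<Sum>i\<in>UNIV. \<Sum>j\<in>UNIV. \<bar>X $ i $ j\<bar>)" by (intro sum_mono norm_le_l1_cart)
    also have "\<dots> \<le> (\<Sum>i\<in>(UNIV::'n set). \<Sum>j\<in>(UNIV::'n set). c)" using X by (intro sum_mono) (auto simp: abs_le_iff minus_le_iff)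
    also have "\<dots> = 1" by (simp add: c_def)
    finally show "norm X \<le> 1" .
  qed
  have sub2: "{X :: real^'n^'n. norm X \<le> 1} \<subseteq> {X. \<forall>i j. - 1 \<le> X $ i $ j \<and> X $ i $ j \<le> 1}"
  proof -
    have "\<bar>X $ i $ j\<bar> \<le> 1" if "norm X \<le> 1" for X :: "real^'n^'n" and i j
      using entry_le_norm[of X i j] that by linarith
    then show ?thesis by (auto simp: abs_le_iff minus_le_iff)
  qed
  have pos: "emeasure lebesgue_sym {X :: real^'n^'n. norm X \<le> 1} \<noteq> 0"
  proof -
    have "0 < ennreal (\<Prod>e\<in>(sym_entries :: 'n set set). c - - c)"
      using c0 by (simp only: ennreal_less_zero_iff) (intro prod_pos, simp)
    also have "\<dots> = emeasure lebesgue_sym {X :: real^'n^'n. \<forall>i j. - c \<le> X $ i $ j \<and> X $ i $ j \<le> c}"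
      using c0 by (subst emeasure_lebesgue_sym_box[of "\<lambda>_. - c" "\<lambda>_. c"]) auto
    also have "\<dots> \<le> emeasure lebesgue_sym {X :: real^'n^'n. norm X \<le> 1}"
      using gm by (intro emeasure_mono sub) simp
    finally show ?thesis by simp
  qed
  have fin: "emeasure lebesgue_sym {X :: real^'n^'n. norm X \<le> 1} \<noteq> \<infinity>"
  proof -
    have b: "{X :: real^'n^'n. \<forall>i j. - 1 \<le> X $ i $ j \<and> X $ i $ j \<le> 1} \<in> sets borel" by measurable
    have "emeasure lebesgue_sym {X :: real^'n^'n. norm X \<le> 1} \<le>
       emeasure lebesgue_sym {X :: real^'n^'n. \<forall>i j. - 1 \<le> X $ i $ j \<and> X $ i $ j \<le> 1}"
      using b by (intro emeasure_mono sub2) simp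
    also have "\<dots> < \<infinity>" by (subst emeasure_lebesgue_sym_box[of "\<lambda>_. - 1" "\<lambda>_. 1"]) auto
    finally show ?thesis by simp
  qed
  show ?thesis
  proof (rule has_jacobianI[OF translation_invariant_lebesgue_sym, where T' = ?T' and g = ?g])
    show "linear ?T" by (rule linear_congruence)
    show "linear ?T'" using linear_congruence[of "transpose Q"] by simp
    show "?T (?T' x) = x" for x
    proof -
      have "?T (?T' x) = (Q ** transpose Q) ** x ** (Q ** transpose Q)" by (simp only: matrix_mul_assoc)
      then show ?thesis by (simp add: QQ)
    qed
    show "?T v \<in> {X. transpose X = X}" if "v \<in> {X. transpose X = X}" for v
      using that by (simp add: matrix_transpose_mul matrix_mul_assoc)
    show "?T' v \<in> {X. transpose X = X}" if "v \<in> {X. transpose X = X}" for v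
      using that by (simp add: matrix_transpose_mul matrix_mul_assoc)
    show "?g \<in> borel_measurable borel" using gm by simp
    show "(\<integral>\<^sup>+x. ?g (?T x) \<partial>lebesgue_sym) \<noteq> 0" unfolding T1 * using pos .
    show "(\<integral>\<^sup>+x. ?g (?T x) \<partial>lebesgue_sym) \<noteq> \<infinity>" unfolding T1 * using fin .
    show "(\<integral>\<^sup>+x. ?g (- x) \<partial>lebesgue_sym) = ennreal 1 * (\<integral>\<^sup>+x. ?g (?T x) \<partial>lebesgue_sym)"
      unfolding T1 T2 by simp
  qed
qed

text \<open>The entry at \<open>{p, q}\<close> is multiplied by one factor \<open>t\<close> for each of \<open>p\<close> and \<open>q\<close> that is the distinguished
  index \<open>i\<close>. There are \<open>k\<close> unordered pairs containing \<open>i\<close>, and \<open>{i}\<close> counts twice: the total is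
  \<open>t ^ (k + 1)\<close>.\<close>

lemma has_jacobian_congruence_axis:
  fixes i :: "'n::finite"
  assumes t: "t > 0"
  defines "D \<equiv> diag_matrix (\<lambda>j. if j = i then t else 1)"
  shows "has_jacobian lebesgue_sym (\<lambda>X. D ** X ** transpose D) (t ^ (CARD('n) + 1))"
proof -
  let ?T = "\<lambda>X. D ** X ** transpose D"
  define D' where "D' = diag_matrix (\<lambda>j. if j = i then 1 / t else 1)"
  have "(\<lambda>j. (if j = i then t else 1) * (if j = i then 1 / t else 1)) = (\<lambda>j. 1)" using t by auto
  then have DD: "D ** D' = mat 1" unfolding D_def D'_def diag_matrix_mul by (simp add: diag_matrix_def mat_def)
  define w where "w = (\<lambda>e :: 'n set. if e = {i} then t\<^sup>2 else if i \<in> e then t else 1)"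
  have w0: "w e > 0" for e using t by (simp add: w_def)
  have diag_left: "(diag_matrix d ** X) $ p $ q = d p * X $ p $ q" for d and X :: "real^'n^'n" and p q
  proof -
    have "(diag_matrix d ** X) $ p $ q = (\<Sum>k\<in>UNIV. if k = p then d p * X $ p $ q else 0)"
      unfolding matrix_matrix_mult_def diag_matrix_def vec_lambda_beta by (rule sum.cong) auto
    then show ?thesis by simp
  qed
  have diag_right: "(X ** diag_matrix d) $ p $ q = X $ p $ q * d q" for d and X :: "real^'n^'n" and p q
  proof -
    have "(X ** diag_matrix d) $ p $ q = (\<Sum>k\<in>UNIV. if k = q then X $ p $ q * d q else 0)"
      unfolding matrix_matrix_mult_def diag_matrix_def vec_lambda_beta by (rule sum.cong) auto
    then show ?thesis by simp
  qed
  have Tc: "?T X $ p $ q = w {p, q} * X $ p $ q" for X p q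
    by (simp add: D_def transpose_diag_matrix diag_left diag_right w_def power2_eq_square)
  have pw: "(\<Prod>e\<in>sym_entries. w e) = t ^ (CARD('n) + 1)"
  proof -
    have "(\<Prod>e\<in>sym_entries. w e) = (\<Prod>e\<in>range (\<lambda>j. {i, j}). w e)"
      by (rule prod.mono_neutral_right) (auto simp: sym_entries_def w_def)
    also have "\<dots> = (\<Prod>j\<in>UNIV. w {i, j})"
      by (subst prod.reindex) (auto simp: inj_def doubleton_eq_iff)
    also have "\<dots> = (\<Prod>j\<in>UNIV. t * (if j = i then t else 1))"
      by (intro prod.cong) (auto simp: w_def power2_eq_square)
    also have "\<dots> = t ^ (CARD('n) + 1)" by (simp add: prod.distrib)
    finally show ?thesis .
  qed
  let ?B = "\<lambda>a b. {X :: real^'n^'n. \<forall>p q. a {p, q} \<le> X $ p $ q \<and> X $ p $ q \<le> b {p, q}}"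
  have bm: "?B a b \<in> sets borel" for a b by measurable
  let ?g = "indicator (?B (\<lambda>_. 0) (\<lambda>_. 1)) :: _ \<Rightarrow> ennreal"
  have g1: "?g (?T X) = indicator (?B (\<lambda>_. 0) (\<lambda>e. 1 / w e)) X" for X
  proof -
    have "(0 \<le> w {p, q} * X $ p $ q \<and> w {p, q} * X $ p $ q \<le> 1) = (0 \<le> X $ p $ q \<and> X $ p $ q \<le> 1 / w {p, q})" for p q
      using w0[of "{p, q}"] by (auto simp: zero_le_mult_iff field_simps)
    then show ?thesis by (simp add: indicator_def Tc)
  qed
  have g2: "?g (- X) = indicator (?B (\<lambda>_. - 1) (\<lambda>_. 0)) X" for X
    by (auto simp: indicator_def)
  have p: "(\<Prod>e\<in>sym_entries. 1 / w e - 0) = 1 / t ^ (CARD('n) + 1)"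
    by (simp add: pw prod_dividef)
  have i1: "(\<integral>\<^sup>+x. ?g (?T x) \<partial>lebesgue_sym) = ennreal (1 / t ^ (CARD('n) + 1))"
    unfolding g1 p[symmetric] using bm w0 emeasure_lebesgue_sym_box[of "\<lambda>_. 0" "\<lambda>e. 1 / w e"]
    by (subst nn_integral_indicator) (auto simp: less_imp_le)
  have i2: "(\<integral>\<^sup>+x. ?g (- x) \<partial>lebesgue_sym) = 1"
    unfolding g2 using bm emeasure_lebesgue_sym_box[of "\<lambda>_::'n set. - 1" "\<lambda>_. 0"]
    by (subst nn_integral_indicator) auto
  show ?thesis
  proof (rule has_jacobianI[OF translation_invariant_lebesgue_sym, where T' = "\<lambda>X. D' ** X ** transpose D'" and g = ?g])
    show "D ** (D' ** x ** transpose D') ** transpose D = x" for x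
    proof -
      have "D ** (D' ** x ** transpose D') ** transpose D = (D ** D') ** x ** transpose (D ** D')"
        by (simp only: matrix_mul_assoc matrix_transpose_mul)
      then show ?thesis by (simp add: DD)
    qed
    show "?g \<in> borel_measurable borel" using bm by simp
    show "(\<integral>\<^sup>+x. ?g (?T x) \<partial>lebesgue_sym) \<noteq> 0" unfolding i1 using t by simp
    show "(\<integral>\<^sup>+x. ?g (?T x) \<partial>lebesgue_sym) \<noteq> \<infinity>" unfolding i1 by simp
    show "(\<integral>\<^sup>+x. ?g (- x) \<partial>lebesgue_sym) = ennreal (t ^ (CARD('n) + 1)) * (\<integral>\<^sup>+x. ?g (?T x) \<partial>lebesgue_sym)"
      unfolding i1 i2 using t by (subst ennreal_mult'[symmetric]) auto
  qed (auto simp: linear_congruence matrix_transpose_mul matrix_mul_assoc)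
qed

theorem has_jacobian_congruence:
  fixes A :: "real^'n^'n"
  assumes "invertible A"
  shows "has_jacobian lebesgue_sym (\<lambda>X. A ** X ** transpose A) (\<bar>det A\<bar> ^ (CARD('n) + 1))"
proof (rule multiplicative_factor_eq_det_power[OF _ _ _ assms])
  fix A B :: "real^'n^'n" and a b :: real
  assume "has_jacobian lebesgue_sym (\<lambda>X. A ** X ** transpose A) a"
    "has_jacobian lebesgue_sym (\<lambda>X. B ** X ** transpose B) b" "0 \<le> a"
  from has_jacobian_compose[OF this]
  show "has_jacobian lebesgue_sym (\<lambda>X. (A ** B) ** X ** transpose (A ** B)) (a * b)"
    by (simp add: matrix_mul_assoc matrix_transpose_mul)
qed (use has_jacobian_congruence_orthogonal has_jacobian_congruence_axis in blast)+

section \<open>The inverse Wishart kernel\<close>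

lemma pos_def_measurable_comp [measurable (raw)]:
  fixes A :: "'a \<Rightarrow> real^'n^'n"
  assumes "A \<in> borel_measurable M" shows "Measurable.pred M (\<lambda>x. pos_def (A x))"
  using assms pos_def_measurable by (rule measurable_compose)

text \<open>The unnormalized inverse Wishart density.\<close>

definition iw_kernel :: "real \<Rightarrow> real^'n^'n \<Rightarrow> real^'n^'n \<Rightarrow> real" where
  "iw_kernel d S X =
     (if pos_def X then det X powr (- d/2) * exp (- (1/2) * trace (S ** matrix_inv X)) else 0)"

lemma borel_measurable_iw_kernel [measurable (raw)]:
  fixes S X :: "'a \<Rightarrow> real^'n^'n"
  assumes [measurable]: "S \<in> borel_measurable M" "X \<in> borel_measurable M"
  shows "(\<lambda>x. iw_kernel d (S x) (X x)) \<in> borel_measurable M"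
  unfolding iw_kernel_def by measurable

lemma iw_kernel_nonneg: "iw_kernel d S X \<ge> 0"
  by (simp add: iw_kernel_def)

lemma invertible_transpose_iff: "invertible (transpose A) \<longleftrightarrow> invertible (A :: real^'n^'n)"
  by (simp add: invertible_det_nz)

lemma matrix_inv_congruence:
  fixes A X :: "real^'n^'n"
  assumes "invertible A" "invertible X"
  shows "matrix_inv (A ** X ** transpose A) = transpose (matrix_inv A) ** matrix_inv X ** matrix_inv A"
  using assms by (simp add: matrix_inv_mul invertible_matrix_mul invertible_transpose_iff
      matrix_inv_transpose matrix_mul_assoc)

lemma outer_scaleR_left: "outer (c *\<^sub>R v) w = c *\<^sub>R outer v w"
  by (simp add: outer_def vec_eq_iff)

lemma outer_diff_left: "outer (u - v) w = outer u w - outer v w"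
  by (simp add: outer_def vec_eq_iff algebra_simps)

text \<open>The change of \<open>tr (S \<Sigma>\<^sup>-\<^sup>1)\<close>, compared with unit scale, when \<open>\<Sigma> = A X A\<^sup>T\<close>.\<close>

abbreviation trace_change :: "real^'n^'n \<Rightarrow> real^'n^'n \<Rightarrow> real^'n^'n \<Rightarrow> real" where
  "trace_change S A X \<equiv>
     trace (matrix_inv A ** S ** transpose (matrix_inv A) ** matrix_inv X) - trace (matrix_inv X)"

lemma iw_kernel_congruence:
  fixes A X :: "real^'n^'n"
  assumes A: "invertible A" and X: "pos_def X"
  shows "iw_kernel d S (A ** X ** transpose A) = \<bar>det A\<bar> powr (- d) *
    exp (- (1/2) * trace_change S A X) *
    iw_kernel d (mat 1) X"
proof -
  have Xi: "invertible X" using X by (rule pos_def_imp_invertible)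
  have d0: "det X > 0" using X by (rule det_pos_def)
  have dA: "det A \<noteq> 0" using A invertible_det_nz by blast
  have "trace (S ** matrix_inv (A ** X ** transpose A)) =
    trace ((S ** transpose (matrix_inv A) ** matrix_inv X) ** matrix_inv A)"
    by (simp add: matrix_inv_congruence A Xi matrix_mul_assoc)
  also have "\<dots> = trace (matrix_inv A ** S ** transpose (matrix_inv A) ** matrix_inv X)"
    by (subst trace_mul_sym) (simp add: matrix_mul_assoc)
  finally have t: "trace (S ** matrix_inv (A ** X ** transpose A)) =
    trace (matrix_inv A ** S ** transpose (matrix_inv A) ** matrix_inv X)" .
  have "det (A ** X ** transpose A) = \<bar>det A\<bar> powr 2 * det X"
    using dA by (simp add: det_mul power2_eq_square)
  then have "det (A ** X ** transpose A) powr (- d/2) = (\<bar>det A\<bar> powr 2) powr (- d/2) * det X powr (- d/2)"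
    using d0 by (simp only: powr_mult)
  also have "(\<bar>det A\<bar> powr 2) powr (- d/2) = \<bar>det A\<bar> powr (- d)"
    by (simp only: powr_powr) simp
  finally have dd: "det (A ** X ** transpose A) powr (- d/2) = \<bar>det A\<bar> powr (- d) * det X powr (- d/2)" .
  show ?thesis using X unfolding iw_kernel_def pos_def_congruence_iff[OF A] dd t
    by (simp add: mult_exp_exp diff_divide_distrib)
qed

text \<open>The general substitution behind all laws of this section: a factor \<open>\<bar>det A\<bar> ^ (k + 1)\<close> comes from the
  measure, a factor \<open>\<bar>det A\<bar> powr (- d)\<close> from the determinant in the kernel, and the exponent changes by the
  trace.\<close>

lemma nn_integral_iw_congruence:
  fixes A :: "real^'n^'n" and f :: "real^'n^'n \<Rightarrow> ennreal"
  assumes A: "invertible A" and [measurable]: "f \<in> borel_measurable borel"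
  shows "(\<integral>\<^sup>+X. f X * ennreal (iw_kernel d S X) \<partial>lebesgue_sym) =
    ennreal (\<bar>det A\<bar> powr (real CARD('n) + 1 - d)) *
    (\<integral>\<^sup>+X. f (A ** X ** transpose A) * ennreal (exp (- (1/2) * trace_change S A X)) * ennreal (iw_kernel d (mat 1) X) \<partial>lebesgue_sym)"
proof -
  have "det A \<noteq> 0" using A invertible_det_nz by blast
  then have dA: "\<bar>det A\<bar> > 0" by simp
  have *: "f (A ** X ** transpose A) * ennreal (iw_kernel d S (A ** X ** transpose A)) =
    ennreal (\<bar>det A\<bar> powr (- d)) * (f (A ** X ** transpose A) * ennreal (exp (- (1/2) * trace_change S A X)) * ennreal (iw_kernel d (mat 1) X))" for X
  proof (cases "pos_def X")
    case True
    then show ?thesis unfolding iw_kernel_congruence[OF A True] by (simp add: ennreal_mult iw_kernel_nonneg mult_ac)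
  next
    case False
    then show ?thesis using pos_def_congruence_iff[OF A, of X] by (simp add: iw_kernel_def)
  qed
  have "(\<integral>\<^sup>+X. f X * ennreal (iw_kernel d S X) \<partial>lebesgue_sym) = ennreal (\<bar>det A\<bar> ^ (CARD('n) + 1)) *
     (\<integral>\<^sup>+X. f (A ** X ** transpose A) * ennreal (iw_kernel d S (A ** X ** transpose A)) \<partial>lebesgue_sym)"
    by (rule has_jacobianD[OF has_jacobian_congruence[OF A]]) measurable
  also have "\<dots> = ennreal (\<bar>det A\<bar> ^ (CARD('n) + 1)) * (ennreal (\<bar>det A\<bar> powr (- d)) *
    (\<integral>\<^sup>+X. f (A ** X ** transpose A) * ennreal (exp (- (1/2) * trace_change S A X)) * ennreal (iw_kernel d (mat 1) X) \<partial>lebesgue_sym))"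
    unfolding * by (subst nn_integral_cmult) auto
  also have "ennreal (\<bar>det A\<bar> ^ (CARD('n) + 1)) * (ennreal (\<bar>det A\<bar> powr (- d)) * I) = ennreal (\<bar>det A\<bar> powr (real CARD('n) + 1 - d)) * I" for I
  proof -
    have "\<bar>det A\<bar> ^ (CARD('n) + 1) * \<bar>det A\<bar> powr (- d) = \<bar>det A\<bar> powr (real CARD('n) + 1 - d)"
    proof -
      have "\<bar>det A\<bar> ^ (CARD('n) + 1) = \<bar>det A\<bar> powr (real CARD('n) + 1)"
        using powr_realpow[OF dA, of "CARD('n) + 1"] by (simp add: add.commute)
      then show ?thesis by (simp only: powr_add[symmetric]) simp
    qed
    then show ?thesis by (simp add: ennreal_mult'[symmetric] mult.assoc[symmetric])
  qed
  finally show ?thesis .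
qed

text \<open>A scale matrix \<open>A A\<^sup>T\<close> is reduced to the identity by the congruence with \<open>A\<close>.\<close>

lemma nn_integral_iw_standardize:
  fixes A :: "real^'n^'n" and f :: "real^'n^'n \<Rightarrow> ennreal"
  assumes A: "invertible A" and [measurable]: "f \<in> borel_measurable borel"
  shows "(\<integral>\<^sup>+X. f X * ennreal (iw_kernel d (A ** transpose A) X) \<partial>lebesgue_sym) =
    ennreal (\<bar>det A\<bar> powr (real CARD('n) + 1 - d)) *
    (\<integral>\<^sup>+X. f (A ** X ** transpose A) * ennreal (iw_kernel d (mat 1) X) \<partial>lebesgue_sym)"
proof -
  let ?B = "matrix_inv A"
  have "?B ** (A ** transpose A) ** transpose ?B = (?B ** A) ** transpose (?B ** A)"
    by (simp only: matrix_mul_assoc matrix_transpose_mul)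
  then have "?B ** (A ** transpose A) ** transpose ?B = mat 1" by (simp add: matrix_inv_left A)
  then show ?thesis
    by (subst nn_integral_iw_congruence[OF assms]) (simp only: matrix_mul_lid diff_self mult_zero_right exp_zero ennreal_1 mult_1_right)
qed

subsection \<open>The standard normal density\<close>

definition std_gauss :: "'a::euclidean_space \<Rightarrow> real" where
  "std_gauss x = exp (- (norm x)\<^sup>2 / 2) / sqrt ((2 * pi) ^ DIM('a))"

lemma std_gauss_pos: "std_gauss x > 0"
  by (simp add: std_gauss_def)

lemma borel_measurable_std_gauss [measurable]: "std_gauss \<in> borel_measurable borel"
  unfolding std_gauss_def[abs_def] by measurable

text \<open>The density is a product of one-dimensional normal densities.\<close>

lemma nn_integral_std_gauss: "(\<integral>\<^sup>+x. ennreal (std_gauss x) \<partial>(lborel :: 'a::euclidean_space measure)) = 1"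
proof -
  have *: "std_gauss x = (\<Prod>b\<in>Basis. std_normal_density (x \<bullet> b))" for x :: 'a
  proof -
    have "(norm x)\<^sup>2 = (\<Sum>b\<in>Basis. (x \<bullet> b)\<^sup>2)"
      by (simp add: norm_eq_sqrt_inner euclidean_inner[of x x] sum_nonneg power2_eq_square)
    then have "exp (- (norm x)\<^sup>2 / 2) = (\<Prod>b\<in>Basis. exp (- (x \<bullet> b)\<^sup>2 / 2))"
      by (simp add: exp_sum[symmetric] sum_negf sum_divide_distrib)
    then have "std_gauss x = (\<Prod>b\<in>Basis. exp (- (x \<bullet> b)\<^sup>2 / 2)) / (\<Prod>b\<in>(Basis::'a set). sqrt (2 * pi))"
      unfolding std_gauss_def real_sqrt_power prod_constant by simp
    then show ?thesis unfolding std_normal_density_def prod_dividef[symmetric] by simp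
  qed
  have "(\<integral>\<^sup>+x. ennreal (std_gauss x) \<partial>(lborel :: 'a measure)) = (\<integral>\<^sup>+x. (\<Prod>b\<in>Basis. ennreal (std_normal_density (x \<bullet> b))) \<partial>(lborel :: 'a measure))"
    by (simp add: * prod_ennreal)
  also have "\<dots> = (\<Prod>b\<in>(Basis::'a set). \<integral>\<^sup>+x. ennreal (std_normal_density x) \<partial>lborel)"
    by (rule nn_integral_lborel_prod) auto
  also have "(\<integral>\<^sup>+x. ennreal (std_normal_density x) \<partial>lborel) = 1"
    by (simp add: nn_integral_eq_integral[OF integrable_normal_density] integral_normal_density)
  finally show ?thesis by simp
qed

lemma mvn_density_standard: "mvn_density 0 (mat 1) y = std_gauss (y :: real^'n)"
proof -
  have "matrix_inv (mat 1 :: real^'n^'n) = mat 1" by (rule matrix_inv_eqI) simp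
  then show ?thesis by (simp add: mvn_density_def std_gauss_def dot_square_norm)
qed

lemma nn_integral_lborel_affine_subst:
  fixes f :: "'a::euclidean_space \<Rightarrow> ennreal"
  assumes [measurable]: "f \<in> borel_measurable borel" and "c \<noteq> 0"
  shows "(\<integral>\<^sup>+x. ennreal (\<bar>c\<bar> ^ DIM('a)) * f (t + c *\<^sub>R x) \<partial>lborel) = (\<integral>\<^sup>+x. f x \<partial>lborel)"
  using has_jacobianD[OF has_jacobian_lborel_affine[OF assms(2), of t] assms(1)]
  by (simp add: nn_integral_cmult)

subsection \<open>The first column of the inverse\<close>

definition proj_perp :: "real^'n \<Rightarrow> real^'n^'n" where
  "proj_perp e = mat 1 - outer e e"

lemma proj_perp_mult: "proj_perp e *v y = y - (e \<bullet> y) *\<^sub>R e"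
  by (simp add: proj_perp_def matrix_vector_mult_diff_rdistrib outer_mult_vec)

text \<open>A shear that fixes \<open>e\<close> moves the component of \<open>\<Sigma>\<^sup>-\<^sup>1 e\<close> orthogonal to \<open>e\<close> by an arbitrary translation, leaves
  \<open>e \<bullet> \<Sigma>\<^sup>-\<^sup>1 e\<close> alone, and has determinant one.\<close>

lemma iw_shear:
  fixes e v :: "real^'n"
  assumes e: "norm e = 1" and v: "e \<bullet> v = 0" and X: "pos_def X"
  defines "A \<equiv> mat 1 + outer e v"
  shows "invertible A" "det A = 1"
    "matrix_inv (A ** X ** transpose A) *v e = matrix_inv X *v e - (e \<bullet> (matrix_inv X *v e)) *\<^sub>R v"
    "trace_change (mat 1) A X =
      (e \<bullet> (matrix_inv X *v e)) * (v \<bullet> v) - 2 * (v \<bullet> (matrix_inv X *v e))"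
proof -
  have ee: "e \<bullet> e = 1" using e by (simp add: norm_eq_1)
  have ve: "v \<bullet> e = 0" using v by (simp add: inner_commute)
  show dA: "det A = 1" by (simp add: A_def det_mat_1_plus_outer v)
  show iA: "invertible A" by (simp add: invertible_det_nz dA)
  have "A *v e = e" by (simp add: A_def matrix_vector_mult_add_rdistrib outer_mult_vec ve)
  then have "A ** (mat 1 - outer e v) = mat 1"
    by (simp add: matrix_sub_ldistrib matrix_mul_outer) (simp add: A_def)
  then have B: "matrix_inv A = mat 1 - outer e v" by (rule matrix_inv_eqI)
  have Bt: "transpose (matrix_inv A) = mat 1 - outer v e" by (simp add: B transpose_diff transpose_outer)
  have Xi: "invertible X" using X by (rule pos_def_imp_invertible)
  have Xs: "transpose (matrix_inv X) = matrix_inv X" using pos_def_matrix_inv[OF X] by (simp add: pos_def_def)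
  have Be: "matrix_inv A *v e = e" by (simp add: B matrix_vector_mult_diff_rdistrib outer_mult_vec ve)
  show "matrix_inv (A ** X ** transpose A) *v e = matrix_inv X *v e - (e \<bullet> (matrix_inv X *v e)) *\<^sub>R v"
    unfolding matrix_inv_congruence[OF iA Xi] matrix_vector_mul_assoc[symmetric] Be Bt
    by (simp add: matrix_vector_mult_diff_rdistrib outer_mult_vec)
  have "matrix_inv A ** mat 1 ** transpose (matrix_inv A) = mat 1 - outer e v - outer v e + (v \<bullet> v) *\<^sub>R outer e e"
    unfolding Bt unfolding B
    by (simp add: matrix_sub_rdistrib matrix_sub_ldistrib matrix_mul_outer
        matrix_vector_mult_diff_rdistrib outer_mult_vec outer_scaleR_left outer_diff_left)
  moreover have "trace ((mat 1 - outer e v - outer v e + (v \<bullet> v) *\<^sub>R outer e e) ** Y) =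
     trace Y - v \<bullet> (Y *v e) - e \<bullet> (Y *v v) + (v \<bullet> v) * (e \<bullet> (Y *v e))" for Y :: "real^'n^'n"
    by (simp add: matrix_sub_rdistrib matrix_add_rdistrib trace_add trace_sub trace_outer_mul
        matrix_mul_scaleR_left trace_scaleR)
  moreover have "e \<bullet> (matrix_inv X *v v) = v \<bullet> (matrix_inv X *v e)"
    by (subst inner_mult_symmetric[OF Xs]) (rule inner_commute)
  ultimately show "trace_change (mat 1) A X =
      (e \<bullet> (matrix_inv X *v e)) * (v \<bullet> v) - 2 * (v \<bullet> (matrix_inv X *v e))" by simp
qed

text \<open>Given \<open>\<eta> = e \<bullet> \<Sigma>\<^sup>-\<^sup>1 e\<close>, write \<open>\<Sigma>\<^sup>-\<^sup>1 e = \<eta> e + \<surd>\<eta> \<zeta>\<close> with \<open>\<zeta>\<close> orthogonal to \<open>e\<close>. The kernel depends on \<open>\<zeta>\<close>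
  through the factor \<open>exp (- (norm \<zeta>)\<^sup>2 / 2)\<close>, and otherwise only on quantities that the shears preserve,
  while the shears translate \<open>\<zeta>\<close> freely. So \<open>\<zeta>\<close> is standard normal on the complement of \<open>e\<close>. To
  integrate over the shears without choosing coordinates on the complement, their parameter \<open>y\<close> ranges
  over the full space and acts through its projection.\<close>

lemma iw_column_gaussian:
  fixes e :: "real^'n" and g :: "real^'n \<Rightarrow> ennreal"
  assumes e: "norm e = 1" and g [measurable]: "g \<in> borel_measurable borel"
  shows "(\<integral>\<^sup>+X. g (matrix_inv X *v e) * ennreal (iw_kernel d (mat 1) X) \<partial>lebesgue_sym) =
    (\<integral>\<^sup>+X. (\<integral>\<^sup>+y. ennreal (std_gauss y) * g ((e \<bullet> (matrix_inv X *v e)) *\<^sub>R e + sqrt (e \<bullet> (matrix_inv X *v e)) *\<^sub>R (proj_perp e *v y)) \<partial>lborel)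
        * ennreal (iw_kernel d (mat 1) X) \<partial>lebesgue_sym)"
proof -
  interpret S: sigma_finite_measure "lebesgue_sym :: (real^'n^'n) measure" by (rule sigma_finite_lebesgue_sym)
  interpret pair_sigma_finite "lebesgue_sym :: (real^'n^'n) measure" "lborel :: (real^'n) measure" ..
  have ee: "e \<bullet> e = 1" using e by (simp add: norm_eq_1)
  define \<eta> where "\<eta> X = e \<bullet> (matrix_inv X *v e)" for X :: "real^'n^'n"
  define \<zeta> where "\<zeta> X = (1 / sqrt (\<eta> X)) *\<^sub>R (matrix_inv X *v e - \<eta> X *\<^sub>R e)" for X :: "real^'n^'n"
  have [measurable]: "\<eta> \<in> borel_measurable borel" "\<zeta> \<in> borel_measurable borel"
    unfolding \<eta>_def[abs_def] \<zeta>_def[abs_def] by measurable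
  have e0: "e \<noteq> 0" using e by auto
  have eta_pos: "\<eta> X > 0" if "pos_def X" for X
    using pos_def_matrix_inv[OF that] e0 by (simp add: \<eta>_def pos_def_def)
  have x_eq: "matrix_inv X *v e = \<eta> X *\<^sub>R e + sqrt (\<eta> X) *\<^sub>R \<zeta> X" if "pos_def X" for X
    using eta_pos[OF that] by (simp add: \<zeta>_def)
  have e_zeta: "e \<bullet> \<zeta> X = 0" for X
    by (simp add: \<zeta>_def inner_diff_right ee) (simp add: \<eta>_def)
  (* A probability density in y for every X. It is inserted as a factor of mass one; after the shear,
     the integral over y becomes the Gaussian integral. *)
  define w where "w X y = ennreal (sqrt (\<eta> X) ^ CARD('n)) * ennreal (std_gauss (\<zeta> X - sqrt (\<eta> X) *\<^sub>R y))" for X y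
  have [measurable]: "(\<lambda>x. w (a x) (b x)) \<in> borel_measurable M"
    if [measurable]: "a \<in> borel_measurable M" "b \<in> borel_measurable M" for a b and M :: "'z measure"
    unfolding w_def by measurable
  have w_mass: "(\<integral>\<^sup>+y. w X y \<partial>lborel) = 1" if "pos_def X" for X
    using nn_integral_lborel_affine_subst[of "\<lambda>z. ennreal (std_gauss z)" "- sqrt (\<eta> X)" "\<zeta> X"] eta_pos[OF that]
    by (simp add: w_def nn_integral_std_gauss)
  let ?k = "\<lambda>X. ennreal (iw_kernel d (mat 1) X)"
  let ?x = "\<lambda>X. matrix_inv X *v e"
  let ?G = "\<lambda>X y. ennreal (sqrt (\<eta> X) ^ CARD('n)) * (ennreal (std_gauss (\<zeta> X + sqrt (\<eta> X) *\<^sub>R y)) *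
      g (\<eta> X *\<^sub>R e + sqrt (\<eta> X) *\<^sub>R (proj_perp e *v (\<zeta> X + sqrt (\<eta> X) *\<^sub>R y)))) * ?k X"
  have "(\<integral>\<^sup>+X. g (?x X) * ?k X \<partial>lebesgue_sym) = (\<integral>\<^sup>+X. \<integral>\<^sup>+y. g (?x X) * w X y * ?k X \<partial>lborel \<partial>lebesgue_sym)"
  proof (rule nn_integral_cong)
    fix X :: "real^'n^'n"
    show "g (?x X) * ?k X = (\<integral>\<^sup>+y. g (?x X) * w X y * ?k X \<partial>lborel)"
    proof (cases "pos_def X")
      case True
      then show ?thesis by (simp add: nn_integral_multc nn_integral_cmult w_mass)
    qed (simp add: iw_kernel_def)
  qed
  also have "\<dots> = (\<integral>\<^sup>+y. \<integral>\<^sup>+X. g (?x X) * w X y * ?k X \<partial>lebesgue_sym \<partial>lborel)"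
    by (rule Fubini'[symmetric]) measurable
  also have "\<dots> = (\<integral>\<^sup>+y. \<integral>\<^sup>+X. ?G X y \<partial>lebesgue_sym \<partial>lborel)"
  proof (rule nn_integral_cong)
    fix y :: "real^'n"
    (* The shear is chosen so that its parameter cancels the projection of y in the argument of w. *)
    define v where "v = - (proj_perp e *v y)"
    have v: "e \<bullet> v = 0" by (simp add: v_def proj_perp_mult inner_diff_right ee)
    define A where "A = mat 1 + outer e v"
    note sh = iw_shear[OF e v, folded A_def]
    have iA: "invertible A" "det A = 1" using sh(1,2)[OF pos_def_mat_1] .
    have "(\<integral>\<^sup>+X. g (?x X) * w X y * ?k X \<partial>lebesgue_sym) =
      (\<integral>\<^sup>+X. g (?x (A ** X ** transpose A)) * w (A ** X ** transpose A) y * ennreal (exp (- (1/2) *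
        trace_change (mat 1) A X)) * ?k X \<partial>lebesgue_sym)"
    proof -
      have "(\<lambda>X. g (?x X) * w X y) \<in> borel_measurable borel" by measurable
      from nn_integral_iw_congruence[OF iA(1) this, of d "mat 1"] show ?thesis by (simp add: iA(2))
    qed
    also have "\<dots> = (\<integral>\<^sup>+X. ?G X y \<partial>lebesgue_sym)"
    proof (rule nn_integral_cong)
      fix X :: "real^'n^'n"
      let ?Y = "A ** X ** transpose A"
      show "g (?x ?Y) * w ?Y y * ennreal (exp (- (1/2) *
        trace_change (mat 1) A X)) * ?k X =
        ?G X y"
      proof (cases "pos_def X")
        case True
        note eta = eta_pos[OF True]
        let ?s = "sqrt (\<eta> X)"
        have s: "?s * ?s = \<eta> X" "?s > 0" using eta by simp_all
        have x': "?x ?Y = ?x X - \<eta> X *\<^sub>R v" using sh(3)[OF True] by (simp add: \<eta>_def)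
        have eta': "\<eta> ?Y = \<eta> X" by (simp add: \<eta>_def[of ?Y] x' inner_diff_right v) (simp add: \<eta>_def)
        have zeta': "\<zeta> ?Y = \<zeta> X - ?s *\<^sub>R v"
        proof -
          have "(1 / ?s) * \<eta> X = ?s" using s by (simp add: field_simps)
          then have "(1 / ?s) *\<^sub>R (\<eta> X *\<^sub>R v) = ?s *\<^sub>R v" by simp
          moreover have "\<zeta> ?Y = \<zeta> X - (1 / ?s) *\<^sub>R (\<eta> X *\<^sub>R v)"
            by (simp add: \<zeta>_def eta' x' scaleR_diff_right)
          ultimately show ?thesis by simp
        qed
        have y_eq: "y = (e \<bullet> y) *\<^sub>R e - v" by (simp add: v_def proj_perp_mult)
        have arg: "\<zeta> ?Y - ?s *\<^sub>R y = \<zeta> X - (?s * (e \<bullet> y)) *\<^sub>R e"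
          unfolding zeta' by (subst (1) y_eq) (simp add: algebra_simps)
        have x'': "?x ?Y = \<eta> X *\<^sub>R e + ?s *\<^sub>R (proj_perp e *v (\<zeta> X + ?s *\<^sub>R y))"
          unfolding x' x_eq[OF True] using s(1)
          by (simp add: proj_perp_mult inner_add_right e_zeta v_def algebra_simps mult.assoc[symmetric])
        have vx: "v \<bullet> ?x X = ?s * (v \<bullet> \<zeta> X)"
          unfolding x_eq[OF True] using v by (simp add: inner_add_right inner_commute)
        have n1: "(norm (\<zeta> X - (?s * (e \<bullet> y)) *\<^sub>R e))\<^sup>2 = \<zeta> X \<bullet> \<zeta> X + \<eta> X * (e \<bullet> y)\<^sup>2"
        proof -
          have "(norm (z - c *\<^sub>R e))\<^sup>2 = z \<bullet> z - 2 * c * (e \<bullet> z) + c * c" for z c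
            unfolding power2_norm_eq_inner by (simp add: inner_diff_left inner_diff_right ee inner_commute[of z e] algebra_simps)
          from this[of "\<zeta> X" "?s * (e \<bullet> y)"] have "(norm (\<zeta> X - (?s * (e \<bullet> y)) *\<^sub>R e))\<^sup>2 =
              \<zeta> X \<bullet> \<zeta> X + (?s * ?s) * (e \<bullet> y)\<^sup>2"
            by (simp only: e_zeta power2_eq_square mult_zero_right diff_zero mult_ac)
          then show ?thesis by (simp only: s(1))
        qed
        have n2: "(norm (\<zeta> X + ?s *\<^sub>R y))\<^sup>2 = \<zeta> X \<bullet> \<zeta> X - 2 * ?s * (v \<bullet> \<zeta> X) + \<eta> X * ((e \<bullet> y)\<^sup>2 + v \<bullet> v)"
        proof -
          have a: "\<zeta> X \<bullet> y = - (v \<bullet> \<zeta> X)" by (subst y_eq) (simp add: inner_diff_right e_zeta inner_commute)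
          have b: "y \<bullet> y = (e \<bullet> y)\<^sup>2 + v \<bullet> v"
          proof -
            have "y \<bullet> y = ((e \<bullet> y) *\<^sub>R e - v) \<bullet> ((e \<bullet> y) *\<^sub>R e - v)" using y_eq by simp
            also have "\<dots> = (e \<bullet> y)\<^sup>2 + v \<bullet> v"
              using v by (simp add: inner_diff_left inner_diff_right ee inner_commute[of v e] power2_eq_square)
            finally show ?thesis .
          qed
          have "(norm (z + c *\<^sub>R y))\<^sup>2 = z \<bullet> z + 2 * c * (z \<bullet> y) + (c * c) * (y \<bullet> y)" for z c
            unfolding power2_norm_eq_inner by (simp add: inner_add_left inner_add_right inner_commute[of y z] algebra_simps)
          from this[of "\<zeta> X" ?s]
          have "(norm (\<zeta> X + ?s *\<^sub>R y))\<^sup>2 = \<zeta> X \<bullet> \<zeta> X + 2 * ?s * (\<zeta> X \<bullet> y) + (?s * ?s) * (y \<bullet> y)" .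
          then show ?thesis unfolding a b s(1) by simp
        qed
        (* The Gaussian weight and the change of the exponent combine to the density at zeta + sqrt eta y. *)
        have "std_gauss (\<zeta> X - (?s * (e \<bullet> y)) *\<^sub>R e) * exp (- (1/2) * (\<eta> X * (v \<bullet> v) - 2 * (?s * (v \<bullet> \<zeta> X)))) = std_gauss (\<zeta> X + ?s *\<^sub>R y)"
          unfolding std_gauss_def n1 n2 by (simp add: exp_add[symmetric] field_simps)
        then have G: "ennreal (std_gauss (\<zeta> X - (?s * (e \<bullet> y)) *\<^sub>R e)) * ennreal (exp (- (1/2) * (\<eta> X * (v \<bullet> v) - 2 * (?s * (v \<bullet> \<zeta> X)))))
            = ennreal (std_gauss (\<zeta> X + ?s *\<^sub>R y))"
          by (simp add: ennreal_mult[symmetric] std_gauss_pos less_imp_le)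
        show ?thesis
          unfolding w_def eta' arg x'' sh(4)[OF True] vx \<eta>_def[symmetric] G[symmetric] by (simp only: mult_ac)
      qed (simp add: iw_kernel_def)
    qed
    finally show "(\<integral>\<^sup>+X. g (?x X) * w X y * ?k X \<partial>lebesgue_sym) = \<dots>" .
  qed
  also have "\<dots> = (\<integral>\<^sup>+X. \<integral>\<^sup>+y. ?G X y \<partial>lborel \<partial>lebesgue_sym)"
    by (rule Fubini') measurable
  also have "\<dots> = (\<integral>\<^sup>+X. (\<integral>\<^sup>+y. ennreal (std_gauss y) * g (\<eta> X *\<^sub>R e + sqrt (\<eta> X) *\<^sub>R (proj_perp e *v y)) \<partial>lborel) * ?k X \<partial>lebesgue_sym)"
  proof (rule nn_integral_cong)
    fix X :: "real^'n^'n"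
    show "(\<integral>\<^sup>+y. ?G X y \<partial>lborel) =
      (\<integral>\<^sup>+y. ennreal (std_gauss y) * g (\<eta> X *\<^sub>R e + sqrt (\<eta> X) *\<^sub>R (proj_perp e *v y)) \<partial>lborel) * ?k X"
    proof (cases "pos_def X")
      case True
      then show ?thesis
        using nn_integral_lborel_affine_subst[of "\<lambda>z. ennreal (std_gauss z) * g (\<eta> X *\<^sub>R e + sqrt (\<eta> X) *\<^sub>R (proj_perp e *v z))" "sqrt (\<eta> X)" "\<zeta> X"] eta_pos[OF True]
        by (simp add: nn_integral_multc)
    qed (simp add: iw_kernel_def)
  qed
  finally show ?thesis by (simp add: \<eta>_def)
qed

abbreviation iw_mass :: "real \<Rightarrow> real^'n^'n \<Rightarrow> ennreal" where
  "iw_mass d S \<equiv> (\<integral>\<^sup>+X. ennreal (iw_kernel d S X) \<partial>lebesgue_sym)"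

text \<open>With \<open>r = 1\<close> as the identity, these maps form the one-parameter group that scales the axis \<open>e\<close>.\<close>

lemma iw_stretch:
  fixes e :: "real^'n"
  assumes e: "norm e = 1" and r: "r > 0" and X: "pos_def X"
  defines "A \<equiv> mat 1 + outer ((1/r - 1) *\<^sub>R e) e"
  shows "invertible A" "det A = 1 / r"
    "e \<bullet> (matrix_inv (A ** X ** transpose A) *v e) = r\<^sup>2 * (e \<bullet> (matrix_inv X *v e))"
    "trace_change (mat 1) A X =
      (r\<^sup>2 - 1) * (e \<bullet> (matrix_inv X *v e))"
proof -
  have ee: "e \<bullet> e = 1" using e by (simp add: norm_eq_1)
  show dA: "det A = 1 / r" by (simp add: A_def det_mat_1_plus_outer ee)
  show iA: "invertible A" using r by (simp add: invertible_det_nz dA)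
  have Ae: "A *v e = (1 / r) *\<^sub>R e"
    by (simp add: A_def matrix_vector_mult_add_rdistrib outer_mult_vec ee algebra_simps)
  have "A ** (mat 1 + outer ((r - 1) *\<^sub>R e) e) = A + outer ((r - 1) *\<^sub>R (A *v e)) e"
    by (simp add: matrix_add_ldistrib matrix_mul_outer matrix_vector_mult_scaleR)
  also have "\<dots> = mat 1 + ((1 / r - 1) + (r - 1) * (1 / r)) *\<^sub>R outer e e"
    unfolding Ae unfolding A_def by (simp add: outer_scaleR_left scaleR_add_left)
  also have "(1 / r - 1) + (r - 1) * (1 / r) = 0" using r by (simp add: field_simps)
  finally have "A ** (mat 1 + outer ((r - 1) *\<^sub>R e) e) = mat 1" by simp
  then have B: "matrix_inv A = mat 1 + (r - 1) *\<^sub>R outer e e"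
    by (simp add: matrix_inv_eqI outer_scaleR_left)
  then have Bt: "transpose (matrix_inv A) = mat 1 + (r - 1) *\<^sub>R outer e e"
    by (simp add: transpose_add transpose_scaleR transpose_outer)
  have Xi: "invertible X" using X by (rule pos_def_imp_invertible)
  have Be: "matrix_inv A *v e = r *\<^sub>R e"
    by (simp add: B matrix_vector_mult_add_rdistrib scaleR_matrix_vector_assoc[symmetric] outer_mult_vec ee algebra_simps)
  have "e \<bullet> (matrix_inv (A ** X ** transpose A) *v e) = (matrix_inv A *v e) \<bullet> (matrix_inv X *v (matrix_inv A *v e))"
    unfolding matrix_inv_congruence[OF iA Xi] matrix_vector_mul_assoc[symmetric]
    by (subst inner_mult_transpose) simp
  then show "e \<bullet> (matrix_inv (A ** X ** transpose A) *v e) = r\<^sup>2 * (e \<bullet> (matrix_inv X *v e))"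
    by (simp add: Be matrix_vector_mult_scaleR power2_eq_square)
  have "matrix_inv A ** mat 1 ** transpose (matrix_inv A) =
      mat 1 + ((r - 1) + (r - 1) * r) *\<^sub>R outer e e"
    unfolding Bt by (simp add: matrix_add_ldistrib matrix_mul_scaleR_right matrix_mul_outer Be outer_scaleR_left)
       (simp add: B scaleR_add_left)
  also have "(r - 1) + (r - 1) * r = r\<^sup>2 - 1" by (simp add: power2_eq_square algebra_simps)
  finally show "trace_change (mat 1) A X =
      (r\<^sup>2 - 1) * (e \<bullet> (matrix_inv X *v e))"
    by (simp add: matrix_add_rdistrib trace_add matrix_mul_scaleR_left trace_scaleR trace_outer_mul)
qed

text \<open>Stretching the axis by \<open>1 / \<surd>t\<close> multiplies \<open>\<eta> = e \<bullet> \<Sigma>\<^sup>-\<^sup>1 e\<close> by \<open>t\<close>, the kernel with the measure by a power of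
  \<open>t\<close>, and adds \<open>(t - 1) \<eta>\<close> to the trace. Averaging over \<open>t\<close> spreads \<open>\<eta>\<close> over the half-line with the
  unnormalized chi-square density. Applying the law to the constant function expresses the first
  factor on the right by the total mass.\<close>

lemma iw_quadratic_form_law:
  fixes e :: "real^'n" and g :: "real \<Rightarrow> ennreal" and d :: real
  assumes e: "norm e = 1" and g [measurable]: "g \<in> borel_measurable borel"
  defines "\<eta> \<equiv> (\<lambda>X. e \<bullet> (matrix_inv X *v e))" and "a \<equiv> (d - real CARD('n) - 1) / 2"
  shows "(\<integral>\<^sup>+X. g (\<eta> X) * ennreal (iw_kernel d (mat 1) X) \<partial>lebesgue_sym) =
    (\<integral>\<^sup>+X. ennreal (exp (\<eta> X / 2 - 1 / \<eta> X) * \<eta> X powr (- a - 1)) * ennreal (iw_kernel d (mat 1) X) \<partial>lebesgue_sym) *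
    (\<integral>\<^sup>+s. g s * ennreal (if s > 0 then s powr (a - 1) * exp (- s/2) else 0) \<partial>lborel)"
proof -
  interpret S: sigma_finite_measure "lebesgue_sym :: (real^'n^'n) measure" by (rule sigma_finite_lebesgue_sym)
  interpret pair_sigma_finite "lebesgue_sym :: (real^'n^'n) measure" "lborel :: real measure" ..
  have [measurable]: "\<eta> \<in> borel_measurable borel" unfolding \<eta>_def by measurable
  have e0: "e \<noteq> 0" using e by auto
  have eta_pos: "\<eta> X > 0" if "pos_def X" for X
    using pos_def_matrix_inv[OF that] e0 by (simp add: \<eta>_def pos_def_def)
  (* An exponential density in t for every X, inserted as a factor of mass one. Its rate 1 / eta makes
     the later substitution s = eta t linear. *)
  define w where "w X t = ennreal (if t > 0 then exp (- t / \<eta> X) / \<eta> X else 0)" for X :: "real^'n^'n" and t :: real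
  have [measurable]: "(\<lambda>x. w (p x) (q x)) \<in> borel_measurable M"
    if [measurable]: "p \<in> borel_measurable M" "q \<in> borel_measurable M" for p q and M :: "'z measure"
    unfolding w_def by measurable
  have w_mass: "(\<integral>\<^sup>+t. w X t \<partial>lborel) = 1" if "pos_def X" for X
  proof -
    have "(\<integral>\<^sup>+t. w X t \<partial>lborel) = (\<integral>\<^sup>+t. ennreal (exponential_density (1 / \<eta> X) t) \<partial>lborel)"
    proof (rule nn_integral_cong_AE, rule eventually_mono[OF AE_lborel_singleton[of 0]])
      fix t :: real assume "t \<noteq> 0"
      then show "w X t = ennreal (exponential_density (1 / \<eta> X) t)"
        by (auto simp: w_def exponential_density_def)
    qed
    also have "\<dots> = emeasure (density lborel (exponential_density (1 / \<eta> X))) (space lborel)"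
      by (subst emeasure_density) (auto intro!: nn_integral_cong)
    also have "\<dots> = 1"
      using prob_space.emeasure_space_1[OF prob_space_exponential_density[of "1 / \<eta> X"]] eta_pos[OF that] by simp
    finally show ?thesis .
  qed
  let ?k = "\<lambda>X. ennreal (iw_kernel d (mat 1) X)"
  let ?q = "\<lambda>s :: real. ennreal (if s > 0 then s powr (a - 1) * exp (- s/2) else 0)"
  let ?c = "\<lambda>X. ennreal (exp (\<eta> X / 2 - 1 / \<eta> X) * \<eta> X powr (- a - 1))"
  let ?G = "\<lambda>X t. ?c X * (ennreal \<bar>\<eta> X\<bar> * (g (0 + \<eta> X * t) * ?q (0 + \<eta> X * t))) * ?k X"
  have "(\<integral>\<^sup>+X. g (\<eta> X) * ?k X \<partial>lebesgue_sym) = (\<integral>\<^sup>+X. \<integral>\<^sup>+t. g (\<eta> X) * w X t * ?k X \<partial>lborel \<partial>lebesgue_sym)"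
  proof (rule nn_integral_cong)
    fix X :: "real^'n^'n"
    show "g (\<eta> X) * ?k X = (\<integral>\<^sup>+t. g (\<eta> X) * w X t * ?k X \<partial>lborel)"
    proof (cases "pos_def X")
      case True
      then show ?thesis by (simp add: nn_integral_multc nn_integral_cmult w_mass)
    qed (simp add: iw_kernel_def)
  qed
  also have "\<dots> = (\<integral>\<^sup>+t. \<integral>\<^sup>+X. g (\<eta> X) * w X t * ?k X \<partial>lebesgue_sym \<partial>lborel)"
    by (rule Fubini'[symmetric]) measurable
  also have "\<dots> = (\<integral>\<^sup>+t. \<integral>\<^sup>+X. ?G X t \<partial>lebesgue_sym \<partial>lborel)"
  proof (rule nn_integral_cong)
    fix t :: real
    show "(\<integral>\<^sup>+X. g (\<eta> X) * w X t * ?k X \<partial>lebesgue_sym) =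
      (\<integral>\<^sup>+X. ?G X t \<partial>lebesgue_sym)"
    proof (cases "t > 0")
      case t: True
      define r where "r = sqrt t"
      have r: "r > 0" "r\<^sup>2 = t" using t by (auto simp: r_def)
      define A where "A = mat 1 + outer ((1/r - 1) *\<^sub>R e) e"
      note st = iw_stretch[OF e r(1), folded A_def]
      have iA: "invertible A" "det A = 1 / r" using st(1,2)[OF pos_def_mat_1] .
      have "(\<lambda>X. g (\<eta> X) * w X t) \<in> borel_measurable borel" by measurable
      note nn_integral_iw_congruence[OF iA(1) this, of d "mat 1"]
      also have "\<bar>det A\<bar> powr (real CARD('n) + 1 - d) = t powr a"
      proof -
        have "\<bar>det A\<bar> = t powr (- (1/2))" using r(1) t by (simp add: iA(2) r_def powr_minus_divide powr_half_sqrt)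
        moreover have "- (1/2) * (real CARD('n) + 1 - d) = a" by (simp add: a_def field_simps)
        ultimately show ?thesis by (simp only: powr_powr)
      qed
      also have "ennreal (t powr a) * (\<integral>\<^sup>+X. g (\<eta> (A ** X ** transpose A)) * w (A ** X ** transpose A) t *
           ennreal (exp (- (1/2) * trace_change (mat 1) A X)) * ?k X \<partial>lebesgue_sym) =
         (\<integral>\<^sup>+X. ennreal (t powr a) * (g (\<eta> (A ** X ** transpose A)) * w (A ** X ** transpose A) t *
           ennreal (exp (- (1/2) * trace_change (mat 1) A X)) * ?k X) \<partial>lebesgue_sym)"
        by (rule nn_integral_cmult[symmetric]) measurable
      also have "\<dots> = (\<integral>\<^sup>+X. ?G X t \<partial>lebesgue_sym)"
      proof (rule nn_integral_cong)
        fix X :: "real^'n^'n"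
        let ?Y = "A ** X ** transpose A"
        show "ennreal (t powr a) * (g (\<eta> ?Y) * w ?Y t *
           ennreal (exp (- (1/2) * trace_change (mat 1) A X)) * ?k X) =
           ?G X t"
        proof (cases "pos_def X")
          case True
          note eta = eta_pos[OF True]
          have eta': "\<eta> ?Y = \<eta> X * t" using st(3)[OF True] r(2) by (simp add: \<eta>_def mult.commute)
          have tr: "trace_change (mat 1) A X = (t - 1) * \<eta> X"
            using st(4)[OF True] r(2) by (simp add: \<eta>_def)
          have et: "\<eta> X * t > 0" using eta t by simp
          have m: "(\<eta> X * t) powr (a - 1) = \<eta> X powr a / \<eta> X * (t powr a / t)"
            using eta t by (simp add: powr_mult powr_diff)
          have n: "\<eta> X powr (- a - 1) = 1 / (\<eta> X powr a * \<eta> X)"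
            using eta powr_minus_divide[of "\<eta> X" "a + 1"] by (simp add: powr_add)
          have x1: "exp (\<eta> X / 2 - 1 / \<eta> X) * exp (- (\<eta> X * t) / 2) = exp (- 1 / \<eta> X) * exp (- (1/2) * ((t - 1) * \<eta> X))"
            by (simp add: exp_add[symmetric] field_simps)
          have "t powr a * (exp (- t / (\<eta> X * t)) / (\<eta> X * t)) * exp (- (1/2) * ((t - 1) * \<eta> X)) =
             (t powr a / (\<eta> X * t)) * (exp (- 1 / \<eta> X) * exp (- (1/2) * ((t - 1) * \<eta> X)))"
            using t by simp
          also have "\<dots> = (exp (\<eta> X / 2 - 1 / \<eta> X) * \<eta> X powr (- a - 1)) * (\<eta> X * ((\<eta> X * t) powr (a - 1) * exp (- (\<eta> X * t) / 2)))"
            unfolding x1[symmetric] m n using eta t by (simp add: field_simps)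
          finally have key: "t powr a * (exp (- t / (\<eta> X * t)) / (\<eta> X * t)) * exp (- (1/2) * ((t - 1) * \<eta> X)) = \<dots>" .
          have E: "ennreal (t powr a) * ennreal (exp (- t / (\<eta> X * t)) / (\<eta> X * t)) * ennreal (exp (- (1/2) * ((t - 1) * \<eta> X))) =
             ?c X * (ennreal (\<eta> X) * ennreal ((\<eta> X * t) powr (a - 1) * exp (- (\<eta> X * t) / 2)))"
            using key eta t by (simp only: ennreal_mult[symmetric] powr_ge_zero exp_ge_zero mult_nonneg_nonneg less_imp_le divide_nonneg_nonneg et)
          have w': "w ?Y t = ennreal (exp (- t / (\<eta> X * t)) / (\<eta> X * t))"
            unfolding w_def eta' using t by simp
          have q': "?q (0 + \<eta> X * t) = ennreal ((\<eta> X * t) powr (a - 1) * exp (- (\<eta> X * t) / 2))"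
            using et by simp
          have ab: "\<bar>\<eta> X\<bar> = \<eta> X" using eta by simp
          have "ennreal (t powr a) * (g (\<eta> X * t) * u1 * u2 * ?k X) = (ennreal (t powr a) * u1 * u2) * (g (\<eta> X * t) * ?k X)" for u1 u2
            by (simp only: mult_ac)
          moreover have "(?c X * (ennreal (\<eta> X) * u3)) * (g (\<eta> X * t) * ?k X) = ?c X * (ennreal (\<eta> X) * (g (\<eta> X * t) * u3)) * ?k X" for u3
            by (simp only: mult_ac)
          ultimately show ?thesis unfolding eta' tr w' q' ab E by (simp only: add_0_left E)
        qed (simp add: iw_kernel_def)
      qed
      finally show ?thesis .
    next
      case False
      have "w X t = 0" for X using False by (simp add: w_def)
      moreover have "?G X t = 0" for X
      proof (cases "pos_def X")
        case True
        then have "\<not> 0 + \<eta> X * t > 0" using False eta_pos[OF True] by (simp add: zero_less_mult_iff)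
        then have "?q (0 + \<eta> X * t) = 0" by (simp only: if_False ennreal_0)
        then show ?thesis by (simp only: mult_zero_left mult_zero_right)
      qed (simp add: iw_kernel_def)
      ultimately show ?thesis by (simp only: mult_zero_left mult_zero_right nn_integral_0_iff_AE nn_integral_const)
    qed
  qed
  also have "\<dots> = (\<integral>\<^sup>+X. \<integral>\<^sup>+t. ?G X t \<partial>lborel \<partial>lebesgue_sym)"
    by (rule Fubini') measurable
  also have "\<dots> = (\<integral>\<^sup>+X. ?c X * ?k X * (\<integral>\<^sup>+s. g s * ?q s \<partial>lborel) \<partial>lebesgue_sym)"
  proof (rule nn_integral_cong)
    fix X :: "real^'n^'n"
    show "(\<integral>\<^sup>+t. ?G X t \<partial>lborel) =
      ?c X * ?k X * (\<integral>\<^sup>+s. g s * ?q s \<partial>lborel)"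
    proof (cases "pos_def X")
      case True
      have "(\<integral>\<^sup>+t. ?G X t \<partial>lborel) =
         ?c X * (\<integral>\<^sup>+t. ennreal \<bar>\<eta> X\<bar> * (g (0 + \<eta> X * t) * ?q (0 + \<eta> X * t)) \<partial>lborel) * ?k X"
        by (subst nn_integral_multc, measurable) (subst nn_integral_cmult, measurable)
      also have "(\<integral>\<^sup>+t. ennreal \<bar>\<eta> X\<bar> * (g (0 + \<eta> X * t) * ?q (0 + \<eta> X * t)) \<partial>lborel) = (\<integral>\<^sup>+s. g s * ?q s \<partial>lborel)"
      proof -
        have m: "(\<lambda>s. g s * ?q s) \<in> borel_measurable borel" by measurable
        have nz: "\<eta> X \<noteq> 0" using eta_pos[OF True] by simp
        from nn_integral_lborel_affine_subst[OF m nz, of 0] show ?thesis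
          by (simp only: real_scaleR_def DIM_real power_one_right)
      qed
      finally show ?thesis by (simp add: mult_ac)
    qed (simp add: iw_kernel_def)
  qed
  also have "\<dots> = (\<integral>\<^sup>+X. ?c X * ?k X \<partial>lebesgue_sym) * (\<integral>\<^sup>+s. g s * ?q s \<partial>lborel)"
    by (rule nn_integral_multc) measurable
  finally show ?thesis .
qed

lemma borel_measurable_chi_square_density [measurable]: "chi_square_density \<nu> \<in> borel_measurable borel"
  unfolding chi_square_density_def[abs_def] by measurable

text \<open>The constant of the previous law is eliminated by the instance for the constant function.\<close>

lemma iw_quadratic_form_chi_square:
  fixes e :: "real^'n" and g :: "real \<Rightarrow> ennreal" and d :: real
  assumes e: "norm e = 1" and g [measurable]: "g \<in> borel_measurable borel" and \<nu>: "d - real CARD('n) - 1 > 0"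
    and chi: "(\<integral>\<^sup>+s. ennreal (chi_square_density (d - real CARD('n) - 1) s) \<partial>lborel) = 1"
  shows "(\<integral>\<^sup>+X. g (e \<bullet> (matrix_inv X *v e)) * ennreal (iw_kernel d (mat 1) X) \<partial>lebesgue_sym) =
    iw_mass d (mat 1 :: real^'n^'n) * (\<integral>\<^sup>+s. g s * ennreal (chi_square_density (d - real CARD('n) - 1) s) \<partial>lborel)"
proof -
  define \<nu> where "\<nu> = d - real CARD('n) - 1"
  define C where "C = 2 powr (\<nu>/2) * Gamma (\<nu>/2)"
  have C: "C > 0" using \<nu> by (simp add: C_def Gamma_real_pos \<nu>_def)
  have q: "ennreal (if s > 0 then s powr (\<nu>/2 - 1) * exp (- s/2) else 0) = ennreal C * ennreal (chi_square_density \<nu> s)" for s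
  proof -
    have "chi_square_density \<nu> s = (if s > 0 then s powr (\<nu>/2 - 1) * exp (- s/2) / C else 0)"
      by (simp add: chi_square_density_def C_def)
    then show ?thesis using C by (simp add: ennreal_mult'[symmetric])
  qed
  obtain K where K: "\<And>g :: real \<Rightarrow> ennreal. g \<in> borel_measurable borel \<Longrightarrow>
      (\<integral>\<^sup>+X. g (e \<bullet> (matrix_inv X *v e)) * ennreal (iw_kernel d (mat 1) X) \<partial>lebesgue_sym) =
      K * (\<integral>\<^sup>+s. g s * ennreal (if s > 0 then s powr (\<nu>/2 - 1) * exp (- s/2) else 0) \<partial>lborel)"
    using iw_quadratic_form_law[OF e, of _ d, folded \<nu>_def] by blast
  have K': "(\<integral>\<^sup>+X. g (e \<bullet> (matrix_inv X *v e)) * ennreal (iw_kernel d (mat 1) X) \<partial>lebesgue_sym) =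
      K * ennreal C * (\<integral>\<^sup>+s. g s * ennreal (chi_square_density \<nu> s) \<partial>lborel)"
    if [measurable]: "g \<in> borel_measurable borel" for g :: "real \<Rightarrow> ennreal"
  proof -
    have "(\<integral>\<^sup>+s. g s * (ennreal C * ennreal (chi_square_density \<nu> s)) \<partial>lborel) =
       (\<integral>\<^sup>+s. ennreal C * (g s * ennreal (chi_square_density \<nu> s)) \<partial>lborel)" by (simp only: mult_ac)
    also have "\<dots> = ennreal C * (\<integral>\<^sup>+s. g s * ennreal (chi_square_density \<nu> s) \<partial>lborel)"
      by (rule nn_integral_cmult) measurable
    finally show ?thesis using K[OF that] by (simp only: q mult.assoc)
  qed
  have "iw_mass d (mat 1 :: real^'n^'n) = K * ennreal C"
    using K'[of "\<lambda>_. 1"] chi by (simp add: \<nu>_def)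
  then show ?thesis using K'[OF g] by (simp add: \<nu>_def)
qed

lemma iw_column_law:
  fixes e :: "real^'n" and g :: "real^'n \<Rightarrow> ennreal"
  assumes e: "norm e = 1" and g [measurable]: "g \<in> borel_measurable borel" and \<nu>: "d - real CARD('n) - 1 > 0"
    and chi: "(\<integral>\<^sup>+s. ennreal (chi_square_density (d - real CARD('n) - 1) s) \<partial>lborel) = 1"
  shows "(\<integral>\<^sup>+X. g (matrix_inv X *v e) * ennreal (iw_kernel d (mat 1) X) \<partial>lebesgue_sym) =
    iw_mass d (mat 1 :: real^'n^'n) *
    (\<integral>\<^sup>+s. (\<integral>\<^sup>+y. ennreal (std_gauss y) * g (s *\<^sub>R e + sqrt s *\<^sub>R (proj_perp e *v y)) \<partial>lborel)
       * ennreal (chi_square_density (d - real CARD('n) - 1) s) \<partial>lborel)"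
  unfolding iw_column_gaussian[OF e g]
  by (rule iw_quadratic_form_chi_square[OF e _ \<nu> chi]) measurable

lemma powr_two_half: "(x powr 2) powr (c / 2) = x powr (c :: real)"
  by (simp add: powr_powr)

lemma pos_def_sqrt:
  fixes S :: "real^'n^'n"
  assumes S: "pos_def S"
  obtains B where "transpose B = B" "B ** B = S" "invertible B" "pos_semidef B"
proof -
  obtain B where B: "pos_semidef B" "B ** B = S"
    using pos_semidef_sqrt_exists[OF pos_def_imp_semidef[OF S]] .
  then have "invertible B" using invertible_sqrt pos_def_imp_invertible[OF S] by blast
  with B that show thesis by (auto simp: pos_semidef_def)
qed

text \<open>Choose \<open>B\<close> with \<open>B B = S\<close> and a unit vector \<open>e\<close> with \<open>b = c B e\<close>. The congruence with \<open>B\<close> reduces the law of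
  \<open>\<Sigma>\<^sup>-\<^sup>1 b\<close> to that of the column \<open>\<Sigma>\<^sup>-\<^sup>1 e\<close> under unit scale; \<open>K\<close> is \<open>c B\<^sup>-\<^sup>1\<close> times the projection along \<open>e\<close>.\<close>

theorem iw_vector_law:
  fixes S :: "real^'n^'n" and b :: "real^'n" and d :: real
  assumes S: "pos_def S" and \<nu>: "d - real CARD('n) - 1 > 0"
    and chi: "(\<integral>\<^sup>+s. ennreal (chi_square_density (d - real CARD('n) - 1) s) \<partial>lborel) = 1"
  defines "V \<equiv> matrix_inv S"
  shows "\<exists>K :: real^'n^'n. K ** transpose K = (b \<bullet> (V *v b)) *\<^sub>R V - outer (V *v b) (V *v b) \<and>
    (\<forall>g\<in>borel_measurable borel.
      (\<integral>\<^sup>+X. g (matrix_inv X *v b) * ennreal (iw_kernel d S X) \<partial>lebesgue_sym) =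
      ennreal (det S powr ((real CARD('n) + 1 - d) / 2)) * iw_mass d (mat 1 :: real^'n^'n) *
      (\<integral>\<^sup>+s. (\<integral>\<^sup>+y. ennreal (std_gauss y) * g (s *\<^sub>R (V *v b) + sqrt s *\<^sub>R (K *v y)) \<partial>lborel)
         * ennreal (chi_square_density (d - real CARD('n) - 1) s) \<partial>lborel))"
proof -
  obtain B where B: "transpose B = B" "B ** B = S" "invertible B" using pos_def_sqrt[OF S] by blast
  let ?R = "matrix_inv B"
  have Rt: "transpose ?R = ?R" using B(1,3) by (metis matrix_inv_transpose)
  have V: "V = ?R ** ?R" unfolding V_def B(2)[symmetric] using B(3) by (rule matrix_inv_mul[OF B(3)])
  define c where "c = norm (?R *v b)"
  obtain e :: "real^'n" where e: "norm e = 1" "?R *v b = c *\<^sub>R e"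
  (* For b = 0 the constant c vanishes and every unit vector will do. *)
  proof (cases "?R *v b = 0")
    case True
    have "norm (axis undefined 1 :: real^'n) = 1" by simp
    from that[OF this] show thesis using True by (simp add: c_def)
  next
    case False
    then show thesis using that[of "(1 / c) *\<^sub>R (?R *v b)"] by (simp add: c_def)
  qed
  have ee: "e \<bullet> e = 1" using e(1) by (simp add: norm_eq_1)
  have Vb: "V *v b = c *\<^sub>R (?R *v e)"
    by (simp add: V matrix_vector_mul_assoc[symmetric] e(2) matrix_vector_mult_scaleR)
  have bVb: "b \<bullet> (V *v b) = c * c"
    unfolding V matrix_vector_mul_assoc[symmetric] inner_mult_transpose[of b] Rt
    by (simp add: e(2) ee)
  define K where "K = c *\<^sub>R (?R ** proj_perp e)"
  have Pt: "transpose (proj_perp e) = proj_perp e" by (simp add: proj_perp_def transpose_diff transpose_outer)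
  have "proj_perp e ** (mat 1 - outer e e) = proj_perp e - outer (proj_perp e *v e) e"
    by (simp add: matrix_sub_ldistrib matrix_mul_outer)
  also have "outer (proj_perp e *v e) e = 0"
    by (simp add: proj_perp_mult ee) (simp add: outer_def vec_eq_iff)
  finally have PP: "proj_perp e ** proj_perp e = proj_perp e" by (simp add: proj_perp_def)
  have "K ** transpose K = (c * c) *\<^sub>R (?R ** (proj_perp e ** proj_perp e) ** ?R)"
    by (simp add: K_def transpose_scaleR matrix_transpose_mul Rt Pt matrix_mul_scaleR_left matrix_mul_scaleR_right matrix_mul_assoc)
  also have "\<dots> = (c * c) *\<^sub>R V - (c * c) *\<^sub>R outer (?R *v e) (?R *v e)"
    unfolding PP by (simp add: proj_perp_def matrix_sub_ldistrib matrix_sub_rdistrib V matrix_mul_outer outer_matrix_mul Rt scaleR_diff_right)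
  also have "(c * c) *\<^sub>R outer (?R *v e) (?R *v e) = outer (V *v b) (V *v b)"
    unfolding Vb by (simp add: outer_def vec_eq_iff)
  finally have K: "K ** transpose K = (b \<bullet> (V *v b)) *\<^sub>R V - outer (V *v b) (V *v b)" unfolding bVb .
  have dB: "\<bar>det B\<bar> powr (real CARD('n) + 1 - d) = det S powr ((real CARD('n) + 1 - d) / 2)"
  proof -
    have "det B \<noteq> 0" using B(3) invertible_det_nz by blast
    then have "det S = \<bar>det B\<bar> powr 2" by (simp add: B(2)[symmetric] det_mul power2_eq_square)
    then show ?thesis by (simp only: powr_two_half)
  qed
  have "(\<integral>\<^sup>+X. g (matrix_inv X *v b) * ennreal (iw_kernel d S X) \<partial>lebesgue_sym) =
      ennreal (det S powr ((real CARD('n) + 1 - d) / 2)) * iw_mass d (mat 1 :: real^'n^'n) *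
      (\<integral>\<^sup>+s. (\<integral>\<^sup>+y. ennreal (std_gauss y) * g (s *\<^sub>R (V *v b) + sqrt s *\<^sub>R (K *v y)) \<partial>lborel)
         * ennreal (chi_square_density (d - real CARD('n) - 1) s) \<partial>lborel)"
    if [measurable]: "g \<in> borel_measurable borel" for g
  proof -
    have "(\<integral>\<^sup>+X. g (matrix_inv X *v b) * ennreal (iw_kernel d S X) \<partial>lebesgue_sym) =
      ennreal (\<bar>det B\<bar> powr (real CARD('n) + 1 - d)) *
      (\<integral>\<^sup>+X. g (matrix_inv (B ** X ** transpose B) *v b) * ennreal (iw_kernel d (mat 1) X) \<partial>lebesgue_sym)"
      using nn_integral_iw_standardize[OF B(3), of "\<lambda>X. g (matrix_inv X *v b)" d] by (simp add: B(1,2))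
    also have "(\<integral>\<^sup>+X. g (matrix_inv (B ** X ** transpose B) *v b) * ennreal (iw_kernel d (mat 1) X) \<partial>lebesgue_sym) =
      (\<integral>\<^sup>+X. g (c *\<^sub>R (?R *v (matrix_inv X *v e))) * ennreal (iw_kernel d (mat 1) X) \<partial>lebesgue_sym)"
    proof (rule nn_integral_cong)
      fix X :: "real^'n^'n"
      show "g (matrix_inv (B ** X ** transpose B) *v b) * ennreal (iw_kernel d (mat 1) X) =
         g (c *\<^sub>R (?R *v (matrix_inv X *v e))) * ennreal (iw_kernel d (mat 1) X)"
      proof (cases "pos_def X")
        case True
        then show ?thesis
          by (simp only: matrix_inv_congruence[OF B(3) pos_def_imp_invertible[OF True]] Rt
              matrix_vector_mul_assoc[symmetric] e(2) matrix_vector_mult_scaleR)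
      qed (simp add: iw_kernel_def)
    qed
    also have "\<dots> = iw_mass d (mat 1 :: real^'n^'n) *
      (\<integral>\<^sup>+s. (\<integral>\<^sup>+y. ennreal (std_gauss y) * g (c *\<^sub>R (?R *v (s *\<^sub>R e + sqrt s *\<^sub>R (proj_perp e *v y)))) \<partial>lborel)
         * ennreal (chi_square_density (d - real CARD('n) - 1) s) \<partial>lborel)"
      by (rule iw_column_law[OF e(1) _ \<nu> chi]) measurable
    also have "(\<lambda>s y. c *\<^sub>R (?R *v (s *\<^sub>R e + sqrt s *\<^sub>R (proj_perp e *v y)))) =
      (\<lambda>s y. s *\<^sub>R (V *v b) + sqrt s *\<^sub>R (K *v y))"
      by (simp add: fun_eq_iff Vb K_def matrix_vector_right_distrib matrix_vector_mult_scaleR scaleR_add_right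
          scaleR_matrix_vector_assoc[symmetric] matrix_vector_mul_assoc)
         (simp add: mult.commute)
    finally show ?thesis by (simp only: dB mult.assoc)
  qed
  with K show ?thesis by blast
qed

lemma iw_mass_scale:
  fixes S :: "real^'n^'n"
  assumes S: "pos_def S"
  shows "iw_mass d S = ennreal (det S powr ((real CARD('n) + 1 - d) / 2)) * iw_mass d (mat 1 :: real^'n^'n)"
proof -
  obtain B where B: "transpose B = B" "B ** B = S" "invertible B" using pos_def_sqrt[OF S] by blast
  have "det B \<noteq> 0" using B(3) invertible_det_nz by blast
  then have "det S = \<bar>det B\<bar> powr 2" by (simp add: B(2)[symmetric] det_mul power2_eq_square)
  then have dB: "\<bar>det B\<bar> powr (real CARD('n) + 1 - d) = det S powr ((real CARD('n) + 1 - d) / 2)"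
    by (simp only: powr_two_half)
  show ?thesis using nn_integral_iw_standardize[OF B(3), of "\<lambda>_. 1" d] by (simp add: B(1,2) dB)
qed

section \<open>The total mass of the inverse Wishart kernel\<close>

text \<open>Comparison with \<open>(1 + \<bar>x\<bar>) powr (- 2 a)\<close>, which has an elementary primitive on each half-line.\<close>

lemma nn_integral_inverse_power_finite:
  fixes a :: real
  assumes a: "a > 1/2"
  shows "(\<integral>\<^sup>+x. ennreal ((1 + x\<^sup>2) powr (- a)) \<partial>lborel) < \<infinity>"
proof -
  define h where "h x = (1 + x) powr (- 2 * a) * indicator {0..} x" for x :: real
  have [measurable]: "h \<in> borel_measurable borel" unfolding h_def[abs_def] by measurable
  have "(\<integral>\<^sup>+x. ennreal (h x) \<partial>lborel) = (\<integral>\<^sup>+x. ennreal ((1 + x) powr (- 2 * a)) * indicator {0..} x \<partial>lborel)"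
    unfolding h_def by (intro nn_integral_cong) (auto simp: indicator_def)
  also have "\<dots> = ennreal (0 - (1 + 0) powr (1 - 2 * a) / (1 - 2 * a))"
  proof (rule nn_integral_FTC_atLeast)
    show "((\<lambda>x. (1 + x) powr (1 - 2 * a) / (1 - 2 * a)) has_real_derivative (1 + x) powr (- 2 * a)) (at x)" if "0 \<le> x" for x
    proof -
      have "((\<lambda>x. (1 + x) powr (1 - 2 * a) / (1 - 2 * a)) has_real_derivative
         ((1 - 2 * a) * (1 + x) powr (1 - 2 * a - 1)) / (1 - 2 * a)) (at x)"
        using that by (auto intro!: derivative_eq_intros)
      then show ?thesis using a by simp
    qed
    have "((\<lambda>x :: real. (1 + x) powr (1 - 2 * a)) \<longlongrightarrow> 0) at_top"
      using a by (intro tendsto_neg_powr filterlim_tendsto_add_at_top[OF tendsto_const filterlim_ident]) auto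
    from tendsto_divide[OF this tendsto_const, of "1 - 2 * a"]
    show "((\<lambda>x. (1 + x) powr (1 - 2 * a) / (1 - 2 * a)) \<longlongrightarrow> 0) at_top" using a by simp
  qed auto
  finally have fin: "(\<integral>\<^sup>+x. ennreal (h x) \<partial>lborel) < \<infinity>" by simp
  have refl: "(\<integral>\<^sup>+x. ennreal (h (- x)) \<partial>lborel) = (\<integral>\<^sup>+x. ennreal (h x) \<partial>lborel)"
    using nn_integral_lborel_affine_subst[of "\<lambda>x. ennreal (h x)" "-1" 0] by simp
  have "(\<integral>\<^sup>+x. ennreal ((1 + x\<^sup>2) powr (- a)) \<partial>lborel) \<le> (\<integral>\<^sup>+x. ennreal (2 powr a) * (ennreal (h x) + ennreal (h (- x))) \<partial>lborel)"
  proof (rule nn_integral_mono)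
    fix x :: real
    have "0 \<le> (1 - \<bar>x\<bar>)\<^sup>2" by simp
    then have "(1 + \<bar>x\<bar>) powr 2 / 2 \<le> 1 + x\<^sup>2" by (simp add: power2_eq_square algebra_simps)
    then have "(1 + x\<^sup>2) powr (- a) \<le> ((1 + \<bar>x\<bar>) powr 2 / 2) powr (- a)"
      using a by (intro powr_mono2') auto
    also have "\<dots> = (1 + \<bar>x\<bar>) powr (- 2 * a) * 2 powr a"
    proof -
      have "((1 + \<bar>x\<bar>) powr 2 / 2) powr (- a) = ((1 + \<bar>x\<bar>) powr 2) powr (- a) / 2 powr (- a)"
        by (rule powr_divide)
      also have "((1 + \<bar>x\<bar>) powr 2) powr (- a) = (1 + \<bar>x\<bar>) powr (- 2 * a)" by (simp only: powr_powr) simp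
      finally show ?thesis by (simp add: powr_minus_divide)
    qed
    also have "\<dots> \<le> 2 powr a * (h x + h (- x))"
      by (cases "x \<ge> 0") (auto simp: h_def indicator_def mult.commute)
    finally have "ennreal ((1 + x\<^sup>2) powr (- a)) \<le> ennreal (2 powr a * (h x + h (- x)))" by (rule ennreal_leI)
    also have "\<dots> = ennreal (2 powr a) * (ennreal (h x) + ennreal (h (- x)))"
      by (simp add: ennreal_mult'' ennreal_plus h_def)
    finally show "ennreal ((1 + x\<^sup>2) powr (- a)) \<le> ennreal (2 powr a) * (ennreal (h x) + ennreal (h (- x)))" .
  qed
  also have "\<dots> = ennreal (2 powr a) * ((\<integral>\<^sup>+x. ennreal (h x) \<partial>lborel) + (\<integral>\<^sup>+x. ennreal (h x) \<partial>lborel))"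
    by (subst nn_integral_cmult, measurable) (subst nn_integral_add, auto simp: refl)
  also have "\<dots> < \<infinity>" using fin by (auto simp: ennreal_mult_less_top)
  finally show ?thesis .
qed

text \<open>Spreading the exponent evenly over the coordinates bounds the kernel by a product of integrable
  functions of one variable.\<close>

lemma nn_integral_student_kernel_finite:
  fixes \<beta> :: real
  assumes \<beta>: "\<beta> > DIM('a)"
  shows "(\<integral>\<^sup>+y. ennreal ((1 + (norm y)\<^sup>2) powr (- \<beta> / 2)) \<partial>(lborel :: 'a::euclidean_space measure)) < \<infinity>"
proof -
  define a where "a = \<beta> / (2 * DIM('a))"
  have a: "a > 1/2" "DIM('a) * a = \<beta> / 2" using \<beta> by (auto simp: a_def field_simps)
  have "(\<integral>\<^sup>+y. ennreal ((1 + (norm y)\<^sup>2) powr (- \<beta> / 2)) \<partial>(lborel :: 'a measure)) \<le>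
    (\<integral>\<^sup>+y. (\<Prod>b\<in>Basis. ennreal ((1 + (y \<bullet> b)\<^sup>2) powr (- a))) \<partial>(lborel :: 'a measure))"
  proof (rule nn_integral_mono)
    fix y :: 'a
    have le: "(1 + (norm y)\<^sup>2) powr (- a) \<le> (1 + (y \<bullet> b)\<^sup>2) powr (- a)" if "b \<in> Basis" for b
    proof (rule powr_mono2')
      have "\<bar>y \<bullet> b\<bar> \<le> \<bar>norm y\<bar>" using Basis_le_norm[OF that, of y] by simp
      then have "(y \<bullet> b)\<^sup>2 \<le> (norm y)\<^sup>2" by (simp only: abs_le_square_iff)
      then show "1 + (y \<bullet> b)\<^sup>2 \<le> 1 + (norm y)\<^sup>2" by simp
    qed (use a in \<open>auto simp: add_pos_nonneg\<close>)
    have "(1 + (norm y)\<^sup>2) powr (- \<beta> / 2) = ((1 + (norm y)\<^sup>2) powr (- a)) powr (DIM('a))"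
    proof -
      have "- a * real DIM('a) = - \<beta> / 2" using a(2) by (simp add: mult.commute)
      then show ?thesis by (simp only: powr_powr)
    qed
    also have "\<dots> = (\<Prod>b\<in>(Basis::'a set). (1 + (norm y)\<^sup>2) powr (- a))"
    proof -
      have "(1 + (norm y)\<^sup>2) powr (- a) > 0" by (simp add: add_nonneg_eq_0_iff)
      then show ?thesis by (subst powr_realpow) auto
    qed
    also have "\<dots> \<le> (\<Prod>b\<in>Basis. (1 + (y \<bullet> b)\<^sup>2) powr (- a))"
      by (intro prod_mono conjI le) auto
    finally show "ennreal ((1 + (norm y)\<^sup>2) powr (- \<beta> / 2)) \<le> (\<Prod>b\<in>Basis. ennreal ((1 + (y \<bullet> b)\<^sup>2) powr (- a)))"
      by (simp add: prod_ennreal ennreal_leI)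
  qed
  also have "\<dots> = (\<Prod>b\<in>(Basis::'a set). \<integral>\<^sup>+x. ennreal ((1 + x\<^sup>2) powr (- a)) \<partial>lborel)"
    by (rule nn_integral_lborel_prod) auto
  also have "\<dots> < \<infinity>"
    using nn_integral_inverse_power_finite[OF a(1)] by (simp add: power_less_top_ennreal)
  finally show ?thesis .
qed

text \<open>For large \<open>l\<close> the left side decays like the right side, and for small \<open>l\<close> the exponential kills the
  singularity. With \<open>u = 1 / l\<close> this is \<open>1 + u \<le> d exp ((1 + u) / d)\<close> raised to the power \<open>d/2\<close>.\<close>

lemma power_le_exp_bound:
  fixes d l :: real
  assumes d: "d > 0" and l: "l > 0"
  shows "l powr (- d/2) * exp (- (1/2) * (1 / l)) \<le> (d powr (d/2) * exp (1/2)) * (1 + l) powr (- d/2)"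
proof -
  define u where "u = 1 / l"
  have u: "u > 0" "l * u = 1" using l by (auto simp: u_def)
  have "(1 + u) / d \<le> exp ((1 + u) / d)" using exp_ge_add_one_self[of "(1 + u) / d"] by linarith
  then have "((1 + u) / d) powr (d/2) \<le> exp ((1 + u) / d) powr (d/2)"
    using d u by (intro powr_mono2) auto
  also have "\<dots> = exp (1/2) * exp (u/2)"
    using d by (simp add: exp_powr_real exp_add[symmetric] field_simps)
  finally have "(1 + u) powr (d/2) / d powr (d/2) \<le> exp (1/2) * exp (u/2)"
    using d u by (simp add: powr_divide)
  then have *: "(1 + u) powr (d/2) \<le> d powr (d/2) * exp (1/2) * exp (u/2)"
    using d by (simp add: divide_le_eq mult_ac)
  have "(1 + l) powr (d/2) = (l * (1 + u)) powr (d/2)" using u by (simp add: algebra_simps)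
  also have "\<dots> = l powr (d/2) * (1 + u) powr (d/2)" using l u by (simp add: powr_mult)
  finally have e: "(1 + l) powr (- d/2) = l powr (- d/2) / (1 + u) powr (d/2)"
    by (simp add: powr_minus_divide)
  have "l powr (- d/2) * exp (- (u/2)) = (1 + l) powr (- d/2) * ((1 + u) powr (d/2) * exp (- (u/2)))"
    unfolding e using u by simp
  also have "\<dots> \<le> (1 + l) powr (- d/2) * (d powr (d/2) * exp (1/2))"
  proof (rule mult_left_mono)
    have "(1 + u) powr (d/2) * exp (- (u/2)) \<le> (d powr (d/2) * exp (1/2) * exp (u/2)) * exp (- (u/2))"
      by (rule mult_right_mono[OF *]) simp
    also have "\<dots> = d powr (d/2) * exp (1/2)" by (simp add: mult.assoc exp_add[symmetric])
    finally show "(1 + u) powr (d/2) * exp (- (u/2)) \<le> d powr (d/2) * exp (1/2)" .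
  qed simp
  finally show ?thesis by (simp add: u_def mult_ac)
qed

lemma one_plus_sum_le_prod:
  fixes f :: "'a \<Rightarrow> real"
  assumes "finite I" "\<And>i. i \<in> I \<Longrightarrow> f i \<ge> 0"
  shows "1 + (\<Sum>i\<in>I. f i) \<le> (\<Prod>i\<in>I. 1 + f i)"
  using assms
proof (induction I)
  case (insert i I)
  have "0 \<le> f i" "0 \<le> (\<Sum>j\<in>I. f j)" using insert by (auto intro: sum_nonneg)
  then have "1 + (f i + (\<Sum>j\<in>I. f j)) \<le> (1 + f i) * (1 + (\<Sum>j\<in>I. f j))"
    by (simp add: algebra_simps)
  also have "\<dots> \<le> (1 + f i) * (\<Prod>j\<in>I. 1 + f j)"
    using insert \<open>0 \<le> f i\<close> by (intro mult_left_mono) auto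
  finally show ?case using insert by simp
qed simp

text \<open>Under the spectral theorem the kernel is a product over the eigenvalues, each factor of which is
  controlled by the previous bound.\<close>

lemma iw_kernel_le_trace:
  fixes X :: "real^'n^'n"
  assumes d: "d > 0" and X: "pos_def X"
  shows "iw_kernel d (mat 1) X \<le> (d powr (d/2) * exp (1/2)) ^ CARD('n) * (1 + trace X) powr (- d/2)"
    and "trace X > 0"
proof -
  obtain Q l where Q: "orthogonal_matrix Q" "X = Q ** diag_matrix l ** transpose Q" "\<And>i. l i \<ge> 0"
    using spectral_theorem_pos_semidef[OF pos_def_imp_semidef[OF X]] by blast
  have QQ: "transpose Q ** Q = mat 1" "Q ** transpose Q = mat 1" using Q(1) by (auto simp: orthogonal_matrix_def)
  have tr: "trace (Q ** diag_matrix f ** transpose Q) = (\<Sum>i\<in>UNIV. f i)" for f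
  proof -
    have "trace (Q ** diag_matrix f ** transpose Q) = trace (Q ** (diag_matrix f ** transpose Q))"
      by (simp only: matrix_mul_assoc)
    also have "\<dots> = trace (diag_matrix f ** (transpose Q ** Q))"
      by (subst trace_mul_sym) (simp only: matrix_mul_assoc)
    also have "\<dots> = (\<Sum>i\<in>UNIV. f i)" by (simp add: QQ) (simp add: trace_def diag_matrix_def)
    finally show ?thesis .
  qed
  have det: "det X = (\<Prod>i\<in>UNIV. l i)"
  proof -
    have "det X = det (Q ** transpose Q) * det (diag_matrix l)" by (simp add: Q(2) det_mul)
    then show ?thesis by (simp add: QQ det_diag_matrix)
  qed
  have l: "l i > 0" for i
  proof -
    have "(\<Prod>i\<in>UNIV. l i) \<noteq> 0" using det_pos_def[OF X] det by (metis less_irrefl)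
    then have "l i \<noteq> 0" by (metis UNIV_I finite prod_zero)
    then show ?thesis using Q(3)[of i] by simp
  qed
  have "X ** (Q ** diag_matrix (\<lambda>i. 1 / l i) ** transpose Q) =
      Q ** (diag_matrix l ** (transpose Q ** Q) ** diag_matrix (\<lambda>i. 1 / l i)) ** transpose Q"
    by (simp only: Q(2) matrix_mul_assoc)
  also have "diag_matrix l ** (transpose Q ** Q) ** diag_matrix (\<lambda>i. 1 / l i) = mat 1"
    using l by (simp add: QQ diag_matrix_mul less_imp_neq[symmetric]) (simp add: diag_matrix_def mat_def)
  finally have inv: "matrix_inv X = Q ** diag_matrix (\<lambda>i. 1 / l i) ** transpose Q"
    by (intro matrix_inv_eqI) (simp add: QQ)
  have trX: "trace X = (\<Sum>i\<in>UNIV. l i)" by (simp only: Q(2) tr)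
  show "trace X > 0" unfolding trX using l by (intro sum_pos) auto
  have "iw_kernel d (mat 1) X = (\<Prod>i\<in>UNIV. l i powr (- d/2) * exp (- (1/2) * (1 / l i)))"
  proof -
    have "exp (- (1/2) * (\<Sum>i\<in>UNIV. 1 / l i)) = (\<Prod>i\<in>UNIV. exp (- (1/2) * (1 / l i)))"
      by (simp only: sum_distrib_left exp_sum finite)
    moreover have "det X powr (- d/2) = (\<Prod>i\<in>UNIV. l i powr (- d/2))"
      unfolding det by (rule prod_powr_distrib)
    ultimately show ?thesis using X by (simp add: iw_kernel_def inv tr prod.distrib)
  qed
  also have "\<dots> \<le> (\<Prod>i\<in>UNIV. (d powr (d/2) * exp (1/2)) * (1 + l i) powr (- d/2))"
    by (intro prod_mono conjI power_le_exp_bound d l) auto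
  also have "\<dots> = (d powr (d/2) * exp (1/2)) ^ CARD('n) * (\<Prod>i\<in>UNIV. (1 + l i) powr (- d/2))"
    by (simp add: prod.distrib)
  also have "(\<Prod>i\<in>UNIV. (1 + l i) powr (- d/2)) = (\<Prod>i\<in>UNIV. 1 + l i) powr (- d/2)"
    by (rule prod_powr_distrib[symmetric])
  also have "(d powr (d/2) * exp (1/2)) ^ CARD('n) * (\<Prod>i\<in>UNIV. 1 + l i) powr (- d/2) \<le>
     (d powr (d/2) * exp (1/2)) ^ CARD('n) * (1 + trace X) powr (- d/2)"
    unfolding trX using l d
    by (intro mult_left_mono powr_mono2' one_plus_sum_le_prod add_pos_nonneg sum_nonneg) (auto intro: less_imp_le)
  finally show "iw_kernel d (mat 1) X \<le> (d powr (d/2) * exp (1/2)) ^ CARD('n) * (1 + trace X) powr (- d/2)" .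
qed

lemma pos_semidef_entry_le_trace:
  fixes X :: "real^'n^'n"
  assumes X: "pos_semidef X"
  shows "\<bar>X $ i $ j\<bar> \<le> trace X"
proof -
  have s: "X $ i $ j = X $ j $ i" using X by (auto simp: pos_semidef_def transpose_def vec_eq_iff)
  have q: "axis p 1 \<bullet> (X *v axis q 1) = X $ p $ q" for p q
    by (simp add: matrix_vector_mult_basis column_def inner_axis')
  have dd: "X $ p $ p \<ge> 0" for p using X q[of p p] by (metis pos_semidef_def)
  have "0 \<le> (axis i 1 + axis j 1) \<bullet> (X *v (axis i 1 + axis j 1))"
       "0 \<le> (axis i 1 - axis j 1) \<bullet> (X *v (axis i 1 - axis j 1))" using X by (auto simp: pos_semidef_def)
  then have "2 * \<bar>X $ i $ j\<bar> \<le> X $ i $ i + X $ j $ j"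
    by (simp add: matrix_vector_right_distrib matrix_vector_mult_diff_distrib inner_add_left inner_add_right
        inner_diff_left inner_diff_right q s)
  moreover have "X $ p $ p \<le> trace X" for p unfolding trace_def by (rule member_le_sum) (use dd in auto)
  from this[of i] this[of j] have "X $ i $ i + X $ j $ j \<le> 2 * trace X" by simp
  ultimately show ?thesis by linarith
qed

text \<open>All entries of a positive definite matrix are bounded by its trace. For large \<open>d\<close> the kernel is therefore
  dominated by a product of integrable functions of the entries.\<close>

lemma iw_mass_finite_large:
  assumes d: "d \<ge> 4 * real (card (sym_entries :: 'n::finite set set))"
  shows "iw_mass d (mat 1 :: real^'n^'n) < \<infinity>"
proof -
  let ?E = "sym_entries :: 'n set set"
  have cE: "card ?E > 0" by (auto simp: card_gt_0_iff sym_entries_def)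
  then have d0: "d > 0" using d by simp
  define C where "C = (d powr (d/2) * exp (1/2)) ^ CARD('n)"
  have C: "C \<ge> 0" by (simp add: C_def)
  have le: "ennreal (iw_kernel d (mat 1) (sym_of_entries s :: real^'n^'n)) \<le>
     ennreal C * (\<Prod>e\<in>?E. ennreal ((1 + (s e)\<^sup>2) powr (- 1)))" for s
  proof (cases "pos_def (sym_of_entries s :: real^'n^'n)")
    case True
    let ?X = "sym_of_entries s :: real^'n^'n"
    note b = iw_kernel_le_trace[OF d0 True]
    have s: "\<bar>s e\<bar> \<le> trace ?X" if "e \<in> ?E" for e
      using that pos_semidef_entry_le_trace[OF pos_def_imp_semidef[OF True]]
      by (auto simp: sym_entries_def sym_of_entries_def)
    have "(1 + trace ?X) powr (- d/2) \<le> (1 + trace ?X) powr (- (2 * real (card ?E)))"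
      using d b(2) by (intro powr_mono) auto
    also have "\<dots> = ((1 + trace ?X) powr (- 2)) powr (card ?E)"
      by (simp only: powr_powr) simp
    also have "\<dots> = (\<Prod>e\<in>?E. (1 + trace ?X) powr (- 2))"
      using b(2) by (subst powr_realpow) auto
    also have "\<dots> \<le> (\<Prod>e\<in>?E. (1 + (s e)\<^sup>2) powr (- 1))"
    proof (intro prod_mono conjI)
      fix e assume e: "e \<in> ?E"
      have "1 + (s e)\<^sup>2 \<le> (1 + trace ?X)\<^sup>2"
      proof -
        have "(s e)\<^sup>2 \<le> (trace ?X)\<^sup>2" using s[OF e] b(2) by (simp flip: abs_le_square_iff)
        then show ?thesis using b(2) by (simp add: power2_eq_square algebra_simps)
      qed
      then have "inverse ((1 + trace ?X)\<^sup>2) \<le> inverse (1 + (s e)\<^sup>2)"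
        by (intro le_imp_inverse_le) (auto simp: add_pos_nonneg)
      then show "(1 + trace ?X) powr (- 2) \<le> (1 + (s e)\<^sup>2) powr (- 1)"
        using b(2) by (simp add: powr_minus add_pos_nonneg)
    qed simp
    finally have "iw_kernel d (mat 1) ?X \<le> C * (\<Prod>e\<in>?E. (1 + (s e)\<^sup>2) powr (- 1))"
      using b(1) C unfolding C_def by (meson mult_left_mono order_trans)
    then have "ennreal (iw_kernel d (mat 1) ?X) \<le> ennreal (C * (\<Prod>e\<in>?E. (1 + (s e)\<^sup>2) powr (- 1)))" by (rule ennreal_leI)
    also have "\<dots> = ennreal C * (\<Prod>e\<in>?E. ennreal ((1 + (s e)\<^sup>2) powr (- 1)))"
      using C by (subst ennreal_mult) (auto intro: prod_nonneg simp: prod_ennreal)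
    finally show ?thesis .
  qed (simp add: iw_kernel_def)
  have "iw_mass d (mat 1 :: real^'n^'n) = (\<integral>\<^sup>+s. ennreal (iw_kernel d (mat 1) (sym_of_entries s :: real^'n^'n)) \<partial>entries_measure)"
    by (rule nn_integral_lebesgue_sym) measurable
  also have "\<dots> \<le> (\<integral>\<^sup>+s. ennreal C * (\<Prod>e\<in>?E. ennreal ((1 + (s e)\<^sup>2) powr (- 1))) \<partial>entries_measure)"
    by (intro nn_integral_mono le)
  also have "\<dots> = ennreal C * (\<integral>\<^sup>+s. (\<Prod>e\<in>?E. ennreal ((1 + (s e)\<^sup>2) powr (- 1))) \<partial>entries_measure)"
    by (rule nn_integral_cmult) measurable
  also have "(\<integral>\<^sup>+s. (\<Prod>e\<in>?E. ennreal ((1 + (s e)\<^sup>2) powr (- 1))) \<partial>entries_measure) =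
    (\<Prod>e\<in>?E. \<integral>\<^sup>+x. ennreal ((1 + x\<^sup>2) powr (- 1)) \<partial>lborel)"
    by (rule entries.product_nn_integral_prod) auto
  also have "ennreal C * \<dots> < \<infinity>"
    using nn_integral_inverse_power_finite[of 1] by (simp add: ennreal_mult_less_top power_less_top_ennreal)
  finally show ?thesis .
qed

lemma nn_integral_gaussian_quadratic:
  fixes X :: "real^'n^'n"
  assumes X: "pos_def X"
  shows "(\<integral>\<^sup>+m. ennreal (exp (- (1/2) * (m \<bullet> (matrix_inv X *v m)))) \<partial>lborel) =
    ennreal (sqrt ((2 * pi) ^ CARD('n)) * det X powr (1/2))"
proof -
  obtain B where B: "transpose B = B" "B ** B = X" "invertible B" using pos_def_sqrt[OF X] by blast
  have Rt: "transpose (matrix_inv B) = matrix_inv B" using B(1,3) by (metis matrix_inv_transpose)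
  have q: "(B *v y) \<bullet> (matrix_inv X *v (B *v y)) = y \<bullet> y" for y
  proof -
    have "matrix_inv X *v (B *v y) = matrix_inv B *v y"
      unfolding B(2)[symmetric] matrix_inv_mul[OF B(3) B(3)] matrix_vector_mul_assoc matrix_mul_assoc[symmetric]
      by (simp add: matrix_inv_left B(3))
    then show ?thesis
      by (simp add: inner_mult_transpose[of "B *v y"] Rt matrix_vector_mul_assoc matrix_inv_left B(3))
  qed
  have "det B \<noteq> 0" using B(3) invertible_det_nz by blast
  then have dB: "\<bar>det B\<bar> = det X powr (1/2)"
    by (simp add: B(2)[symmetric] det_mul powr_half_sqrt real_sqrt_mult)
  have "(\<integral>\<^sup>+m. ennreal (exp (- (1/2) * (m \<bullet> (matrix_inv X *v m)))) \<partial>lborel) =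
     ennreal \<bar>det B\<bar> * (\<integral>\<^sup>+y. ennreal (exp (- (1/2) * ((B *v y) \<bullet> (matrix_inv X *v (B *v y))))) \<partial>lborel)"
    by (rule has_jacobianD[OF has_jacobian_lborel_matrix[OF B(3)]]) measurable
  also have "(\<integral>\<^sup>+y. ennreal (exp (- (1/2) * ((B *v y) \<bullet> (matrix_inv X *v (B *v y))))) \<partial>lborel) =
     (\<integral>\<^sup>+y. ennreal (sqrt ((2 * pi) ^ CARD('n))) * ennreal (std_gauss (y :: real^'n)) \<partial>lborel)"
    unfolding q by (intro nn_integral_cong) (simp add: ennreal_mult''[symmetric] std_gauss_def dot_square_norm)
  also have "\<dots> = ennreal (sqrt ((2 * pi) ^ CARD('n)))"
    by (subst nn_integral_cmult) (auto simp: nn_integral_std_gauss)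
  finally show ?thesis by (simp add: dB ennreal_mult'[symmetric] mult.commute)
qed

text \<open>Integrating \<open>exp (- \<mu> \<bullet> \<Sigma>\<^sup>-\<^sup>1 \<mu> / 2)\<close> over \<open>\<mu>\<close> first gives a power of \<open>det \<Sigma>\<close>; integrating over \<open>\<Sigma>\<close> first gives a
  power of \<open>det (1 + \<mu> \<mu>\<^sup>T) = 1 + (norm \<mu>)\<^sup>2\<close>. Comparing the two orders relates the masses for \<open>d\<close> and
  \<open>d + 1\<close> by an explicit integral.\<close>

lemma iw_mass_step:
  "iw_mass d (mat 1 :: real^'n^'n) * ennreal (sqrt ((2 * pi) ^ CARD('n))) =
   iw_mass (d + 1) (mat 1 :: real^'n^'n) *
     (\<integral>\<^sup>+m. ennreal ((1 + (norm (m :: real^'n))\<^sup>2) powr (- (d - real CARD('n)) / 2)) \<partial>lborel)"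
proof -
  interpret S: sigma_finite_measure "lebesgue_sym :: (real^'n^'n) measure" by (rule sigma_finite_lebesgue_sym)
  interpret pair_sigma_finite "lebesgue_sym :: (real^'n^'n) measure" "lborel :: (real^'n) measure" ..
  let ?S = "\<lambda>m :: real^'n. mat 1 + outer m m"
  have pd: "pos_def (?S m)" for m using pos_def_add_outer[OF pos_def_mat_1, of 1 m] by simp
  have "iw_mass d (mat 1 :: real^'n^'n) * ennreal (sqrt ((2 * pi) ^ CARD('n))) =
    (\<integral>\<^sup>+X. ennreal (iw_kernel d (mat 1 :: real^'n^'n) X) * ennreal (sqrt ((2 * pi) ^ CARD('n))) \<partial>lebesgue_sym)"
    by (rule nn_integral_multc[symmetric]) measurable
  also have "\<dots> = (\<integral>\<^sup>+X. \<integral>\<^sup>+m. ennreal (iw_kernel (d + 1) (?S m) X) \<partial>lborel \<partial>lebesgue_sym)"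
  proof (rule nn_integral_cong)
    fix X :: "real^'n^'n"
    show "ennreal (iw_kernel d (mat 1) X) * ennreal (sqrt ((2 * pi) ^ CARD('n))) = (\<integral>\<^sup>+m. ennreal (iw_kernel (d + 1) (?S m) X) \<partial>lborel)"
    proof (cases "pos_def X")
      case True
      have dX: "det X > 0" using det_pos_def[OF True] .
      have pw: "det X powr (- (d + 1) / 2) * det X powr (1/2) = det X powr (- d/2)"
        by (simp only: powr_add[symmetric]) (simp add: field_simps)
      have k: "iw_kernel (d + 1) (?S m) X = (det X powr (- (d + 1)/2) * exp (- (1/2) * trace (matrix_inv X))) *
          exp (- (1/2) * (m \<bullet> (matrix_inv X *v m)))" for m
        using True by (simp add: iw_kernel_def matrix_add_rdistrib trace_add trace_outer_mul exp_add[symmetric]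
            add_divide_distrib diff_divide_distrib mult.assoc)
      have "(\<integral>\<^sup>+m. ennreal (iw_kernel (d + 1) (?S m) X) \<partial>lborel) =
         (\<integral>\<^sup>+m. ennreal (det X powr (- (d + 1)/2) * exp (- (1/2) * trace (matrix_inv X))) *
           ennreal (exp (- (1/2) * (m \<bullet> (matrix_inv X *v m)))) \<partial>lborel)"
        unfolding k by (simp add: ennreal_mult'')
      also have "\<dots> = ennreal (det X powr (- (d + 1)/2) * exp (- (1/2) * trace (matrix_inv X))) *
          ennreal (sqrt ((2 * pi) ^ CARD('n)) * det X powr (1/2))"
        by (subst nn_integral_cmult, measurable) (simp only: nn_integral_gaussian_quadratic[OF True])
      also have "\<dots> = ennreal ((det X powr (- (d + 1) / 2) * det X powr (1/2)) * exp (- (1/2) * trace (matrix_inv X)) * sqrt ((2 * pi) ^ CARD('n)))"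
        by (simp add: ennreal_mult''[symmetric] mult_ac)
      also have "\<dots> = ennreal (iw_kernel d (mat 1) X) * ennreal (sqrt ((2 * pi) ^ CARD('n)))"
        unfolding pw using True by (simp add: iw_kernel_def ennreal_mult''[symmetric])
      finally show ?thesis ..
    qed (simp add: iw_kernel_def)
  qed
  also have "\<dots> = (\<integral>\<^sup>+m. iw_mass (d + 1) (?S m) \<partial>lborel)"
    by (rule Fubini'[symmetric]) measurable
  also have "\<dots> = (\<integral>\<^sup>+m. iw_mass (d + 1) (mat 1 :: real^'n^'n) * ennreal ((1 + (norm (m :: real^'n))\<^sup>2) powr (- (d - real CARD('n)) / 2)) \<partial>lborel)"
    by (intro nn_integral_cong)
       (subst iw_mass_scale[OF pd], simp add: det_mat_1_plus_outer dot_square_norm mult.commute)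
  also have "\<dots> = iw_mass (d + 1) (mat 1 :: real^'n^'n) * (\<integral>\<^sup>+m. ennreal ((1 + (norm (m :: real^'n))\<^sup>2) powr (- (d - real CARD('n)) / 2)) \<partial>lborel)"
    by (rule nn_integral_cmult) measurable
  finally show ?thesis .
qed

text \<open>Descending from large \<open>d\<close> in unit steps; the integral in each step converges for \<open>d > 2 k\<close>.\<close>

theorem iw_mass_finite:
  assumes "d > 2 * real CARD('n)"
  shows "iw_mass d (mat 1 :: real^'n^'n) < \<infinity>"
proof -
  have "iw_mass d (mat 1 :: real^'n^'n) < \<infinity>"
    if "d > 2 * real CARD('n)" "d + real N \<ge> 4 * real (card (sym_entries :: 'n set set))" for d N
    using that
  proof (induction N arbitrary: d)
    case 0
    then show ?case using iw_mass_finite_large[of d, where 'n = 'n] by simp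
  next
    case (Suc N)
    have "iw_mass (d + 1) (mat 1 :: real^'n^'n) < \<infinity>" using Suc by simp
    moreover have "(\<integral>\<^sup>+m. ennreal ((1 + (norm (m :: real^'n))\<^sup>2) powr (- (d - real CARD('n)) / 2)) \<partial>lborel) < \<infinity>"
      using Suc.prems(1) by (intro nn_integral_student_kernel_finite) simp
    ultimately have "iw_mass d (mat 1 :: real^'n^'n) * ennreal (sqrt ((2 * pi) ^ CARD('n))) < \<infinity>"
      unfolding iw_mass_step by (simp add: ennreal_mult_less_top)
    then show ?case by (auto simp: ennreal_mult_less_top)
  qed
  moreover obtain N where "4 * real (card (sym_entries :: 'n set set)) - d \<le> real N" using real_arch_simple by blast
  ultimately show ?thesis using assms by (metis diff_le_eq add.commute)
qed

text \<open>Every symmetric matrix becomes positive definite after adding a multiple of the identity. So countably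
  many translates of the positive definite cone cover all symmetric matrices, and the cone cannot be a
  null set.\<close>

lemma emeasure_pos_def_nonzero: "emeasure lebesgue_sym {X :: real^'n^'n. pos_def X} \<noteq> 0"
proof
  assume 0: "emeasure lebesgue_sym {X :: real^'n^'n. pos_def X} = 0"
  have m: "{X :: real^'n^'n. pos_def X} \<in> sets borel" by measurable
  have tr: "AE X in lebesgue_sym. \<not> pos_def (real n *\<^sub>R mat 1 + X :: real^'n^'n)" for n
  proof -
    have mn: "{X :: real^'n^'n. pos_def (real n *\<^sub>R mat 1 + X)} \<in> sets borel" by measurable
    have "real n *\<^sub>R mat 1 \<in> {X :: real^'n^'n. transpose X = X}" by (simp add: transpose_scaleR)
    from translation_invariant_nn_integral[OF translation_invariant_lebesgue_sym this, of "indicator {X. pos_def X}"]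
    have "(\<integral>\<^sup>+X. indicator {X :: real^'n^'n. pos_def X} (real n *\<^sub>R mat 1 + X) \<partial>lebesgue_sym) = emeasure lebesgue_sym {X :: real^'n^'n. pos_def X}"
      using m by simp
    also have "(\<lambda>X :: real^'n^'n. indicator {X. pos_def X} (real n *\<^sub>R mat 1 + X) :: ennreal) = indicator {X. pos_def (real n *\<^sub>R mat 1 + X)}"
      by (auto simp: indicator_def)
    finally have "emeasure lebesgue_sym {X :: real^'n^'n. pos_def (real n *\<^sub>R mat 1 + X)} = 0" using 0 mn by simp
    then show ?thesis using mn by (subst AE_iff_measurable[OF _ refl]) auto
  qed
  have "AE X in lebesgue_sym. \<forall>n. \<not> pos_def (real n *\<^sub>R mat 1 + X :: real^'n^'n)" using tr by (simp add: AE_all_countable)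
  then have "AE X in lebesgue_sym :: (real^'n^'n) measure. False"
    using AE_lebesgue_sym_symmetric
  proof eventually_elim
    case (elim X)
    obtain K where K: "K > 0" "\<And>v. norm (X *v v) \<le> norm v * K"
      using bounded_linear.pos_bounded[OF matrix_vector_mul_bounded_linear[of X]] by blast
    obtain n where n: "K < real n" using reals_Archimedean2 by blast
    have "pos_def (real n *\<^sub>R mat 1 + X)"
      unfolding pos_def_def
    proof safe
      show "transpose (real n *\<^sub>R mat 1 + X) = real n *\<^sub>R mat 1 + X" using elim(2) by (simp add: transpose_add transpose_scaleR)
      fix v :: "real^'n" assume "v \<noteq> 0"
      have "\<bar>v \<bullet> (X *v v)\<bar> \<le> norm v * norm (X *v v)" by (rule Cauchy_Schwarz_ineq2)
      also have "\<dots> \<le> norm v * (norm v * K)" by (intro mult_left_mono K) simp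
      also have "\<dots> < norm v * (norm v * real n)" using n \<open>v \<noteq> 0\<close> by simp
      finally have "- (v \<bullet> (X *v v)) < real n * (v \<bullet> v)" by (simp add: dot_square_norm power2_eq_square mult_ac)
      then show "0 < v \<bullet> ((real n *\<^sub>R mat 1 + X) *v v)"
        by (simp add: matrix_vector_mult_add_rdistrib scaleR_matrix_vector_assoc[symmetric] inner_add_right)
    qed
    then show False using elim(1) by blast
  qed
  then have "emeasure (lebesgue_sym :: (real^'n^'n) measure) UNIV = 0"
    by (subst (asm) AE_iff_measurable[of UNIV]) auto
  then have "emeasure lebesgue_sym {X :: real^'n^'n. \<forall>i j. 0 \<le> X $ i $ j \<and> X $ i $ j \<le> 1} = 0"
    by (rule emeasure_eq_0[rotated]) auto
  moreover have "emeasure lebesgue_sym {X :: real^'n^'n. \<forall>i j. 0 \<le> X $ i $ j \<and> X $ i $ j \<le> 1} = 1"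
    using emeasure_lebesgue_sym_box[of "\<lambda>_::'n set. 0" "\<lambda>_. 1"] by simp
  ultimately show False by simp
qed

lemma iw_mass_nonzero: "iw_mass d (mat 1 :: real^'n^'n) \<noteq> 0"
proof
  assume "iw_mass d (mat 1 :: real^'n^'n) = 0"
  then have "AE X in lebesgue_sym. ennreal (iw_kernel d (mat 1) (X :: real^'n^'n)) = 0"
    by (subst (asm) nn_integral_0_iff_AE) auto
  then have "AE X in lebesgue_sym. \<not> pos_def (X :: real^'n^'n)"
  proof eventually_elim
    case (elim X)
    show ?case
    proof
      assume p: "pos_def X"
      then have "iw_kernel d (mat 1) X > 0" using det_pos_def[OF p] by (simp add: iw_kernel_def)
      then show False using elim by simp
    qed
  qed
  moreover have "{X :: real^'n^'n. pos_def X} \<in> sets borel" by measurable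
  ultimately have "emeasure lebesgue_sym {X :: real^'n^'n. pos_def X} = 0"
    by (subst (asm) AE_iff_measurable[OF _ refl]) auto
  then show False using emeasure_pos_def_nonzero by blast
qed

section \<open>Linear images of Gaussian vectors\<close>

text \<open>\<open>T\<close> is \<open>x - 2 P x\<close> with \<open>P\<close> the orthogonal projection onto \<open>W\<close>.\<close>

lemma orthogonal_reflection_exists:
  fixes W :: "'a::euclidean_space set"
  assumes W: "subspace W"
  obtains T where "orthogonal_transformation T" "\<And>w. w \<in> W \<Longrightarrow> T w = - w"
    "\<And>x. (\<And>w. w \<in> W \<Longrightarrow> x \<bullet> w = 0) \<Longrightarrow> T x = x"
proof -
  obtain B where B: "B \<subseteq> W" "pairwise orthogonal B" "\<And>x. x \<in> B \<Longrightarrow> norm x = 1" "independent B" "span B = W"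
    using orthonormal_basis_subspace[OF W] by metis
  have fin: "finite B" using B(4) by (rule independent_imp_finite)
  define P where "P x = (\<Sum>b\<in>B. (x \<bullet> b) *\<^sub>R b)" for x
  have lin: "linear P" unfolding P_def[abs_def]
    by (rule linearI) (simp_all add: inner_add_left scaleR_add_left sum.distrib scaleR_sum_right)
  have PW: "P x \<in> W" for x unfolding P_def using B(1) W by (intro subspace_sum subspace_scale) auto
  have Pb: "P x \<bullet> b = x \<bullet> b" if b: "b \<in> B" for x b
  proof -
    have "P x \<bullet> b = (\<Sum>c\<in>B. (x \<bullet> c) * (c \<bullet> b))" by (simp add: P_def inner_sum_left)
    also have "\<dots> = (\<Sum>c\<in>B. if c = b then x \<bullet> b else 0)"
    proof (rule sum.cong[OF refl])
      fix c assume c: "c \<in> B"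
      show "(x \<bullet> c) * (c \<bullet> b) = (if c = b then x \<bullet> b else 0)"
        using B(2) B(3)[OF b] b c by (auto simp: pairwise_def orthogonal_def norm_eq_1)
    qed
    also have "\<dots> = x \<bullet> b" using fin b by simp
    finally show ?thesis .
  qed
  have perp: "(x - P x) \<bullet> w = 0" if w: "w \<in> W" for x w
  proof -
    have "orthogonal (x - P x) w"
      by (rule orthogonal_to_span[of w B]) (use w B(5) Pb in \<open>auto simp: orthogonal_def inner_diff_left\<close>)
    then show ?thesis by (simp add: orthogonal_def)
  qed
  have PwW: "P w = w" if "w \<in> W" for w
  proof -
    have "w - P w \<in> W" using W that PW by (simp add: subspace_diff)
    then have "(w - P w) \<bullet> (w - P w) = 0" by (rule perp)
    then show ?thesis by simp
  qed
  define T where "T x = x - 2 *\<^sub>R P x" for x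
  have "T x = x" if "\<And>w. w \<in> W \<Longrightarrow> x \<bullet> w = 0" for x
    using that B(1) by (simp add: T_def P_def subset_eq)
  moreover have "T w = - w" if "w \<in> W" for w
    using PwW[OF that] by (simp add: T_def scaleR_2)
  moreover have "orthogonal_transformation T"
  proof -
    have "linear T" unfolding T_def[abs_def]
      using lin by (intro linearI) (simp_all add: linear_add linear_scale algebra_simps)
    moreover have "norm (T x) = norm x" for x
    proof -
      have p: "P x \<bullet> x = P x \<bullet> P x" using perp[OF PW, of x x] by (simp add: inner_diff_left inner_commute[of "P x" x])
      have "T x \<bullet> T x = x \<bullet> x - 4 * (P x \<bullet> x) + 4 * (P x \<bullet> P x)"
        by (simp add: T_def inner_diff_left inner_diff_right inner_commute[of x "P x"])
      then show ?thesis by (simp add: p norm_eq_sqrt_inner)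
    qed
    ultimately show ?thesis by (simp add: orthogonal_transformation)
  qed
  ultimately show thesis using that by blast
qed

lemma std_gauss_Pair: "std_gauss (y, z) = std_gauss y * std_gauss z"
  by (simp add: std_gauss_def norm_Pair power_add real_sqrt_mult exp_add[symmetric] add_divide_distrib)

text \<open>The law of a linear image of a standard normal vector is determined by its covariance matrix, even
  if the two vectors live in spaces of different dimensions. On the product of the two spaces, the
  reflection along the vectors \<open>(B\<^sup>T v, - C\<^sup>T v)\<close> preserves the standard normal density. Since
  \<open>B B\<^sup>T = C C\<^sup>T\<close>, it fixes the vectors \<open>(B\<^sup>T v, C\<^sup>T v)\<close>, and hence it exchanges \<open>(B\<^sup>T v, 0)\<close> and \<open>(0, C\<^sup>T v)\<close>.
  Taking adjoints, it carries one linear map into the other.\<close>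

theorem nn_integral_gauss_linear_image:
  fixes B :: "real^'k^'p" and C :: "real^'m^'p" and g :: "real^'p \<Rightarrow> ennreal"
  assumes eq: "B ** transpose B = C ** transpose C" and g [measurable]: "g \<in> borel_measurable borel"
  shows "(\<integral>\<^sup>+y. ennreal (std_gauss y) * g (B *v y) \<partial>lborel) = (\<integral>\<^sup>+z. ennreal (std_gauss z) * g (C *v z) \<partial>lborel)"
proof -
  let ?E = "lborel :: ((real^'k) \<times> (real^'m)) measure"
  define W where "W = range (\<lambda>v. (transpose B *v v, - (transpose C *v v)))"
  have W: "subspace W"
    unfolding W_def
    by (rule linear_subspace_image[OF _ subspace_UNIV], rule linearI)
       (simp_all add: matrix_vector_right_distrib matrix_vector_mult_scaleR)
  obtain T where T: "orthogonal_transformation T" "\<And>w. w \<in> W \<Longrightarrow> T w = - w"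
    "\<And>x. (\<And>w. w \<in> W \<Longrightarrow> x \<bullet> w = 0) \<Longrightarrow> T x = x"
    using orthogonal_reflection_exists[OF W] by blast
  have lT: "linear T" using T(1) by (rule orthogonal_transformation_linear)
  then have [measurable]: "T \<in> borel_measurable borel"
    by (intro borel_measurable_continuous_onI linear_continuous_on) (simp add: linear_conv_bounded_linear)
  have ip: "(transpose B *v v) \<bullet> (transpose B *v w) = (transpose C *v v) \<bullet> (transpose C *v w)" for v w
  proof -
    have "(transpose B *v v) \<bullet> (transpose B *v w) = v \<bullet> (B *v (transpose B *v w))"
      by (simp add: inner_mult_transpose[of v])
    also have "\<dots> = v \<bullet> (C *v (transpose C *v w))" by (simp only: matrix_vector_mul_assoc eq)
    also have "\<dots> = (transpose C *v v) \<bullet> (transpose C *v w)" by (simp add: inner_mult_transpose[of v])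
    finally show ?thesis .
  qed
  have swap: "T (transpose B *v v, 0) = (0, transpose C *v v)" for v
  proof -
    let ?p = "(transpose B *v v, transpose C *v v)" and ?q = "(transpose B *v v, - (transpose C *v v))"
    have "T ?q = - ?q" by (rule T(2)) (auto simp: W_def)
    moreover have "T ?p = ?p" by (rule T(3)) (auto simp: W_def ip)
    moreover have "(transpose B *v v, 0) = (1/2) *\<^sub>R (?p + ?q)" by (simp add: scaleR_2[symmetric])
    ultimately have "T (transpose B *v v, 0) = (1/2) *\<^sub>R (?p + - ?q)"
      by (simp only: linear_scale[OF lT] linear_add[OF lT])
    then show ?thesis by (simp add: scaleR_2[symmetric])
  qed
  have CB: "C *v snd (T x) = B *v fst x" for x
  proof -
    have "v \<bullet> (C *v snd (T x)) = v \<bullet> (B *v fst x)" for v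
    proof -
      have "v \<bullet> (C *v snd (T x)) = (0, transpose C *v v) \<bullet> T x"
        by (simp add: inner_mult_transpose[of v] inner_prod_def)
      also have "\<dots> = T (transpose B *v v, 0) \<bullet> T x" by (simp add: swap)
      also have "\<dots> = (transpose B *v v, 0) \<bullet> x" using T(1) unfolding orthogonal_transformation_def by blast
      also have "\<dots> = v \<bullet> (B *v fst x)" by (simp add: inner_mult_transpose[of v] inner_prod_def)
      finally show ?thesis .
    qed
    then show ?thesis by (metis vector_eq_rdot inner_commute)
  qed
  have sT: "std_gauss (T x) = std_gauss x" for x
    by (simp add: std_gauss_def orthogonal_transformation_norm[OF T(1)])
  have prod: "(\<integral>\<^sup>+x. ennreal (std_gauss x) * h x \<partial>?E) =
     (\<integral>\<^sup>+y. \<integral>\<^sup>+z. ennreal (std_gauss y) * ennreal (std_gauss z) * h (y, z) \<partial>lborel \<partial>lborel)"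
    if [measurable]: "h \<in> borel_measurable borel" for h
  proof -
    have "(\<lambda>x. ennreal (std_gauss x) * h x) \<in> borel_measurable ?E" by measurable
    from lborel.nn_integral_fst[OF this[unfolded lborel_prod[symmetric]]]
    show ?thesis by (simp add: lborel_prod std_gauss_Pair ennreal_mult std_gauss_pos less_imp_le)
  qed
  have "(snd :: (real^'k) \<times> (real^'m) \<Rightarrow> _) \<in> borel_measurable borel" "(fst :: (real^'k) \<times> (real^'m) \<Rightarrow> _) \<in> borel_measurable borel"
    by (intro borel_measurable_continuous_onI continuous_intros)+
  note fs = this
  have "(\<lambda>z. g (C *v z)) \<in> borel_measurable borel" "(\<lambda>y. g (B *v y)) \<in> borel_measurable borel" by measurable
  note gm = measurable_compose[OF fs(1) this(1)] measurable_compose[OF fs(2) this(2)]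
  have "(\<lambda>x :: (real^'k) \<times> (real^'m). ennreal (std_gauss x) * g (C *v snd x)) \<in> borel_measurable borel"
    by (intro borel_measurable_times_ennreal gm measurable_compose[OF borel_measurable_std_gauss measurable_ennreal])
  note gC = this
  have "(\<integral>\<^sup>+x. ennreal (std_gauss x) * g (C *v snd x) \<partial>?E) = ennreal 1 * (\<integral>\<^sup>+x. ennreal (std_gauss (T x)) * g (C *v snd (T x)) \<partial>?E)"
    by (rule has_jacobianD[OF has_jacobian_lborel_orthogonal[OF T(1)] gC])
  also have "\<dots> = (\<integral>\<^sup>+x. ennreal (std_gauss x) * g (B *v fst x) \<partial>?E)" by (simp add: sT CB)
  finally have main: "(\<integral>\<^sup>+x. ennreal (std_gauss x) * g (C *v snd x) \<partial>?E) = (\<integral>\<^sup>+x. ennreal (std_gauss x) * g (B *v fst x) \<partial>?E)" .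
  have "(\<integral>\<^sup>+x. ennreal (std_gauss x) * g (B *v fst x) \<partial>?E) =
     (\<integral>\<^sup>+y. (\<integral>\<^sup>+z. ennreal (std_gauss (z::real^'m)) * (ennreal (std_gauss y) * g (B *v y)) \<partial>lborel) \<partial>lborel)"
    by (subst prod[OF gm(2)]) (simp add: mult_ac)
  also have "\<dots> = (\<integral>\<^sup>+y. ennreal (std_gauss y) * g (B *v y) \<partial>lborel)"
    by (simp add: nn_integral_multc nn_integral_std_gauss)
  finally have 1: "(\<integral>\<^sup>+x. ennreal (std_gauss x) * g (B *v fst x) \<partial>?E) = (\<integral>\<^sup>+y. ennreal (std_gauss y) * g (B *v y) \<partial>lborel)" .
  have "(\<integral>\<^sup>+x. ennreal (std_gauss x) * g (C *v snd x) \<partial>?E) =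
     (\<integral>\<^sup>+y. ennreal (std_gauss (y::real^'k)) * (\<integral>\<^sup>+z. (ennreal (std_gauss z) * g (C *v z)) \<partial>lborel) \<partial>lborel)"
    by (subst prod[OF gm(1)]) (simp add: mult.assoc nn_integral_cmult)
  also have "\<dots> = (\<integral>\<^sup>+z. ennreal (std_gauss z) * g (C *v z) \<partial>lborel)"
    by (simp add: nn_integral_multc nn_integral_std_gauss)
  finally have 2: "(\<integral>\<^sup>+x. ennreal (std_gauss x) * g (C *v snd x) \<partial>?E) = (\<integral>\<^sup>+z. ennreal (std_gauss z) * g (C *v z) \<partial>lborel)" .
  show ?thesis using main 1 2 by simp
qed

section \<open>Polar coordinates\<close>

lemma sets_uniform_sphere [measurable_cong, simp]: "sets uniform_sphere = sets borel"
  by (simp add: uniform_sphere_def)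

lemma emeasure_unit_ball: "emeasure lborel (ball (0::'a::euclidean_space) 1) \<noteq> 0" "emeasure lborel (ball (0::'a) 1) \<noteq> \<infinity>"
  using content_ball_pos[of 1 "0::'a"] emeasure_lborel_ball_finite[of "0::'a" 1] by (auto simp: measure_def)

lemma prob_space_uniform_sphere: "prob_space (uniform_sphere :: (real^'n) measure)"
  unfolding uniform_sphere_def
  by (intro prob_space.prob_space_distr prob_space_uniform_measure emeasure_unit_ball) auto

lemma nn_integral_uniform_sphere:
  fixes h :: "real^'n \<Rightarrow> ennreal"
  assumes [measurable]: "h \<in> borel_measurable borel"
  shows "emeasure lborel (ball (0::real^'n) 1) * (\<integral>\<^sup>+u. h u \<partial>uniform_sphere) =
    (\<integral>\<^sup>+y. h (sgn y) * indicator (ball 0 1) y \<partial>lborel)"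
proof -
  have b: "ball (0::real^'n) 1 \<in> sets lborel" by simp
  have "(\<integral>\<^sup>+u. h u \<partial>uniform_sphere) = (\<integral>\<^sup>+y. h (sgn y) \<partial>uniform_measure lborel (ball 0 1))"
    unfolding uniform_sphere_def by (rule nn_integral_distr) measurable
  also have "\<dots> = (\<integral>\<^sup>+y. h (sgn y) * indicator (ball 0 1) y \<partial>lborel) / emeasure lborel (ball (0::real^'n) 1)"
    using b by (intro nn_integral_uniform_measure) measurable
  finally show ?thesis
    using ennreal_mult_divide_eq[OF emeasure_unit_ball(1)[where 'a = "real^'n"] emeasure_unit_ball(2)[where 'a = "real^'n", unfolded infinity_ennreal_def]]
    by (simp only: ennreal_times_divide mult.commute[of "emeasure lborel _"])
qed

lemma nn_integral_pareto:
  fixes a :: real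
  assumes a: "a > 0"
  shows "(\<integral>\<^sup>+t. ennreal (if t > 1 then a * t powr (- a - 1) else 0) \<partial>lborel) = 1"
proof -
  have "(\<integral>\<^sup>+t. ennreal (if t > 1 then a * t powr (- a - 1) else 0) \<partial>lborel) =
    (\<integral>\<^sup>+t. ennreal (a * t powr (- a - 1)) * indicator {1..} t \<partial>lborel)"
    by (rule nn_integral_cong_AE, rule eventually_mono[OF AE_lborel_singleton[of 1]]) (auto simp: indicator_def)
  also have "\<dots> = ennreal (0 - (- (1 powr (- a))))"
  proof (rule nn_integral_FTC_atLeast)
    show "((\<lambda>t. - (t powr (- a))) has_real_derivative a * x powr (- a - 1)) (at x)" if "1 \<le> x" for x
      using that by (auto intro!: derivative_eq_intros)
    have "((\<lambda>t :: real. t powr (- a)) \<longlongrightarrow> 0) at_top"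
      using a by (intro tendsto_neg_powr filterlim_ident) auto
    then show "((\<lambda>t :: real. - (t powr (- a))) \<longlongrightarrow> 0) at_top" using tendsto_minus by fastforce
  qed (use a in auto)
  finally show ?thesis by simp
qed

text \<open>Dilations act on the space as stretching did on \<open>\<eta>\<close> above. For \<open>y \<noteq> 0\<close> a density of mass one in the dilation
  parameter \<open>t\<close> is inserted and \<open>y\<close> is replaced by \<open>\<surd>t y\<close>. The inserted density is chosen such that what
  remains is the uniform distribution on the unit ball, whose radial projection is the uniform
  distribution on the sphere. The squared radius keeps all substitutions linear.\<close>

theorem nn_integral_polar_squared:
  fixes F :: "real^'n \<Rightarrow> ennreal"
  assumes [measurable]: "F \<in> borel_measurable borel"
  shows "(\<integral>\<^sup>+y. F y \<partial>lborel) = ennreal (real CARD('n) / 2) * emeasure lborel (ball (0::real^'n) 1) *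
    (\<integral>\<^sup>+u. (\<integral>\<^sup>+q. F (sqrt q *\<^sub>R u) * ennreal (if q > 0 then q powr (real CARD('n)/2 - 1) else 0) \<partial>lborel) \<partial>uniform_sphere)"
proof -
  define a where "a = real CARD('n) / 2"
  have a: "a > 0" by (simp add: a_def)
  (* A Pareto density: psi (1 / c) is a * c powr (a + 1) on the unit ball and 0 outside. *)
  define \<psi> where "\<psi> t = (if t > 1 then a * t powr (- a - 1) else 0)" for t :: real
  have [measurable]: "\<psi> \<in> borel_measurable borel" unfolding \<psi>_def[abs_def] by measurable
  define w where "w y t = ennreal (\<psi> (t / (norm y)\<^sup>2) / (norm y)\<^sup>2)" for y :: "real^'n" and t
  have [measurable]: "(\<lambda>x. w (p x) (q x)) \<in> borel_measurable M"
    if [measurable]: "p \<in> borel_measurable M" "q \<in> borel_measurable M" for p q and M :: "'z measure"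
    unfolding w_def by measurable
  let ?G = "\<lambda>y t. ennreal (t powr a) * (F (sqrt t *\<^sub>R y) * w (sqrt t *\<^sub>R y) t) * indicator {0<..} t"
  let ?I = "\<lambda>u q. F (sqrt q *\<^sub>R u) * ennreal (if q > 0 then q powr (a - 1) else 0)"
  have w_mass: "(\<integral>\<^sup>+t. w y t \<partial>lborel) = 1" if y: "y \<noteq> 0" for y
  proof -
    let ?c = "1 / (norm y)\<^sup>2"
    have c: "?c > 0" using y by simp
    have m: "(\<lambda>t. ennreal (\<psi> t)) \<in> borel_measurable borel" by measurable
    have "(\<integral>\<^sup>+t. w y t \<partial>lborel) = (\<integral>\<^sup>+t. ennreal (\<bar>?c\<bar> ^ DIM(real)) * ennreal (\<psi> (0 + ?c *\<^sub>R t)) \<partial>lborel)"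
      unfolding w_def using c by (intro nn_integral_cong) (simp add: ennreal_mult'[symmetric])
    also have "\<dots> = (\<integral>\<^sup>+t. ennreal (\<psi> t) \<partial>lborel)"
      by (rule nn_integral_lborel_affine_subst[OF m]) (use c in simp)
    also have "\<dots> = 1" unfolding \<psi>_def by (rule nn_integral_pareto[OF a])
    finally show ?thesis .
  qed
  have "(\<integral>\<^sup>+y. F y \<partial>lborel) = (\<integral>\<^sup>+y. \<integral>\<^sup>+t. F y * w y t * indicator {0<..} t \<partial>lborel \<partial>lborel)"
  proof (rule nn_integral_cong_AE, rule eventually_mono[OF AE_lborel_singleton[of 0]])
    fix y :: "real^'n" assume y: "y \<noteq> 0"
    have "(\<integral>\<^sup>+t. F y * w y t * indicator {0<..} t \<partial>lborel) = (\<integral>\<^sup>+t. F y * w y t \<partial>lborel)"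
    proof (rule nn_integral_cong)
      fix t :: real
      show "F y * w y t * indicator {0<..} t = F y * w y t"
      proof (cases "t > 0")
        case False
        then have "t / (norm y)\<^sup>2 \<le> 0" by (simp add: divide_nonpos_nonneg)
        then show ?thesis by (simp add: w_def \<psi>_def)
      qed simp
    qed
    then show "F y = (\<integral>\<^sup>+t. F y * w y t * indicator {0<..} t \<partial>lborel)" by (simp add: nn_integral_cmult w_mass[OF y])
  qed
  also have "\<dots> = (\<integral>\<^sup>+t. \<integral>\<^sup>+y. F y * w y t * indicator {0<..} t \<partial>lborel \<partial>lborel)"
    by (rule lborel_pair.Fubini'[symmetric]) measurable
  also have "\<dots> = (\<integral>\<^sup>+t. \<integral>\<^sup>+y. ?G y t \<partial>lborel \<partial>lborel)"
  proof (rule nn_integral_cong)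
    fix t :: real
    show "(\<integral>\<^sup>+y. F y * w y t * indicator {0<..} t \<partial>lborel) =
      (\<integral>\<^sup>+y. ?G y t \<partial>lborel)"
    proof (cases "t > 0")
      case t: True
      have p: "\<bar>sqrt t\<bar> ^ DIM(real^'n) = t powr a"
      proof -
        have "\<bar>sqrt t\<bar> ^ DIM(real^'n) = (t powr (1/2)) powr (real CARD('n))"
          using t by (simp add: powr_half_sqrt powr_realpow)
        then show ?thesis by (simp only: powr_powr a_def) simp
      qed
      have "(\<lambda>y. F y * w y t) \<in> borel_measurable borel" by measurable
      from nn_integral_lborel_affine_subst[OF this, of "sqrt t" 0, unfolded p] t
      show ?thesis by simp
    qed simp
  qed
  also have "\<dots> = (\<integral>\<^sup>+y. \<integral>\<^sup>+t. ?G y t \<partial>lborel \<partial>lborel)"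
    by (rule lborel_pair.Fubini') measurable
  also have "\<dots> = (\<integral>\<^sup>+y. ennreal a * ((\<integral>\<^sup>+q. ?I (sgn y) q \<partial>lborel) * indicator (ball 0 1) y) \<partial>lborel)"
  proof (rule nn_integral_cong_AE, rule eventually_mono[OF AE_lborel_singleton[of 0]])
    fix y :: "real^'n" assume y: "y \<noteq> 0"
    let ?c = "(norm y)\<^sup>2"
    have c: "?c > 0" using y by simp
    let ?f = "\<lambda>q. ?I (sgn y) q"
    have m: "?f \<in> borel_measurable borel" by measurable
    have "?G y t =
       ennreal a * indicator (ball 0 1) y * (ennreal (\<bar>?c\<bar> ^ DIM(real)) * ?f (0 + ?c *\<^sub>R t))" for t
    proof (cases "t > 0")
      case t: True
      have ct: "?c * t > 0" using c t by simp
      have n: "norm (sqrt t *\<^sub>R y) ^ 2 = t * ?c" using t by (simp add: power_mult_distrib)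
      have arg: "sqrt (0 + ?c *\<^sub>R t) *\<^sub>R sgn y = sqrt t *\<^sub>R y"
        using y t by (simp add: real_sqrt_mult sgn_div_norm)
      have q: "t / (t * ?c) = 1 / ?c" using t by simp
      have ball: "y \<in> ball 0 1 \<longleftrightarrow> ?c < 1" by (simp add: power_less_one_iff abs_square_less_1)
      show ?thesis
      proof (cases "y \<in> ball 0 1")
        case True
        then have c1: "?c < 1" using ball by blast
        have "(1 / z) powr (- a - 1) = z powr (a + 1)" if "z > 0" for z :: real
        proof -
          have "1 / z = z powr (- 1)" using that by (simp add: powr_minus_divide)
          then show ?thesis by (simp only: powr_powr) (simp add: add.commute)
        qed
        from this[OF c] c1 c have "\<psi> (1 / ?c) = a * (?c powr (a + 1))" by (simp add: \<psi>_def)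
        then have w: "w (sqrt t *\<^sub>R y) t = ennreal (a * (?c powr (a + 1)) / (t * ?c))" unfolding w_def n q by simp
        have "t powr a * (a * (?c powr (a + 1)) / (t * ?c)) = a * (?c * ((?c * t) powr (a - 1)))"
          using c t by (simp add: powr_mult powr_diff powr_add field_simps)
        then have "ennreal (t powr a) * ennreal (a * (?c powr (a + 1)) / (t * ?c)) = ennreal a * (ennreal ?c * ennreal ((?c * t) powr (a - 1)))"
          using a c t by (simp add: ennreal_mult'[symmetric])
        moreover have "ennreal (\<bar>?c\<bar> ^ DIM(real)) = ennreal ?c" by simp
        moreover have "?f (0 + ?c *\<^sub>R t) = F (sqrt t *\<^sub>R y) * ennreal ((?c * t) powr (a - 1))"
          unfolding arg using ct by simp
        moreover have "indicator {0<..} t = (1 :: ennreal)" "indicator (ball 0 1) y = (1 :: ennreal)" using True t by auto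
        moreover have "u1 * (x * u2) * 1 = (u1 * u2) * x" "u1 * 1 * (u2 * (x * u3)) = (u1 * (u2 * u3)) * x" for u1 u2 u3 x :: ennreal
          by (simp_all only: mult_ac mult_1_left mult_1_right)
        ultimately show ?thesis by (simp only: w)
      next
        case False
        then have "\<not> 1 / ?c > 1" using ball c by (simp add: field_simps)
        then have "\<psi> (1 / ?c) = 0" by (simp only: \<psi>_def if_False)
        then have "w (sqrt t *\<^sub>R y) t = 0" unfolding w_def n q by simp
        then show ?thesis using False by simp
      qed
    next
      case False
      then have "\<not> ?c * t > 0" using c by (simp add: zero_less_mult_iff)
      then show ?thesis using False by simp
    qed
    then have "(\<integral>\<^sup>+t. ?G y t \<partial>lborel) =
       ennreal a * indicator (ball 0 1) y * (\<integral>\<^sup>+t. ennreal (\<bar>?c\<bar> ^ DIM(real)) * ?f (0 + ?c *\<^sub>R t) \<partial>lborel)"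
      by (simp only:) (rule nn_integral_cmult, measurable)
    also have "(\<integral>\<^sup>+t. ennreal (\<bar>?c\<bar> ^ DIM(real)) * ?f (0 + ?c *\<^sub>R t) \<partial>lborel) = (\<integral>\<^sup>+q. ?f q \<partial>lborel)"
      by (rule nn_integral_lborel_affine_subst[OF m]) (use c in simp)
    finally show "(\<integral>\<^sup>+t. ?G y t \<partial>lborel) =
       ennreal a * ((\<integral>\<^sup>+q. ?f q \<partial>lborel) * indicator (ball 0 1) y)" by (simp only: mult_ac)
  qed
  also have "\<dots> = ennreal a * (\<integral>\<^sup>+y. (\<integral>\<^sup>+q. ?I (sgn y) q \<partial>lborel) * indicator (ball 0 1) y \<partial>lborel)"
  proof (rule nn_integral_cmult)
    have [measurable]: "ball (0::real^'n) 1 \<in> sets borel" by simp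
    show "(\<lambda>y::real^'n. (\<integral>\<^sup>+q. ?I (sgn y) q \<partial>lborel) * indicator (ball 0 1) y) \<in> borel_measurable lborel"
      by measurable
  qed
  also have "(\<integral>\<^sup>+y. (\<integral>\<^sup>+q. ?I (sgn y) q \<partial>lborel) * indicator (ball 0 1) y \<partial>lborel) =
     emeasure lborel (ball (0::real^'n) 1) * (\<integral>\<^sup>+u. (\<integral>\<^sup>+q. ?I u q \<partial>lborel) \<partial>uniform_sphere)"
    by (rule nn_integral_uniform_sphere[symmetric]) measurable
  finally show ?thesis by (simp only: a_def mult.assoc)
qed

lemma AE_uniform_sphere_norm: "AE u in uniform_sphere. norm (u :: real^'n) = 1"
proof -
  have "AE y in uniform_measure lborel (ball 0 1). norm (sgn y :: real^'n) = 1"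
  proof (rule AE_uniform_measureI)
    show "ball (0::real^'n) 1 \<in> sets lborel" by simp
    show "AE y in lborel. y \<in> ball 0 1 \<longrightarrow> norm (sgn y :: real^'n) = 1"
      by (rule eventually_mono[OF AE_lborel_singleton[of 0]]) (simp add: norm_sgn)
  qed
  then show ?thesis unfolding uniform_sphere_def by (subst AE_distr_iff) auto
qed

lemma borel_measurable_F_density [measurable]: "F_density a b \<in> borel_measurable borel"
  unfolding F_density_def[abs_def] by measurable

text \<open>The squared norm of a vector with a multivariate Student density is \<open>k / \<nu>\<close> times an \<open>F\<close>-distributed
  variable, and is independent of the direction.\<close>

theorem nn_integral_student_polar:
  fixes \<nu> :: real
  assumes \<nu>: "\<nu> > 0"
  obtains c where "c > 0"
    "\<And>H. H \<in> borel_measurable borel \<Longrightarrow>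
       (\<integral>\<^sup>+y. H y * ennreal ((1 + (norm (y :: real^'n))\<^sup>2) powr (- (real CARD('n) + \<nu>) / 2)) \<partial>lborel) =
       ennreal c * (\<integral>\<^sup>+u. (\<integral>\<^sup>+Q. H (sqrt (real CARD('n) * Q / \<nu>) *\<^sub>R u) * ennreal (F_density (real CARD('n)) \<nu> Q) \<partial>lborel) \<partial>uniform_sphere)"
proof -
  let ?k = "real CARD('n)"
  let ?J = "\<lambda>H u Q. H (sqrt (?k * Q / \<nu>) *\<^sub>R u) * ennreal (F_density ?k \<nu> Q)"
  define \<beta> where "\<beta> = Beta (?k/2) (\<nu>/2)"
  have b: "\<beta> > 0" using \<nu> by (simp add: \<beta>_def Beta_def Gamma_real_pos)
  obtain m where m: "emeasure lborel (ball (0::real^'n) 1) = ennreal m" "m > 0"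
    using emeasure_unit_ball[where 'a = "real^'n"]
    by (metis ennreal_0 infinity_ennreal_def ennreal_cases less_eq_real_def)
  interpret S: prob_space "uniform_sphere :: (real^'n) measure" by (rule prob_space_uniform_sphere)
  have "(\<integral>\<^sup>+y. H y * ennreal ((1 + (norm (y :: real^'n))\<^sup>2) powr (- (?k + \<nu>) / 2)) \<partial>lborel) =
       ennreal (?k / 2 * m * \<beta>) * (\<integral>\<^sup>+u. (\<integral>\<^sup>+Q. ?J H u Q \<partial>lborel) \<partial>uniform_sphere)"
    if [measurable]: "H \<in> borel_measurable borel" for H
  proof -
    have "(\<integral>\<^sup>+y. H y * ennreal ((1 + (norm (y :: real^'n))\<^sup>2) powr (- (?k + \<nu>) / 2)) \<partial>lborel) =
      ennreal (?k / 2) * ennreal m * (\<integral>\<^sup>+u. (\<integral>\<^sup>+q. H (sqrt q *\<^sub>R u) * ennreal ((1 + (norm (sqrt q *\<^sub>R u))\<^sup>2) powr (- (?k + \<nu>) / 2)) *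
         ennreal (if q > 0 then q powr (?k/2 - 1) else 0) \<partial>lborel) \<partial>uniform_sphere)"
      unfolding m(1)[symmetric] by (rule nn_integral_polar_squared) measurable
    also have "(\<integral>\<^sup>+u. (\<integral>\<^sup>+q. H (sqrt q *\<^sub>R u) * ennreal ((1 + (norm (sqrt q *\<^sub>R u))\<^sup>2) powr (- (?k + \<nu>) / 2)) *
         ennreal (if q > 0 then q powr (?k/2 - 1) else 0) \<partial>lborel) \<partial>uniform_sphere) =
       (\<integral>\<^sup>+u. ennreal \<beta> * (\<integral>\<^sup>+Q. ?J H u Q \<partial>lborel) \<partial>uniform_sphere)"
    proof (rule nn_integral_cong_AE, rule eventually_mono[OF AE_uniform_sphere_norm])
      fix u :: "real^'n" assume u: "norm u = 1"
      let ?f = "\<lambda>q. H (sqrt q *\<^sub>R u) * ennreal (if q > 0 then q powr (?k/2 - 1) * (1 + q) powr (- (?k + \<nu>) / 2) else 0)"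
      let ?c = "?k / \<nu>"
      have c: "?c > 0" using \<nu> by simp
      have fm: "?f \<in> borel_measurable borel" by measurable
      have "(\<integral>\<^sup>+q. H (sqrt q *\<^sub>R u) * ennreal ((1 + (norm (sqrt q *\<^sub>R u))\<^sup>2) powr (- (?k + \<nu>) / 2)) *
         ennreal (if q > 0 then q powr (?k/2 - 1) else 0) \<partial>lborel) = (\<integral>\<^sup>+q. ?f q \<partial>lborel)"
      proof (rule nn_integral_cong)
        fix q :: real
        show "H (sqrt q *\<^sub>R u) * ennreal ((1 + (norm (sqrt q *\<^sub>R u))\<^sup>2) powr (- (?k + \<nu>) / 2)) *
         ennreal (if q > 0 then q powr (?k/2 - 1) else 0) = ?f q"
          using u by (cases "q > 0") (simp_all add: ennreal_mult mult_ac)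
      qed
      also have "\<dots> = (\<integral>\<^sup>+Q. ennreal (\<bar>?c\<bar> ^ DIM(real)) * ?f (0 + ?c *\<^sub>R Q) \<partial>lborel)"
        by (rule nn_integral_lborel_affine_subst[OF fm, symmetric]) (use \<nu> in simp)
      also have "\<dots> = (\<integral>\<^sup>+Q. ennreal \<beta> * (?J H u Q) \<partial>lborel)"
      proof (rule nn_integral_cong)
        fix Q :: real
        have arg: "0 + ?c *\<^sub>R Q = ?k * Q / \<nu>" by simp
        show "ennreal (\<bar>?c\<bar> ^ DIM(real)) * ?f (0 + ?c *\<^sub>R Q) = ennreal \<beta> * (?J H u Q)"
          unfolding arg
        proof (cases "Q > 0")
          case True
          have pos: "?k * Q / \<nu> > 0" using True \<nu> by simp
          have s: "?c * (?k * Q / \<nu>) powr (?k/2 - 1) = ?c powr (?k/2) * Q powr (?k/2 - 1)"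
          proof -
            have "(?k * Q / \<nu>) powr (?k/2 - 1) = ?c powr (?k/2 - 1) * Q powr (?k/2 - 1)"
              using powr_mult[of ?c Q "?k/2 - 1"] by simp
            moreover have "z * z powr (x - 1) = z powr x" if "z > 0" for z x :: real using that by (simp add: powr_diff)
            from this[OF c] have "?c * ?c powr (?k/2 - 1) = ?c powr (?k/2)" .
            ultimately show ?thesis by (simp only: mult.assoc[symmetric])
          qed
          have "\<beta> * F_density ?k \<nu> Q = ?c powr (?k/2) * Q powr (?k/2 - 1) * (1 + ?k * Q / \<nu>) powr (- (?k + \<nu>) / 2)"
            using True b unfolding F_density_def \<beta>_def[symmetric] by (simp add: ac_simps)
          then have "?c * ((?k * Q / \<nu>) powr (?k/2 - 1) * (1 + ?k * Q / \<nu>) powr (- (?k + \<nu>) / 2)) = \<beta> * F_density ?k \<nu> Q"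
            unfolding s[symmetric] by simp
          then have e: "ennreal ?c * ennreal ((?k * Q / \<nu>) powr (?k/2 - 1) * (1 + ?k * Q / \<nu>) powr (- (?k + \<nu>) / 2)) = ennreal \<beta> * ennreal (F_density ?k \<nu> Q)"
            using c b by (simp only: ennreal_mult'[symmetric] less_imp_le)
          have "ennreal (\<bar>?c\<bar> ^ DIM(real)) = ennreal ?c" using \<nu> by simp
          then show "ennreal (\<bar>?c\<bar> ^ DIM(real)) * ?f (?k * Q / \<nu>) = ennreal \<beta> * (?J H u Q)"
          proof -
            have "u1 * (x * u2) = (u1 * u2) * x" for u1 u2 x :: ennreal by (simp only: mult_ac)
            then show ?thesis using \<open>ennreal (\<bar>?c\<bar> ^ DIM(real)) = ennreal ?c\<close> e pos by (simp only: if_True)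
          qed
        next
          case False
          then have "\<not> ?k * Q / \<nu> > 0" using \<nu> by (simp add: zero_less_mult_iff zero_less_divide_iff)
          then have "?f (?k * Q / \<nu>) = 0" by (simp only: if_False ennreal_0 mult_zero_right)
          moreover have "F_density ?k \<nu> Q = 0" using False by (simp add: F_density_def)
          ultimately show "ennreal (\<bar>?c\<bar> ^ DIM(real)) * ?f (?k * Q / \<nu>) = ennreal \<beta> * (?J H u Q)"
            by (simp only: ennreal_0 mult_zero_right)
        qed
      qed
      also have "\<dots> = ennreal \<beta> * (\<integral>\<^sup>+Q. ?J H u Q \<partial>lborel)"
        by (rule nn_integral_cmult) measurable
      finally show "(\<integral>\<^sup>+q. H (sqrt q *\<^sub>R u) * ennreal ((1 + (norm (sqrt q *\<^sub>R u))\<^sup>2) powr (- (?k + \<nu>) / 2)) *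
         ennreal (if q > 0 then q powr (?k/2 - 1) else 0) \<partial>lborel) =
         ennreal \<beta> * (\<integral>\<^sup>+Q. ?J H u Q \<partial>lborel)" .
    qed
    also have "\<dots> = ennreal \<beta> * (\<integral>\<^sup>+u. (\<integral>\<^sup>+Q. ?J H u Q \<partial>lborel) \<partial>uniform_sphere)"
      by (rule nn_integral_cmult) measurable
    moreover have "ennreal (?k / 2 * m * \<beta>) = ennreal (?k / 2) * ennreal m * ennreal \<beta>"
      using m(2) b by (simp only: ennreal_mult'' less_imp_le)
    ultimately show ?thesis by (simp only: mult.assoc)
  qed
  moreover have "?k / 2 * m * \<beta> > 0" using m(2) b by simp
  ultimately show thesis using that by blast
qed

section \<open>Independence as a product of laws\<close>

lemma emeasure_pair_eq_product:
  fixes X :: "'w \<Rightarrow> 'a::second_countable_topology" and Y :: "'w \<Rightarrow> 'b::second_countable_topology"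
  assumes X [measurable]: "X \<in> borel_measurable N" and Y [measurable]: "Y \<in> borel_measurable N"
    and P: "prob_space P1" "sets P1 = sets borel" "prob_space P2" "sets P2 = sets borel"
    and c: "c \<noteq> \<infinity>"
    and rect: "\<And>A B. A \<in> sets borel \<Longrightarrow> B \<in> sets borel \<Longrightarrow>
      emeasure N {\<omega> \<in> space N. X \<omega> \<in> A \<and> Y \<omega> \<in> B} = c * emeasure P1 A * emeasure P2 B"
    and E: "E \<in> sets borel"
  shows "emeasure N {\<omega> \<in> space N. (X \<omega>, Y \<omega>) \<in> E} = c * emeasure (P1 \<Otimes>\<^sub>M P2) E"
proof -
  interpret P1: prob_space P1 by fact
  interpret P2: prob_space P2 by fact
  let ?P = "scale_measure c P1"
  have [simp]: "sets P1 = sets borel" "sets P2 = sets borel" "sets ?P = sets borel" by (simp_all add: P)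
  have "finite_measure ?P" by (rule finite_measureI) (use c P1.emeasure_finite in \<open>simp add: ennreal_mult_eq_top_iff\<close>)
  then interpret S: finite_measure ?P .
  have sb: "sets (?P \<Otimes>\<^sub>M P2) = sets (borel \<Otimes>\<^sub>M borel)" "sets (P1 \<Otimes>\<^sub>M P2) = sets (borel \<Otimes>\<^sub>M borel)"
    by (auto intro: sets_pair_measure_cong)
  have "?P \<Otimes>\<^sub>M P2 = distr N (borel \<Otimes>\<^sub>M borel) (\<lambda>\<omega>. (X \<omega>, Y \<omega>))"
  proof (rule pair_measure_eqI)
    show "sigma_finite_measure ?P" "sigma_finite_measure P2" by unfold_locales
    show "sets (?P \<Otimes>\<^sub>M P2) = sets (distr N (borel \<Otimes>\<^sub>M borel) (\<lambda>\<omega>. (X \<omega>, Y \<omega>)))" using sb by simp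
    fix A B assume AB: "A \<in> sets ?P" "B \<in> sets P2"
    then have "emeasure (distr N (borel \<Otimes>\<^sub>M borel) (\<lambda>\<omega>. (X \<omega>, Y \<omega>))) (A \<times> B) =
      emeasure N {\<omega> \<in> space N. X \<omega> \<in> A \<and> Y \<omega> \<in> B}"
      by (subst emeasure_distr) (auto intro!: arg_cong2[where f = emeasure] pair_measureI)
    then show "emeasure ?P A * emeasure P2 B = emeasure (distr N (borel \<Otimes>\<^sub>M borel) (\<lambda>\<omega>. (X \<omega>, Y \<omega>))) (A \<times> B)"
      using rect AB by simp
  qed
  moreover have Ep: "E \<in> sets (borel \<Otimes>\<^sub>M borel)" using E unfolding borel_prod .
  ultimately have "emeasure N {\<omega> \<in> space N. (X \<omega>, Y \<omega>) \<in> E} = emeasure (?P \<Otimes>\<^sub>M P2) E"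
    by (simp add: emeasure_distr) (auto intro!: arg_cong2[where f = emeasure])
  also have "\<dots> = (\<integral>\<^sup>+x. emeasure P2 (Pair x -` E) \<partial>?P)"
    using Ep sb by (intro P2.emeasure_pair_measure_alt) auto
  also have "\<dots> = c * (\<integral>\<^sup>+x. emeasure P2 (Pair x -` E) \<partial>P1)"
    by (rule nn_integral_scale_measure) (use Ep sb in \<open>auto intro!: P2.measurable_emeasure_Pair\<close>)
  also have "\<dots> = c * emeasure (P1 \<Otimes>\<^sub>M P2) E"
    using Ep sb by (subst P2.emeasure_pair_measure_alt) auto
  finally show ?thesis .
qed

text \<open>Conditioning on an event \<open>D\<close> of the remaining variables is what allows pairs to be assembled into longer
  tuples: rectangles determine the measure in one pair of variables while the other factors are kept
  fixed.\<close>

lemma emeasure_pair_eq_product_restricted: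
  fixes X :: "'w \<Rightarrow> 'a::second_countable_topology" and Y :: "'w \<Rightarrow> 'b::second_countable_topology"
  assumes X [measurable]: "X \<in> borel_measurable N" and Y [measurable]: "Y \<in> borel_measurable N"
    and P: "prob_space P1" "sets P1 = sets borel" "prob_space P2" "sets P2 = sets borel"
    and c: "c \<noteq> \<infinity>" and D: "Measurable.pred N D"
    and rect: "\<And>A B. A \<in> sets borel \<Longrightarrow> B \<in> sets borel \<Longrightarrow>
      emeasure N {\<omega> \<in> space N. D \<omega> \<and> X \<omega> \<in> A \<and> Y \<omega> \<in> B} = c * emeasure P1 A * emeasure P2 B"
    and E: "E \<in> sets borel"
  shows "emeasure N {\<omega> \<in> space N. D \<omega> \<and> (X \<omega>, Y \<omega>) \<in> E} = c * emeasure (P1 \<Otimes>\<^sub>M P2) E"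
proof -
  let ?D = "{\<omega> \<in> space N. D \<omega>}"
  let ?N = "density N (indicator ?D)"
  have Ds: "?D \<in> sets N" using D by measurable
  have m: "X \<in> borel_measurable ?N" "Y \<in> borel_measurable ?N" using X Y by simp_all
  have r: "emeasure ?N F = emeasure N (?D \<inter> F)" if "F \<in> sets N" for F
    using emeasure_restricted[OF Ds that] .
  have "emeasure ?N {\<omega> \<in> space ?N. (X \<omega>, Y \<omega>) \<in> E} = c * emeasure (P1 \<Otimes>\<^sub>M P2) E"
  proof (rule emeasure_pair_eq_product[OF m P c _ E])
    fix A :: "'a set" and B :: "'b set" assume AB [measurable]: "A \<in> sets borel" "B \<in> sets borel"
    have "emeasure ?N {\<omega> \<in> space ?N. X \<omega> \<in> A \<and> Y \<omega> \<in> B} = emeasure N (?D \<inter> {\<omega> \<in> space N. X \<omega> \<in> A \<and> Y \<omega> \<in> B})"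
      by (simp, rule r) measurable
    also have "?D \<inter> {\<omega> \<in> space N. X \<omega> \<in> A \<and> Y \<omega> \<in> B} = {\<omega> \<in> space N. D \<omega> \<and> X \<omega> \<in> A \<and> Y \<omega> \<in> B}" by auto
    finally show "emeasure ?N {\<omega> \<in> space ?N. X \<omega> \<in> A \<and> Y \<omega> \<in> B} = c * emeasure P1 A * emeasure P2 B"
      using rect[OF AB] by simp
  qed
  moreover have "{\<omega> \<in> space N. (X \<omega>, Y \<omega>) \<in> E} \<in> sets N"
  proof -
    have "(\<lambda>\<omega>. (X \<omega>, Y \<omega>)) \<in> measurable N (borel \<Otimes>\<^sub>M borel)" by measurable
    then show ?thesis using measurable_sets[of _ N "borel \<Otimes>\<^sub>M borel" E] E by (simp add: borel_prod vimage_def Int_def conj_commute)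
  qed
  from r[OF this] have "emeasure ?N {\<omega> \<in> space ?N. (X \<omega>, Y \<omega>) \<in> E} = emeasure N {\<omega> \<in> space N. D \<omega> \<and> (X \<omega>, Y \<omega>) \<in> E}"
    by (simp add: Int_def conj_ac cong: conj_cong)
  ultimately show ?thesis by simp
qed

text \<open>The order of the components is that of the integrals in the final computation: direction, radius,
  chi-square variable, Gaussian vector.\<close>

lemma distr_mutually_indep4:
  fixes X1 :: "'w \<Rightarrow> 'a::second_countable_topology" and X2 :: "'w \<Rightarrow> 'b::second_countable_topology"
    and X3 :: "'w \<Rightarrow> 'c::second_countable_topology" and X4 :: "'w \<Rightarrow> 'd::second_countable_topology"
  assumes M: "prob_space M" and ind: "mutually_indep4 M X1 X2 X3 X4"
    and m [measurable]: "X1 \<in> borel_measurable M" "X2 \<in> borel_measurable M" "X3 \<in> borel_measurable M" "X4 \<in> borel_measurable M"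
  shows "distr M borel (\<lambda>\<omega>. (X4 \<omega>, X3 \<omega>, X1 \<omega>, X2 \<omega>)) =
    distr M borel X4 \<Otimes>\<^sub>M (distr M borel X3 \<Otimes>\<^sub>M (distr M borel X1 \<Otimes>\<^sub>M distr M borel X2))"
proof -
  interpret prob_space M by fact
  let ?P1 = "distr M borel X1" and ?P2 = "distr M borel X2" and ?P3 = "distr M borel X3" and ?P4 = "distr M borel X4"
  have ps: "prob_space ?P1" "prob_space ?P2" "prob_space ?P3" "prob_space ?P4"
    by (auto intro: prob_space_distr)
  have e: "emeasure (distr M borel Z) A = emeasure M {\<omega> \<in> space M. Z \<omega> \<in> A}"
    if "Z \<in> borel_measurable M" "A \<in> sets borel" for Z :: "'w \<Rightarrow> 'z::second_countable_topology" and A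
    using that by (simp add: emeasure_distr) (auto intro!: arg_cong2[where f = emeasure])
  have rect: "emeasure M {\<omega> \<in> space M. (X4 \<omega> \<in> A4 \<and> X3 \<omega> \<in> A3) \<and> X1 \<omega> \<in> A1 \<and> X2 \<omega> \<in> A2} =
      emeasure ?P4 A4 * emeasure ?P3 A3 * emeasure ?P1 A1 * emeasure ?P2 A2"
    if A [measurable]: "A1 \<in> sets borel" "A2 \<in> sets borel" "A3 \<in> sets borel" "A4 \<in> sets borel" for A1 A2 A3 A4
  proof -
    let ?F = "\<lambda>i. [{X1 -` A \<inter> space M | A. A \<in> sets borel}, {X2 -` A \<inter> space M | A. A \<in> sets borel},
             {X3 -` A \<inter> space M | A. A \<in> sets borel}, {X4 -` A \<inter> space M | A. A \<in> sets borel}] ! i"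
    let ?A = "\<lambda>i. [X1 -` A1 \<inter> space M, X2 -` A2 \<inter> space M, X3 -` A3 \<inter> space M, X4 -` A4 \<inter> space M] ! i"
    have four: "{..<4::nat} = {0, 1, 2, 3}" by auto
    have "?A \<in> Pi {..<4} ?F" using A by (auto simp: four)
    then have "prob (\<Inter>j\<in>{..<4}. ?A j) = (\<Prod>j\<in>{..<4}. prob (?A j))"
    proof (intro indep_setsD[where F = ?F and I = "{..<4}"])
      show "indep_sets ?F {..<4}" using ind unfolding mutually_indep4_def .
      show "{..<4::nat} \<noteq> {}" by (simp only: four) simp
    qed auto
    then have "prob ((X1 -` A1 \<inter> space M) \<inter> (X2 -` A2 \<inter> space M) \<inter> (X3 -` A3 \<inter> space M) \<inter> (X4 -` A4 \<inter> space M)) =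
       prob (X1 -` A1 \<inter> space M) * prob (X2 -` A2 \<inter> space M) * prob (X3 -` A3 \<inter> space M) * prob (X4 -` A4 \<inter> space M)"
      by (simp add: four Int_ac mult_ac)
    moreover have "(X1 -` A1 \<inter> space M) \<inter> (X2 -` A2 \<inter> space M) \<inter> (X3 -` A3 \<inter> space M) \<inter> (X4 -` A4 \<inter> space M) =
       {\<omega> \<in> space M. (X4 \<omega> \<in> A4 \<and> X3 \<omega> \<in> A3) \<and> X1 \<omega> \<in> A1 \<and> X2 \<omega> \<in> A2}" by auto
    ultimately show ?thesis using A
      by (simp add: emeasure_distr emeasure_eq_measure ennreal_mult[symmetric] mult_ac)
  qed
  have fin: "emeasure (distr M borel Z) A \<noteq> \<infinity>" if "Z \<in> borel_measurable M" for Z :: "'w \<Rightarrow> 'z::second_countable_topology" and A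
    using prob_space.emeasure_le_1[OF prob_space_distr[OF that], of A] by (auto simp: top_unique)
  interpret Q12: pair_prob_space ?P1 ?P2 using ps by (simp add: pair_prob_space_def pair_sigma_finite_def prob_space_imp_sigma_finite)
  have q12: "prob_space (?P1 \<Otimes>\<^sub>M ?P2)" by unfold_locales
  then have q3: "prob_space (?P3 \<Otimes>\<^sub>M (?P1 \<Otimes>\<^sub>M ?P2))"
  proof -
    interpret pair_prob_space ?P3 "?P1 \<Otimes>\<^sub>M ?P2"
      using ps q12 by (simp add: pair_prob_space_def pair_sigma_finite_def prob_space_imp_sigma_finite)
    show ?thesis by unfold_locales
  qed
  have s12: "sets (?P1 \<Otimes>\<^sub>M ?P2) = sets borel"
  proof -
    have "sets (?P1 \<Otimes>\<^sub>M ?P2) = sets (borel \<Otimes>\<^sub>M borel)" by (rule sets_pair_measure_cong) auto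
    then show ?thesis unfolding borel_prod .
  qed
  have s3: "sets (?P3 \<Otimes>\<^sub>M (?P1 \<Otimes>\<^sub>M ?P2)) = sets borel"
  proof -
    have "sets (?P3 \<Otimes>\<^sub>M (?P1 \<Otimes>\<^sub>M ?P2)) = sets (borel \<Otimes>\<^sub>M borel)" using s12 by (intro sets_pair_measure_cong) auto
    then show ?thesis unfolding borel_prod .
  qed
  have s4: "sets (?P4 \<Otimes>\<^sub>M (?P3 \<Otimes>\<^sub>M (?P1 \<Otimes>\<^sub>M ?P2))) = sets borel"
  proof -
    have "sets (?P4 \<Otimes>\<^sub>M (?P3 \<Otimes>\<^sub>M (?P1 \<Otimes>\<^sub>M ?P2))) = sets (borel \<Otimes>\<^sub>M borel)" using s3 by (intro sets_pair_measure_cong) auto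
    then show ?thesis unfolding borel_prod .
  qed
  have m12 [measurable]: "(\<lambda>\<omega>. (X1 \<omega>, X2 \<omega>)) \<in> borel_measurable M"
    unfolding borel_prod[symmetric] by measurable
  have m3 [measurable]: "(\<lambda>\<omega>. (X3 \<omega>, X1 \<omega>, X2 \<omega>)) \<in> borel_measurable M"
    unfolding borel_prod[symmetric] by measurable
  have m4: "(\<lambda>\<omega>. (X4 \<omega>, X3 \<omega>, X1 \<omega>, X2 \<omega>)) \<in> borel_measurable M"
    unfolding borel_prod[symmetric] by measurable
  (* Innermost pair first; in each step the product formula on rectangles extends to all Borel sets
     of the pair just formed. *)
  have r12: "emeasure M {\<omega> \<in> space M. (X4 \<omega> \<in> A4 \<and> X3 \<omega> \<in> A3) \<and> (X1 \<omega>, X2 \<omega>) \<in> E} =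
      emeasure ?P4 A4 * emeasure ?P3 A3 * emeasure (?P1 \<Otimes>\<^sub>M ?P2) E"
    if A [measurable]: "A3 \<in> sets borel" "A4 \<in> sets borel" and E: "E \<in> sets borel" for A3 A4 E
  proof (rule emeasure_pair_eq_product_restricted[OF m(1,2) ps(1) _ ps(2) _ _ _ _ E])
    show "emeasure ?P4 A4 * emeasure ?P3 A3 \<noteq> \<infinity>"
      using fin[OF m(4), of A4] fin[OF m(3), of A3] by (simp add: ennreal_mult_eq_top_iff)
    show "Measurable.pred M (\<lambda>\<omega>. X4 \<omega> \<in> A4 \<and> X3 \<omega> \<in> A3)" by measurable
    show "emeasure M {\<omega> \<in> space M. (X4 \<omega> \<in> A4 \<and> X3 \<omega> \<in> A3) \<and> X1 \<omega> \<in> A1 \<and> X2 \<omega> \<in> A2} =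
      emeasure ?P4 A4 * emeasure ?P3 A3 * emeasure ?P1 A1 * emeasure ?P2 A2"
      if "A1 \<in> sets borel" "A2 \<in> sets borel" for A1 A2 by (rule rect[OF that A])
  qed simp_all
  have r3: "emeasure M {\<omega> \<in> space M. X4 \<omega> \<in> A4 \<and> (X3 \<omega>, X1 \<omega>, X2 \<omega>) \<in> E} =
      emeasure ?P4 A4 * emeasure (?P3 \<Otimes>\<^sub>M (?P1 \<Otimes>\<^sub>M ?P2)) E"
    if A [measurable]: "A4 \<in> sets borel" and E: "E \<in> sets borel" for A4 E
    by (rule emeasure_pair_eq_product_restricted[OF m(3) m12 ps(3) _ q12 s12 _ _ _ E])
       (use r12 A fin[OF m(4)] in \<open>simp_all add: conj_assoc\<close>)
  have r4: "emeasure M {\<omega> \<in> space M. (X4 \<omega>, X3 \<omega>, X1 \<omega>, X2 \<omega>) \<in> E} =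
      1 * emeasure (?P4 \<Otimes>\<^sub>M (?P3 \<Otimes>\<^sub>M (?P1 \<Otimes>\<^sub>M ?P2))) E" if E: "E \<in> sets borel" for E
    by (rule emeasure_pair_eq_product[OF m(4) m3 ps(4) _ q3 s3 _ _ E]) (use r3 in simp_all)
  show ?thesis
  proof (rule measure_eqI)
    show "sets (distr M borel (\<lambda>\<omega>. (X4 \<omega>, X3 \<omega>, X1 \<omega>, X2 \<omega>))) = sets (?P4 \<Otimes>\<^sub>M (?P3 \<Otimes>\<^sub>M (?P1 \<Otimes>\<^sub>M ?P2)))"
      using s4 by simp
    fix E assume "E \<in> sets (distr M borel (\<lambda>\<omega>. (X4 \<omega>, X3 \<omega>, X1 \<omega>, X2 \<omega>)))"
    then have E: "E \<in> sets borel" by simp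
    show "emeasure (distr M borel (\<lambda>\<omega>. (X4 \<omega>, X3 \<omega>, X1 \<omega>, X2 \<omega>))) E = emeasure (?P4 \<Otimes>\<^sub>M (?P3 \<Otimes>\<^sub>M (?P1 \<Otimes>\<^sub>M ?P2))) E"
      using r4[OF E] e[OF m4 E] by simp
  qed
qed

lemma driving_variables_chi_square_mass:
  assumes "driving_variables M \<nu>\<eta> \<nu> \<eta> z0 Q u"
  shows "(\<integral>\<^sup>+s. ennreal (chi_square_density \<nu>\<eta> s) \<partial>lborel) = 1"
proof -
  have M: "prob_space M" and d: "distributed M lborel \<eta> (\<lambda>y. ennreal (chi_square_density \<nu>\<eta> y))"
    using assms by (auto simp: driving_variables_def)
  have "prob_space (distr M lborel \<eta>)"
    using M d by (intro prob_space.prob_space_distr distributed_measurable)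
  then have "prob_space (density lborel (\<lambda>y. ennreal (chi_square_density \<nu>\<eta> y)))"
    using distributed_distr_eq_density[OF d] by simp
  from prob_space.emeasure_space_1[OF this] show ?thesis
    by (simp add: emeasure_density cong: nn_integral_cong)
qed

lemma driving_variables_nn_integral:
  fixes G :: "(real^'k) \<times> real \<times> real \<times> (real^'p) \<Rightarrow> ennreal"
  assumes dv: "driving_variables M \<nu>\<eta> \<nu> \<eta> z0 Q (u :: 'w \<Rightarrow> real^('k::finite))"
    and G [measurable]: "G \<in> borel_measurable borel"
  shows "(\<integral>\<^sup>+\<omega>. G (u \<omega>, Q \<omega>, \<eta> \<omega>, z0 \<omega>) \<partial>M) =
    (\<integral>\<^sup>+u. \<integral>\<^sup>+Q. (\<integral>\<^sup>+s. (\<integral>\<^sup>+z. ennreal (std_gauss z) * G (u, Q, s, z) \<partial>lborel) * ennreal (chi_square_density \<nu>\<eta> s) \<partial>lborel)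
       * ennreal (F_density (real CARD('k)) \<nu> Q) \<partial>lborel \<partial>uniform_sphere)"
proof -
  have M: "prob_space M" and d: "distributed M lborel \<eta> (\<lambda>y. ennreal (chi_square_density \<nu>\<eta> y))"
      "distributed M lborel z0 (\<lambda>y. ennreal (mvn_density 0 (mat 1) y))"
      "distributed M lborel Q (\<lambda>y. ennreal (F_density (real CARD('k)) \<nu> y))"
    and u: "u \<in> borel_measurable M" "distr M borel u = uniform_sphere"
    and ind: "mutually_indep4 M \<eta> z0 Q u"
    using dv by (auto simp: driving_variables_def)
  interpret prob_space M by fact
  have m: "\<eta> \<in> borel_measurable M" "z0 \<in> borel_measurable M" "Q \<in> borel_measurable M"
    using d[THEN distributed_measurable] by simp_all
  have dist: "distr M borel \<eta> = density lborel (\<lambda>y. ennreal (chi_square_density \<nu>\<eta> y))"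
      "distr M borel z0 = density lborel (\<lambda>y. ennreal (std_gauss y))"
      "distr M borel Q = density lborel (\<lambda>y. ennreal (F_density (real CARD('k)) \<nu> y))"
    using d[THEN distributed_distr_eq_density] by (simp_all cong: distr_cong add: mvn_density_standard)
  have pr: "prob_space (distr M borel \<eta>)" "prob_space (distr M borel z0)" "prob_space (distr M borel Q)" "prob_space (distr M borel u)"
    using m u(1) by (auto intro: prob_space_distr)
  let ?z = "distr M borel z0" and ?e = "distr M borel \<eta>" and ?Q = "distr M borel Q"
  interpret Z: prob_space ?z by (rule pr)
  interpret E: prob_space ?e by (rule pr)
  interpret EZ: pair_prob_space ?e ?z ..
  interpret Qp: prob_space ?Q by (rule pr)
  interpret QEZ: pair_prob_space ?Q "?e \<Otimes>\<^sub>M ?z" ..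
  have mm: "(\<lambda>\<omega>. (u \<omega>, Q \<omega>, \<eta> \<omega>, z0 \<omega>)) \<in> borel_measurable M"
    unfolding borel_prod[symmetric] using m u(1) by measurable
  have Gm: "G \<in> borel_measurable (borel \<Otimes>\<^sub>M (borel \<Otimes>\<^sub>M (borel \<Otimes>\<^sub>M borel)))"
    using G by (simp add: borel_prod)
  have s [measurable_cong]: "sets ?z = sets borel" "sets ?e = sets borel" "sets ?Q = sets borel" by simp_all
  have G': "G \<in> borel_measurable (uniform_sphere \<Otimes>\<^sub>M (?Q \<Otimes>\<^sub>M (?e \<Otimes>\<^sub>M ?z)))"
    using Gm by (simp cong: measurable_cong_sets sets_pair_measure_cong)
  have "(\<integral>\<^sup>+\<omega>. G (u \<omega>, Q \<omega>, \<eta> \<omega>, z0 \<omega>) \<partial>M) = (\<integral>\<^sup>+p. G p \<partial>distr M borel (\<lambda>\<omega>. (u \<omega>, Q \<omega>, \<eta> \<omega>, z0 \<omega>)))"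
    using G by (simp add: nn_integral_distr[OF mm])
  also have "\<dots> = (\<integral>\<^sup>+p. G p \<partial>(uniform_sphere \<Otimes>\<^sub>M (?Q \<Otimes>\<^sub>M (?e \<Otimes>\<^sub>M ?z))))"
    unfolding distr_mutually_indep4[OF M ind m u(1)] u(2) ..
  also have "\<dots> = (\<integral>\<^sup>+u. \<integral>\<^sup>+p. G (u, p) \<partial>(?Q \<Otimes>\<^sub>M (?e \<Otimes>\<^sub>M ?z)) \<partial>uniform_sphere)"
    by (rule QEZ.P.nn_integral_fst[symmetric]) (rule G')
  also have "\<dots> = (\<integral>\<^sup>+u. \<integral>\<^sup>+Q. \<integral>\<^sup>+p. G (u, Q, p) \<partial>(?e \<Otimes>\<^sub>M ?z) \<partial>?Q \<partial>uniform_sphere)"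
    by (intro nn_integral_cong EZ.P.nn_integral_fst[symmetric] measurable_compose[OF measurable_Pair1' G']) simp
  also have "\<dots> = (\<integral>\<^sup>+u. \<integral>\<^sup>+Q. \<integral>\<^sup>+s. \<integral>\<^sup>+z. G (u, Q, s, z) \<partial>?z \<partial>?e \<partial>?Q \<partial>uniform_sphere)"
  proof (intro nn_integral_cong Z.nn_integral_fst[symmetric])
    fix a :: "real^'k" and b :: real
    have "(\<lambda>p. (a, b, p)) \<in> measurable (?e \<Otimes>\<^sub>M ?z) (uniform_sphere \<Otimes>\<^sub>M (?Q \<Otimes>\<^sub>M (?e \<Otimes>\<^sub>M ?z)))"
      by (intro measurable_Pair measurable_const measurable_ident) (auto simp: uniform_sphere_def)
    then show "(\<lambda>p. G (a, b, p)) \<in> borel_measurable (?e \<Otimes>\<^sub>M ?z)" using G' by (rule measurable_compose)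
  qed
  finally have A: "(\<integral>\<^sup>+\<omega>. G (u \<omega>, Q \<omega>, \<eta> \<omega>, z0 \<omega>) \<partial>M) = \<dots>" .
  note Gm [measurable]
  show "(\<integral>\<^sup>+\<omega>. G (u \<omega>, Q \<omega>, \<eta> \<omega>, z0 \<omega>) \<partial>M) =
    (\<integral>\<^sup>+u. \<integral>\<^sup>+Q. (\<integral>\<^sup>+s. (\<integral>\<^sup>+z. ennreal (std_gauss z) * G (u, Q, s, z) \<partial>lborel) * ennreal (chi_square_density \<nu>\<eta> s) \<partial>lborel)
       * ennreal (F_density (real CARD('k)) \<nu> Q) \<partial>lborel \<partial>uniform_sphere)"
    unfolding A dist
    by (simp add: nn_integral_density mult.commute)
qed

section \<open>The joint kernel of location and scale\<close>

lemma borel_measurable_weights_rep [measurable (raw)]: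
  fixes L :: "real^'k^'p" and \<zeta> :: "'a \<Rightarrow> real^'k"
  assumes [measurable]: "\<epsilon> \<in> borel_measurable M" "\<zeta> \<in> borel_measurable M" "\<Upsilon> \<in> borel_measurable M"
    "z \<in> borel_measurable M" "s \<in> borel_measurable M"
  shows "(\<lambda>x. weights_rep C L (\<epsilon> x) (\<zeta> x) (\<Upsilon> x) (z x) (s x)) \<in> borel_measurable M"
  unfolding weights_rep_def by measurable

lemma borel_measurable_rep [measurable (raw)]:
  fixes Q :: "'a \<Rightarrow> real" and u :: "'a \<Rightarrow> real^'k"
  assumes [measurable]: "Q \<in> borel_measurable M" "u \<in> borel_measurable M"
  shows "(\<lambda>x. eps_rep m S N \<nu> r (Q x) (u x)) \<in> borel_measurable M"
    "(\<lambda>x. zeta_rep m S N \<nu> r (Q x) (u x)) \<in> borel_measurable M"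
    "(\<lambda>x. Upsilon_rep S \<nu> (Q x) (u x)) \<in> borel_measurable M"
  unfolding eps_rep_def zeta_rep_def Upsilon_rep_def Let_def by measurable

lemma matrix_sqrt_matrix_inv:
  fixes S :: "real^'n^'n"
  assumes S: "pos_def S"
  defines "R \<equiv> matrix_sqrt (matrix_inv S)"
  shows "transpose R = R" "R ** R = matrix_inv S" "invertible R"
    "matrix_inv R ** matrix_inv R = S" "transpose (matrix_inv R) = matrix_inv R"
proof -
  have pd: "pos_def (matrix_inv S)" using pos_def_matrix_inv[OF S] .
  note psd = pos_def_imp_semidef[OF pd]
  show t: "transpose R = R" using pos_semidef_matrix_sqrt[OF psd] by (simp add: pos_semidef_def R_def)
  show RR: "R ** R = matrix_inv S" unfolding R_def by (rule matrix_sqrt_square[OF psd])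
  show i: "invertible R" using invertible_sqrt[OF RR pos_def_imp_invertible[OF pd]] .
  show "transpose (matrix_inv R) = matrix_inv R" using t i by (metis matrix_inv_transpose)
  have "matrix_inv R ** matrix_inv R = matrix_inv (R ** R)" using i by (simp add: matrix_inv_mul)
  also have "\<dots> = S" unfolding RR using matrix_inv_left[OF pos_def_imp_invertible[OF S]] by (rule matrix_inv_eqI)
  finally show "matrix_inv R ** matrix_inv R = S" .
qed

text \<open>In the standardized coordinate \<open>y = \<surd>N S\<^sup>-\<^sup>1\<^sup>/\<^sup>2 (\<mu> - m) = \<surd>q u\<close>, the scale matrix given \<open>\<mu>\<close> is a rank-one
  perturbation of \<open>S\<close>, inverted by the Sherman--Morrison formula. This is where the three expressions of
  the representation come from.\<close>

lemma rep_identities: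
  fixes S :: "real^'k^'k" and m u :: "real^'k"
  assumes S: "pos_def S" and N: "N > 0" and u: "norm u = 1" and Q: "Q \<ge> 0" and \<nu>: "\<nu> > 0"
  defines "q \<equiv> real CARD('k) * Q / \<nu>" and "B \<equiv> matrix_inv (matrix_sqrt (matrix_inv S))"
  defines "\<mu> \<equiv> m + (1 / sqrt N) *\<^sub>R (B *v (sqrt q *\<^sub>R u))"
  defines "V \<equiv> matrix_inv (S + N *\<^sub>R outer (\<mu> - m) (\<mu> - m))"
  shows "V = Upsilon_rep S \<nu> Q u"
    "V *v (\<mu> - r *\<^sub>R 1) = zeta_rep m S N \<nu> r Q u"
    "(\<mu> - r *\<^sub>R 1) \<bullet> (V *v (\<mu> - r *\<^sub>R 1)) = eps_rep m S N \<nu> r Q u"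
proof -
  let ?R = "matrix_sqrt (matrix_inv S)"
  note R = matrix_sqrt_matrix_inv[OF S]
  have q: "q \<ge> 0" using Q \<nu> by (simp add: q_def)
  have q1: "1 + q > 0" using q by simp
  have uu: "u \<bullet> u = 1" using u by (simp add: norm_eq_1)
  have RB: "?R ** B = mat 1" "B ** ?R = mat 1" unfolding B_def by (simp_all add: matrix_inv_right matrix_inv_left R(3))
  have BB: "B ** B = S" "transpose B = B" unfolding B_def using R(4,5) by auto
  define t where "t = q / (1 + q)"
  have t1: "1 - t = 1 / (1 + q)" using q1 by (simp add: t_def field_simps)
  have "N *\<^sub>R outer (\<mu> - m) (\<mu> - m) = q *\<^sub>R outer (B *v u) (B *v u)"
  proof -
    have "\<mu> - m = (sqrt q / sqrt N) *\<^sub>R (B *v u)" by (simp add: \<mu>_def matrix_vector_mult_scaleR)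
    then have "outer (\<mu> - m) (\<mu> - m) = ((sqrt q / sqrt N) * (sqrt q / sqrt N)) *\<^sub>R outer (B *v u) (B *v u)"
      by (simp add: outer_def vec_eq_iff)
    also have "(sqrt q / sqrt N) * (sqrt q / sqrt N) = q / N" using N q by simp
    finally show ?thesis using N by simp
  qed
  then have SB: "S + N *\<^sub>R outer (\<mu> - m) (\<mu> - m) = B ** (mat 1 + q *\<^sub>R outer u u) ** B"
    by (simp add: matrix_add_ldistrib matrix_add_rdistrib BB matrix_mul_scaleR_right matrix_mul_scaleR_left
        matrix_mul_outer outer_matrix_mul)
  have U: "Upsilon_rep S \<nu> Q u = ?R ** (mat 1 - t *\<^sub>R outer u u) ** ?R"
    by (simp add: Upsilon_rep_def Let_def q_def[symmetric] t_def[symmetric] matrix_sub_ldistrib matrix_sub_rdistrib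
        R(2) matrix_mul_scaleR_right matrix_mul_scaleR_left)
  have in1: "(mat 1 + q *\<^sub>R outer u u) ** (mat 1 - t *\<^sub>R outer u u) = mat 1"
  proof -
    have Mu: "(mat 1 + q *\<^sub>R outer u u) *v u = (1 + q) *\<^sub>R u"
      by (simp add: matrix_vector_mult_add_rdistrib scaleR_matrix_vector_assoc[symmetric] outer_mult_vec uu scaleR_add_left)
    have "(mat 1 + q *\<^sub>R outer u u) ** (mat 1 - t *\<^sub>R outer u u) = mat 1 + q *\<^sub>R outer u u - (t * (1 + q)) *\<^sub>R outer u u"
      by (simp add: matrix_sub_ldistrib matrix_mul_scaleR_right matrix_mul_outer Mu outer_scaleR_left)
    also have "t * (1 + q) = q" using q1 by (simp add: t_def)
    finally show ?thesis by simp
  qed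
  have "(S + N *\<^sub>R outer (\<mu> - m) (\<mu> - m)) ** Upsilon_rep S \<nu> Q u = mat 1"
  proof -
    have "(S + N *\<^sub>R outer (\<mu> - m) (\<mu> - m)) ** Upsilon_rep S \<nu> Q u =
        B ** (mat 1 + q *\<^sub>R outer u u) ** (B ** ?R) ** (mat 1 - t *\<^sub>R outer u u) ** ?R"
      unfolding SB U by (simp only: matrix_mul_assoc)
    also have "\<dots> = B ** ((mat 1 + q *\<^sub>R outer u u) ** (mat 1 - t *\<^sub>R outer u u)) ** ?R"
      unfolding RB matrix_mul_rid by (simp only: matrix_mul_assoc)
    finally show ?thesis by (simp add: in1 RB)
  qed
  then show V: "V = Upsilon_rep S \<nu> Q u" unfolding V_def by (rule matrix_inv_eqI)
  define a where "a = m - r *\<^sub>R (1 :: real^'k)"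
  define \<kappa> where "\<kappa> = sqrt q / sqrt N"
  have b: "\<mu> - r *\<^sub>R 1 = a + \<kappa> *\<^sub>R (B *v u)"
    by (simp add: \<mu>_def a_def \<kappa>_def matrix_vector_mult_scaleR)
  define c where "c = ?R *v a"
  have Rb: "?R *v (\<mu> - r *\<^sub>R 1) = c + \<kappa> *\<^sub>R u"
    by (simp add: b c_def matrix_vector_right_distrib matrix_vector_mult_scaleR matrix_vector_mul_assoc RB)
  have au: "a \<bullet> (?R *v u) = c \<bullet> u" by (simp add: c_def inner_mult_symmetric[OF R(1)])
  have aSa: "a \<bullet> (matrix_inv S *v a) = c \<bullet> c"
  proof -
    have "matrix_inv S *v a = ?R *v c" by (simp only: c_def matrix_vector_mul_assoc R(2))
    then show ?thesis using inner_mult_symmetric[OF R(1), of a c] by (simp only: c_def)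
  qed
  have core: "(mat 1 - t *\<^sub>R outer u u) *v (c + \<kappa> *\<^sub>R u) = c + (\<kappa> * (1 - t) - t * (c \<bullet> u)) *\<^sub>R u"
    by (simp add: matrix_vector_mult_diff_rdistrib scaleR_matrix_vector_assoc[symmetric] outer_mult_vec
        inner_add_right uu inner_commute[of u c] algebra_simps)
  have Vb: "V *v (\<mu> - r *\<^sub>R 1) = ?R *v (c + (\<kappa> * (1 - t) - t * (c \<bullet> u)) *\<^sub>R u)"
    unfolding V U matrix_vector_mul_assoc[symmetric] Rb core ..
  have k1: "\<kappa> * (1 - t) = 1 / sqrt N * (sqrt q / (1 + q))" by (simp add: t1 \<kappa>_def)
  have "zeta_rep m S N \<nu> r Q u = matrix_inv S *v a + (\<kappa> * (1 - t)) *\<^sub>R (?R *v u) - t *\<^sub>R ((?R ** outer u u ** ?R) *v a)"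
    by (simp add: zeta_rep_def Let_def q_def[symmetric] t_def[symmetric] a_def[symmetric] k1)
  also have "(?R ** outer u u ** ?R) *v a = (c \<bullet> u) *\<^sub>R (?R *v u)"
    by (simp add: matrix_vector_mul_assoc[symmetric] outer_mult_vec c_def matrix_vector_mult_scaleR inner_commute)
  finally have z: "zeta_rep m S N \<nu> r Q u = matrix_inv S *v a + (\<kappa> * (1 - t)) *\<^sub>R (?R *v u) - t *\<^sub>R ((c \<bullet> u) *\<^sub>R (?R *v u))" .
  show "V *v (\<mu> - r *\<^sub>R 1) = zeta_rep m S N \<nu> r Q u"
    unfolding Vb z
    by (simp add: c_def matrix_vector_right_distrib matrix_vector_mult_diff_distrib matrix_vector_mult_scaleR
        matrix_vector_mul_assoc R(2) scaleR_diff_left)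
  have "x \<bullet> (?R *v y) = (?R *v x) \<bullet> y" for x y by (rule inner_mult_symmetric[OF R(1)])
  from this[of "\<mu> - r *\<^sub>R 1" "c + (\<kappa> * (1 - t) - t * (c \<bullet> u)) *\<^sub>R u"]
  have "(\<mu> - r *\<^sub>R 1) \<bullet> (V *v (\<mu> - r *\<^sub>R 1)) = (c + \<kappa> *\<^sub>R u) \<bullet> (c + (\<kappa> * (1 - t) - t * (c \<bullet> u)) *\<^sub>R u)"
    by (simp only: Vb Rb)
  also have "\<dots> = c \<bullet> c + 2 * (\<kappa> * (1 - t)) * (c \<bullet> u) + \<kappa> * (\<kappa> * (1 - t)) - t * (c \<bullet> u)\<^sup>2"
    by (simp add: inner_add_left inner_add_right uu inner_commute[of u c] power2_eq_square algebra_simps)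
  also have "\<kappa> * (\<kappa> * (1 - t)) = 1 / N * t"
  proof -
    have "\<kappa> * \<kappa> = q / N" using q N by (simp add: \<kappa>_def)
    then have "\<kappa> * (\<kappa> * (1 - t)) = q / N * (1 / (1 + q))" by (simp only: mult.assoc[symmetric] t1)
    then show ?thesis by (simp add: t_def)
  qed
  also have "c \<bullet> c + 2 * (\<kappa> * (1 - t)) * (c \<bullet> u) + 1 / N * t - t * (c \<bullet> u)\<^sup>2 = eps_rep m S N \<nu> r Q u"
    unfolding k1 by (simp add: eps_rep_def Let_def q_def[symmetric] a_def[symmetric] aSa au t_def)
  finally show "(\<mu> - r *\<^sub>R 1) \<bullet> (V *v (\<mu> - r *\<^sub>R 1)) = eps_rep m S N \<nu> r Q u" .
qed

text \<open>The law of \<open>\<Sigma>\<^sup>-\<^sup>1 b\<close> is mapped by \<open>L\<close>, and the Gaussian part is replaced by one with the same covariance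
  matrix and the symmetric square root.\<close>

lemma weights_given_location:
  fixes L :: "real^'k^'p" and S :: "real^'k^'k" and \<mu> :: "real^'k" and g :: "real^'p \<Rightarrow> ennreal"
  assumes S: "pos_def S" and D: "D - real CARD('k) - 1 > 0"
    and chi: "(\<integral>\<^sup>+s. ennreal (chi_square_density (D - real CARD('k) - 1) s) \<partial>lborel) = 1"
    and g [measurable]: "g \<in> borel_measurable borel"
  shows "(\<integral>\<^sup>+X. g (L *v weights C r \<mu> X) * ennreal (iw_kernel D S X) \<partial>lebesgue_sym) =
    ennreal (det S powr ((real CARD('k) + 1 - D) / 2)) * iw_mass D (mat 1 :: real^'k^'k) *
    (\<integral>\<^sup>+s. (\<integral>\<^sup>+z. ennreal (std_gauss z) * g (weights_rep C L
        ((\<mu> - r *\<^sub>R 1) \<bullet> (matrix_inv S *v (\<mu> - r *\<^sub>R 1))) (matrix_inv S *v (\<mu> - r *\<^sub>R 1)) (matrix_inv S) z s) \<partial>lborel)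
      * ennreal (chi_square_density (D - real CARD('k) - 1) s) \<partial>lborel)"
proof -
  define b where "b = \<mu> - r *\<^sub>R (1 :: real^'k)"
  define V where "V = matrix_inv S"
  obtain K :: "real^'k^'k" where K: "K ** transpose K = (b \<bullet> (V *v b)) *\<^sub>R V - outer (V *v b) (V *v b)"
    "\<forall>g\<in>borel_measurable borel.
      (\<integral>\<^sup>+X. g (matrix_inv X *v b) * ennreal (iw_kernel D S X) \<partial>lebesgue_sym) =
      ennreal (det S powr ((real CARD('k) + 1 - D) / 2)) * iw_mass D (mat 1 :: real^'k^'k) *
      (\<integral>\<^sup>+s. (\<integral>\<^sup>+y. ennreal (std_gauss y) * g (s *\<^sub>R (V *v b) + sqrt s *\<^sub>R (K *v y)) \<partial>lborel)
         * ennreal (chi_square_density (D - real CARD('k) - 1) s) \<partial>lborel)"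
    using iw_vector_law[OF S D chi, of b, folded V_def] by blast
  define Y where "Y = (b \<bullet> (V *v b)) *\<^sub>R (L ** V ** transpose L) - L ** outer (V *v b) (V *v b) ** transpose L"
  have LK: "(L ** K) ** transpose (L ** K) = Y"
  proof -
    have "(L ** K) ** transpose (L ** K) = L ** (K ** transpose K) ** transpose L"
      by (simp add: matrix_transpose_mul matrix_mul_assoc)
    then show ?thesis unfolding K(1) Y_def
      by (simp add: matrix_sub_ldistrib matrix_sub_rdistrib matrix_mul_scaleR_right matrix_mul_scaleR_left)
  qed
  have psd: "pos_semidef Y" unfolding LK[symmetric] by (simp add: pos_semidef_def matrix_transpose_mul
        matrix_vector_mul_assoc[symmetric] inner_mult_transpose[of _ L] inner_mult_transpose[of _ K] matrix_mul_assoc)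
  have Ysq: "matrix_sqrt Y ** transpose (matrix_sqrt Y) = Y"
    using pos_semidef_matrix_sqrt[OF psd] matrix_sqrt_square[OF psd] by (simp add: pos_semidef_def)
  have eq: "(L ** K) ** transpose (L ** K) = matrix_sqrt Y ** transpose (matrix_sqrt Y)" unfolding LK Ysq ..
  have gm: "(\<lambda>x. g (L *v (C *\<^sub>R x))) \<in> borel_measurable borel" by measurable
  have "(\<integral>\<^sup>+X. g (L *v weights C r \<mu> X) * ennreal (iw_kernel D S X) \<partial>lebesgue_sym) =
    ennreal (det S powr ((real CARD('k) + 1 - D) / 2)) * iw_mass D (mat 1 :: real^'k^'k) *
    (\<integral>\<^sup>+s. (\<integral>\<^sup>+y. ennreal (std_gauss y) * g (L *v (C *\<^sub>R (s *\<^sub>R (V *v b) + sqrt s *\<^sub>R (K *v y)))) \<partial>lborel)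
         * ennreal (chi_square_density (D - real CARD('k) - 1) s) \<partial>lborel)"
    unfolding weights_def b_def[symmetric] by (rule bspec[OF K(2) gm])
  also have "(\<lambda>s. \<integral>\<^sup>+y. ennreal (std_gauss y) * g (L *v (C *\<^sub>R (s *\<^sub>R (V *v b) + sqrt s *\<^sub>R (K *v y)))) \<partial>lborel) =
    (\<lambda>s. \<integral>\<^sup>+z. ennreal (std_gauss z) * g (weights_rep C L (b \<bullet> (V *v b)) (V *v b) V z s) \<partial>lborel)"
  proof
    fix s :: real
    let ?h = "\<lambda>x. g ((C * s) *\<^sub>R (L *v (V *v b)) + (C * sqrt s) *\<^sub>R x)"
    have hm: "?h \<in> borel_measurable borel" by measurable
    have "L *v (C *\<^sub>R (s *\<^sub>R (V *v b) + sqrt s *\<^sub>R (K *v y))) = (C * s) *\<^sub>R (L *v (V *v b)) + (C * sqrt s) *\<^sub>R ((L ** K) *v y)" for y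
      by (simp add: matrix_vector_mult_scaleR matrix_vector_right_distrib scaleR_add_right matrix_vector_mul_assoc[symmetric])
    then have "(\<integral>\<^sup>+y. ennreal (std_gauss y) * g (L *v (C *\<^sub>R (s *\<^sub>R (V *v b) + sqrt s *\<^sub>R (K *v y)))) \<partial>lborel) =
       (\<integral>\<^sup>+y. ennreal (std_gauss y) * ?h ((L ** K) *v y) \<partial>lborel)" by simp
    also have "\<dots> = (\<integral>\<^sup>+z. ennreal (std_gauss z) * ?h (matrix_sqrt Y *v z) \<partial>lborel)"
      by (rule nn_integral_gauss_linear_image[OF eq hm])
    also have "\<dots> = (\<integral>\<^sup>+z. ennreal (std_gauss z) * g (weights_rep C L (b \<bullet> (V *v b)) (V *v b) V z s) \<partial>lborel)"
      unfolding weights_rep_def Y_def ..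
    finally show "(\<integral>\<^sup>+y. ennreal (std_gauss y) * g (L *v (C *\<^sub>R (s *\<^sub>R (V *v b) + sqrt s *\<^sub>R (K *v y)))) \<partial>lborel) =
       (\<integral>\<^sup>+z. ennreal (std_gauss z) * g (weights_rep C L (b \<bullet> (V *v b)) (V *v b) V z s) \<partial>lborel)" .
  qed
  finally show ?thesis unfolding b_def V_def .
qed

text \<open>A law that is known up to a finite nonzero factor is known after normalization.\<close>

lemma distr_normalized_eq:
  assumes M: "prob_space M" and f: "f \<in> measurable U borel" and h: "h \<in> borel_measurable M"
    and c: "c \<noteq> 0" "c \<noteq> \<infinity>"
    and eq: "\<And>g. g \<in> borel_measurable borel \<Longrightarrow> (\<integral>\<^sup>+p. g (f p) \<partial>U) = c * (\<integral>\<^sup>+\<omega>. g (h \<omega>) \<partial>M)"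
  shows "distr (normalized U) borel f = distr M borel h"
proof (rule measure_eqI)
  fix A assume "A \<in> sets (distr (normalized U) borel f)"
  then have A: "A \<in> sets borel" by simp
  have f': "f \<in> measurable (normalized U) borel" using f by (simp add: normalized_def cong: measurable_cong_sets)
  have e: "emeasure U (f -` B \<inter> space U) = c * emeasure M (h -` B \<inter> space M)" if B: "B \<in> sets borel" for B
  proof -
    have "(\<integral>\<^sup>+p. indicator B (f p) \<partial>U) = c * (\<integral>\<^sup>+\<omega>. indicator B (h \<omega>) \<partial>M)" using B by (intro eq) simp
    moreover have "(\<integral>\<^sup>+p. indicator B (f p) \<partial>U) = emeasure U (f -` B \<inter> space U)"
    proof -
      have "(\<integral>\<^sup>+p. indicator B (f p) \<partial>U) = (\<integral>\<^sup>+p. indicator (f -` B \<inter> space U) p \<partial>U)"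
        by (rule nn_integral_cong) (simp add: indicator_def)
      then show ?thesis using measurable_sets[OF f B] by simp
    qed
    moreover have "(\<integral>\<^sup>+\<omega>. indicator B (h \<omega>) \<partial>M) = emeasure M (h -` B \<inter> space M)"
    proof -
      have "(\<integral>\<^sup>+\<omega>. indicator B (h \<omega>) \<partial>M) = (\<integral>\<^sup>+\<omega>. indicator (h -` B \<inter> space M) \<omega> \<partial>M)"
        by (rule nn_integral_cong) (simp add: indicator_def)
      then show ?thesis using measurable_sets[OF h B] by simp
    qed
    ultimately show ?thesis by simp
  qed
  have sp: "emeasure U (space U) = c"
    using e[of UNIV] prob_space.emeasure_space_1[OF M] by simp
  have "emeasure (distr (normalized U) borel f) A = (1 / c) * emeasure U (f -` A \<inter> space U)"
    using emeasure_distr[OF f' A] by (simp add: normalized_def sp space_scale_measure)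
  also have "\<dots> = (1 / c) * (c * emeasure M (h -` A \<inter> space M))" by (simp only: e[OF A])
  also have "\<dots> = (1 / c * c) * emeasure M (h -` A \<inter> space M)" by (simp only: mult.assoc)
  also have "1 / c * c = 1"
    using c by (metis ennreal_divide_times ennreal_divide_self infinity_ennreal_def mult_1 top.not_eq_extremum)
  finally show "emeasure (distr (normalized U) borel f) A = emeasure (distr M borel h) A"
    using emeasure_distr[OF h A] by simp
qed simp

text \<open>The common core of both cases: only the parameters \<open>m\<close>, \<open>S\<close>, \<open>N\<close> and \<open>D\<close> of the joint density differ.\<close>

theorem weights_law_of_joint_kernel:
  fixes L :: "real^'k^'p" and S :: "real^'k^'k" and m :: "real^'k"
    and U :: "((real^'k) \<times> (real^'k^'k)) measure" and u :: "'w \<Rightarrow> real^'k"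
  assumes S: "pos_def S" and N: "N > 0" and D: "D > 2 * real CARD('k) + 1"
    and dv: "driving_variables M (D - real CARD('k) - 1) (D - 2 * real CARD('k) - 1) \<eta> z0 Q u"
    and U: "sets U = sets (borel \<Otimes>\<^sub>M borel)" and c: "c > 0"
    and dens: "\<And>F. F \<in> borel_measurable (borel \<Otimes>\<^sub>M borel) \<Longrightarrow> (\<integral>\<^sup>+p. F p \<partial>U) =
      ennreal c * (\<integral>\<^sup>+\<mu>. \<integral>\<^sup>+X. F (\<mu>, X) * ennreal (iw_kernel D (S + N *\<^sub>R outer (\<mu> - m) (\<mu> - m)) X) \<partial>lebesgue_sym \<partial>lborel)"
  defines "\<nu> \<equiv> D - 2 * real CARD('k) - 1"
  shows "distr (normalized U) borel (\<lambda>(\<mu>, X). L *v weights C r \<mu> X) =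
    distr M borel (\<lambda>\<omega>. weights_rep C L (eps_rep m S N \<nu> r (Q \<omega>) (u \<omega>)) (zeta_rep m S N \<nu> r (Q \<omega>) (u \<omega>))
       (Upsilon_rep S \<nu> (Q \<omega>) (u \<omega>)) (z0 \<omega>) (\<eta> \<omega>))"
proof -
  let ?k = "real CARD('k)"
  define \<nu>' where "\<nu>' = D - ?k - 1"
  have \<nu>: "\<nu> > 0" and \<nu>': "D - ?k - 1 > 0" using D by (auto simp: \<nu>_def)
  note chi = driving_variables_chi_square_mass[OF dv]
  have M: "prob_space M" and m: "\<eta> \<in> borel_measurable M" "z0 \<in> borel_measurable M" "Q \<in> borel_measurable M" "u \<in> borel_measurable M"
    using dv by (auto simp: driving_variables_def dest: distributed_measurable)
  note [measurable] = m
  define B where "B = matrix_inv (matrix_sqrt (matrix_inv S))"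
  note R = matrix_sqrt_matrix_inv[OF S, folded B_def]
  have iB: "invertible B" unfolding B_def using R(3) by (rule invertible_matrix_inv)
  have dS: "det S > 0" using det_pos_def[OF S] .
  let ?S = "\<lambda>\<mu>. S + N *\<^sub>R outer (\<mu> - m) (\<mu> - m)"
  have pdS: "pos_def (?S \<mu>)" for \<mu> using S N by (intro pos_def_add_outer) auto
  define \<mu> where "\<mu> y = m + (1 / sqrt N) *\<^sub>R (B *v y)" for y
  define j where "j = \<bar>1 / sqrt N\<bar> ^ DIM(real^'k) * \<bar>det B\<bar>"
  have "det B \<noteq> 0" using iB invertible_det_nz by blast
  then have j: "j > 0" using N by (simp add: j_def)
  have jac: "has_jacobian lborel \<mu> j"
    unfolding \<mu>_def[abs_def] j_def
    by (rule has_jacobian_compose[OF has_jacobian_lborel_affine has_jacobian_lborel_matrix[OF iB]]) (use N in auto)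
  have detS: "det (?S (\<mu> y)) = det S * (1 + (norm y)\<^sup>2)" for y
  proof -
    have "N *\<^sub>R outer (\<mu> y - m) (\<mu> y - m) = (N * (1 / sqrt N * (1 / sqrt N))) *\<^sub>R outer (B *v y) (B *v y)"
      by (simp add: \<mu>_def outer_def vec_eq_iff)
    also have "N * (1 / sqrt N * (1 / sqrt N)) = 1" using N by simp
    finally have "?S (\<mu> y) = B ** (mat 1 + outer y y) ** B"
      by (simp add: matrix_add_ldistrib matrix_add_rdistrib R(4,5) matrix_mul_outer outer_matrix_mul)
    then have "det (?S (\<mu> y)) = det (B ** B) * det (mat 1 + outer y y)" by (simp add: det_mul)
    then show ?thesis by (simp add: R(4) det_mat_1_plus_outer dot_square_norm)
  qed
  obtain z where z: "iw_mass D (mat 1 :: real^'k^'k) = ennreal z" "z > 0"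
    using iw_mass_finite[of D, where 'n = 'k] iw_mass_nonzero[of D, where 'n = 'k] D
    by (cases "iw_mass D (mat 1 :: real^'k^'k)") (auto simp: less_le)
  (* The constant that relates the Student density of the standardized location to F and the sphere. *)
  obtain c2 where c2: "c2 > 0"
    "\<And>H. H \<in> borel_measurable borel \<Longrightarrow>
       (\<integral>\<^sup>+y. H y * ennreal ((1 + (norm (y :: real^'k))\<^sup>2) powr (- (?k + \<nu>) / 2)) \<partial>lborel) =
       ennreal c2 * (\<integral>\<^sup>+u. (\<integral>\<^sup>+Q. H (sqrt (?k * Q / \<nu>) *\<^sub>R u) * ennreal (F_density ?k \<nu> Q) \<partial>lborel) \<partial>uniform_sphere)"
    using nn_integral_student_polar[OF \<nu>, where 'n = 'k] by blast
  define e where "e = (?k + 1 - D) / 2"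
  have e: "e = - (?k + \<nu>) / 2" by (simp add: e_def \<nu>_def)
  define K where "K = c * (j * (z * det S powr e * c2))"
  have K: "K > 0" using c j z(2) dS c2(1) by (simp add: K_def)
  let ?rep = "\<lambda>\<omega>. weights_rep C L (eps_rep m S N \<nu> r (Q \<omega>) (u \<omega>)) (zeta_rep m S N \<nu> r (Q \<omega>) (u \<omega>))
       (Upsilon_rep S \<nu> (Q \<omega>) (u \<omega>)) (z0 \<omega>) (\<eta> \<omega>)"
  have "(\<lambda>p. L *v weights C r (fst p) (snd p)) \<in> measurable (borel \<Otimes>\<^sub>M borel) borel"
    unfolding weights_def by measurable
  then have fm: "(\<lambda>(\<mu>, X). L *v weights C r \<mu> X) \<in> measurable (borel \<Otimes>\<^sub>M borel) borel"
    by (simp add: case_prod_beta)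
  show ?thesis
  proof (rule distr_normalized_eq[OF M _ _ _ _ , where c = "ennreal K"])
    show "(\<lambda>(\<mu>, X). L *v weights C r \<mu> X) \<in> measurable U borel"
      using fm by (simp cong: measurable_cong_sets add: U)
    show "?rep \<in> borel_measurable M" by measurable
    show "ennreal K \<noteq> 0" "ennreal K \<noteq> \<infinity>" using K by auto
    fix g :: "real^'p \<Rightarrow> ennreal" assume g [measurable]: "g \<in> borel_measurable borel"
    define \<Gamma> where "\<Gamma> \<epsilon> \<zeta> \<Upsilon> = (\<integral>\<^sup>+s. (\<integral>\<^sup>+z. ennreal (std_gauss z) * g (weights_rep C L \<epsilon> \<zeta> \<Upsilon> z s) \<partial>lborel)
      * ennreal (chi_square_density (D - ?k - 1) s) \<partial>lborel)" for \<epsilon> and \<zeta> :: "real^'k" and \<Upsilon>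
    have [measurable]: "(\<lambda>x. \<Gamma> (a x) (b x) (d x)) \<in> borel_measurable A"
      if [measurable]: "a \<in> borel_measurable A" "b \<in> borel_measurable A" "d \<in> borel_measurable A" for a b d and A :: "'z measure"
      unfolding \<Gamma>_def by measurable
    have [measurable]: "\<mu> \<in> borel_measurable borel" unfolding \<mu>_def[abs_def] by measurable
    let ?V = "\<lambda>\<mu>. matrix_inv (?S \<mu>)"
    let ?b = "\<lambda>\<mu>. \<mu> - r *\<^sub>R (1 :: real^'k)"
    define H where "H y = \<Gamma> (?b (\<mu> y) \<bullet> (?V (\<mu> y) *v ?b (\<mu> y))) (?V (\<mu> y) *v ?b (\<mu> y)) (?V (\<mu> y))" for y
    have Hm [measurable]: "H \<in> borel_measurable borel" unfolding H_def[abs_def] by measurable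
    have gf: "(\<lambda>p. g ((\<lambda>(\<mu>, X). L *v weights C r \<mu> X) p)) \<in> borel_measurable (borel \<Otimes>\<^sub>M borel)"
      using fm by measurable
    have "(\<integral>\<^sup>+p. g ((\<lambda>(\<mu>, X). L *v weights C r \<mu> X) p) \<partial>U) = ennreal c *
       (\<integral>\<^sup>+\<mu>. \<integral>\<^sup>+X. g (L *v weights C r \<mu> X) * ennreal (iw_kernel D (?S \<mu>) X) \<partial>lebesgue_sym \<partial>lborel)"
      using dens[OF gf] by simp
    also have "(\<integral>\<^sup>+\<mu>. \<integral>\<^sup>+X. g (L *v weights C r \<mu> X) * ennreal (iw_kernel D (?S \<mu>) X) \<partial>lebesgue_sym \<partial>lborel) =
       (\<integral>\<^sup>+\<mu>. ennreal (det (?S \<mu>) powr e) * ennreal z * \<Gamma> (?b \<mu> \<bullet> (?V \<mu> *v ?b \<mu>)) (?V \<mu> *v ?b \<mu>) (?V \<mu>) \<partial>lborel)"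
    proof (rule nn_integral_cong)
      fix \<mu> :: "real^'k"
      show "(\<integral>\<^sup>+X. g (L *v weights C r \<mu> X) * ennreal (iw_kernel D (?S \<mu>) X) \<partial>lebesgue_sym) =
        ennreal (det (?S \<mu>) powr e) * ennreal z * \<Gamma> (?b \<mu> \<bullet> (?V \<mu> *v ?b \<mu>)) (?V \<mu> *v ?b \<mu>) (?V \<mu>)"
        unfolding \<Gamma>_def e_def z(1)[symmetric] by (rule weights_given_location[OF pdS \<nu>' chi g])
    qed
    also have "\<dots> = ennreal j * (\<integral>\<^sup>+y. ennreal (det (?S (\<mu> y)) powr e) * ennreal z * H y \<partial>lborel)"
    proof -
      have "(\<lambda>\<mu>. ennreal (det (?S \<mu>) powr e) * ennreal z * \<Gamma> (?b \<mu> \<bullet> (?V \<mu> *v ?b \<mu>)) (?V \<mu> *v ?b \<mu>) (?V \<mu>))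
        \<in> borel_measurable borel" by measurable
      from has_jacobianD[OF jac this] show ?thesis unfolding H_def .
    qed
    also have "(\<integral>\<^sup>+y. ennreal (det (?S (\<mu> y)) powr e) * ennreal z * H y \<partial>lborel) =
       (\<integral>\<^sup>+y. ennreal (z * det S powr e) * (H y * ennreal ((1 + (norm y)\<^sup>2) powr (- (?k + \<nu>) / 2))) \<partial>lborel)"
    proof (rule nn_integral_cong)
      fix y :: "real^'k"
      have "det (?S (\<mu> y)) powr e = det S powr e * (1 + (norm y)\<^sup>2) powr (- (?k + \<nu>) / 2)"
        unfolding detS e by (rule powr_mult)
      then have "ennreal (det (?S (\<mu> y)) powr e) = ennreal (det S powr e) * ennreal ((1 + (norm y)\<^sup>2) powr (- (?k + \<nu>) / 2))"
        by (simp only: ennreal_mult'' powr_ge_zero)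
      moreover have "ennreal (z * det S powr e) = ennreal z * ennreal (det S powr e)"
        by (simp only: ennreal_mult'' powr_ge_zero)
      ultimately show "ennreal (det (?S (\<mu> y)) powr e) * ennreal z * H y =
         ennreal (z * det S powr e) * (H y * ennreal ((1 + (norm y)\<^sup>2) powr (- (?k + \<nu>) / 2)))" by (simp only: mult_ac)
    qed
    also have "\<dots> = ennreal (z * det S powr e) * (\<integral>\<^sup>+y. H y * ennreal ((1 + (norm y)\<^sup>2) powr (- (?k + \<nu>) / 2)) \<partial>lborel)"
      by (rule nn_integral_cmult) measurable
    also have "(\<integral>\<^sup>+y. H y * ennreal ((1 + (norm y)\<^sup>2) powr (- (?k + \<nu>) / 2)) \<partial>lborel) =
       ennreal c2 * (\<integral>\<^sup>+u. (\<integral>\<^sup>+Q. H (sqrt (?k * Q / \<nu>) *\<^sub>R u) * ennreal (F_density ?k \<nu> Q) \<partial>lborel) \<partial>uniform_sphere)"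
      by (rule c2(2)[OF Hm])
    also have "(\<integral>\<^sup>+u. (\<integral>\<^sup>+Q. H (sqrt (?k * Q / \<nu>) *\<^sub>R u) * ennreal (F_density ?k \<nu> Q) \<partial>lborel) \<partial>uniform_sphere) =
       (\<integral>\<^sup>+u. (\<integral>\<^sup>+Q. \<Gamma> (eps_rep m S N \<nu> r Q u) (zeta_rep m S N \<nu> r Q u) (Upsilon_rep S \<nu> Q u) * ennreal (F_density ?k \<nu> Q) \<partial>lborel) \<partial>uniform_sphere)"
    proof (rule nn_integral_cong_AE, rule eventually_mono[OF AE_uniform_sphere_norm], rule nn_integral_cong)
      fix u :: "real^'k" and Q :: real assume u: "norm u = 1"
      show "H (sqrt (?k * Q / \<nu>) *\<^sub>R u) * ennreal (F_density ?k \<nu> Q) =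
         \<Gamma> (eps_rep m S N \<nu> r Q u) (zeta_rep m S N \<nu> r Q u) (Upsilon_rep S \<nu> Q u) * ennreal (F_density ?k \<nu> Q)"
      proof (cases "Q \<ge> 0")
        case True
        note id = rep_identities[OF S N u True \<nu>, of m, folded B_def \<mu>_def]
        show ?thesis unfolding H_def \<mu>_def id(3) unfolding id(2) unfolding id(1) ..
      qed (simp add: F_density_def)
    qed
    also have "\<dots> = (\<integral>\<^sup>+\<omega>. g (?rep \<omega>) \<partial>M)"
    proof -
      let ?G = "\<lambda>(u, Q, s, z). g (weights_rep C L (eps_rep m S N \<nu> r Q u) (zeta_rep m S N \<nu> r Q u) (Upsilon_rep S \<nu> Q u) z s)"
      have "?G \<in> borel_measurable (borel \<Otimes>\<^sub>M (borel \<Otimes>\<^sub>M (borel \<Otimes>\<^sub>M borel)))" by measurable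
      then have Gm: "?G \<in> borel_measurable borel" unfolding borel_prod .
      show ?thesis using driving_variables_nn_integral[OF dv Gm] unfolding \<Gamma>_def \<nu>_def by simp
    qed
    finally show "(\<integral>\<^sup>+p. g ((\<lambda>(\<mu>, X). L *v weights C r \<mu> X) p) \<partial>U) = ennreal K * (\<integral>\<^sup>+\<omega>. g (?rep \<omega>) \<partial>M)"
      using c j z(2) c2(1) dS unfolding K_def
      by (simp only: ennreal_mult' less_imp_le mult.assoc mult_nonneg_nonneg powr_ge_zero)
  qed
qed

section \<open>Almost sure positive definiteness of the scatter matrix\<close>

lemma emeasure_hyperplane:
  fixes w :: "'a::euclidean_space"
  assumes "w \<noteq> 0" shows "emeasure lborel {y. y \<bullet> w = c} = 0"
proof -
  have "negligible {y. w \<bullet> y = c}" using assms by (intro negligible_hyperplane) auto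
  then have "{y. w \<bullet> y = c} \<in> null_sets lebesgue" by (simp add: negligible_iff_null_sets)
  moreover have "{y. w \<bullet> y = c} \<in> sets lborel" by measurable
  ultimately show ?thesis by (simp add: null_sets_def inner_commute)
qed

text \<open>If the factors of a product measure do not charge affine hyperplanes, then the differences of \<open>k + 1\<close>
  coordinates are almost surely linearly independent. Replacing the rows of the identity matrix one after
  the other by these differences, the determinant stays nonzero: it is a nonzero linear functional of the
  new row, which therefore vanishes on an affine hyperplane only.\<close>

lemma AE_PiM_det_differences:
  fixes N :: "'i \<Rightarrow> (real^'k) measure" and \<sigma> :: "'k \<Rightarrow> 'i"
  assumes I: "finite I" and \<sigma>: "inj \<sigma>" "range \<sigma> \<subseteq> I" and i0: "i0 \<in> I" "i0 \<notin> range \<sigma>"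
    and sf: "\<And>i. sigma_finite_measure (N i)" and sets: "\<And>i. sets (N i) = sets borel"
    and hyp: "\<And>i w c. w \<noteq> 0 \<Longrightarrow> emeasure (N i) {y. y \<bullet> w = c} = 0"
  shows "AE x in PiM I N. det (\<chi> j. x (\<sigma> j) - x i0) \<noteq> 0"
proof -
  interpret product_sigma_finite N using sf by (simp add: product_sigma_finite_def)
  note [measurable_cong] = sets
  define A where "A J x = (\<chi> j. if j \<in> J then x (\<sigma> j) - x i0 else axis j 1)" for J and x :: "'i \<Rightarrow> real^'k"
  have comp: "(\<lambda>x. x i) \<in> borel_measurable (PiM I' N)" if "i \<in> I'" for i I'
    using measurable_component_singleton[OF that, of N] sets[of i] by (simp cong: measurable_cong_sets)
  have \<sigma>I: "\<sigma> j \<in> I" for j using \<sigma>(2) by auto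
  have [measurable]: "A J \<in> borel_measurable (PiM I N)" for J
  proof -
    have "(\<lambda>x. (if j \<in> J then x (\<sigma> j) - x i0 else axis j 1) :: real^'k) \<in> borel_measurable (PiM I N)" for j
      using comp[OF \<sigma>I[of j]] comp[OF i0(1)] by (cases "j \<in> J") auto
    then show ?thesis unfolding A_def[abs_def] by measurable
  qed
  have "AE x in PiM I N. det (A J x) \<noteq> 0" for J :: "'k set"
    using finite[of J]
  proof (induction J)
    case empty
    have "A {} x = mat 1" for x by (simp add: A_def vec_eq_iff mat_def axis_def)
    then show ?case by simp
  next
    case (insert j J)
    let ?i = "\<sigma> j" and ?I = "I - {\<sigma> j}"
    have Ii: "insert ?i ?I = I" using \<sigma>I by auto
    let ?bad = "{x \<in> space (PiM I N). det (A J x) \<noteq> 0 \<and> det (A (insert j J) x) = 0}"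
    have bm: "?bad \<in> sets (PiM I N)" by measurable
    have "emeasure (PiM I N) ?bad = (\<integral>\<^sup>+x. indicator ?bad x \<partial>PiM I N)" using bm by simp
    also have "\<dots> = (\<integral>\<^sup>+x. (\<integral>\<^sup>+y. indicator ?bad (x(?i := y)) \<partial>N ?i) \<partial>PiM ?I N)"
      using product_nn_integral_insert[of ?I ?i "indicator ?bad"] I bm Ii by simp
    also have "\<dots> = (\<integral>\<^sup>+x. 0 \<partial>PiM ?I N)"
    proof (rule nn_integral_cong)
      fix x :: "'i \<Rightarrow> real^'k"
      define f where "f v = det (\<chi> j'. if j' = j then v else A J x $ j')" for v :: "real^'k"
      have lin: "linear f"
      proof (rule linearI)
        show "f (a + b) = f a + f b" for a b unfolding f_def by (rule det_row_add)
        show "f (c *\<^sub>R a) = c *\<^sub>R f a" for c a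
        proof -
          have e: "c *s a = c *\<^sub>R a" by (simp add: vec_eq_iff)
          show ?thesis using det_row_mul[of j c "\<lambda>_. a" "\<lambda>j'. A J x $ j'"] unfolding f_def e real_scaleR_def .
        qed
      qed
      define w where "w = adjoint f 1"
      have fw: "f v = v \<bullet> w" for v using adjoint_works[OF lin, of v 1] by (simp add: w_def)
      have upd1: "A J (x(?i := y)) = A J x" for y
        using insert.hyps(2) i0(2) \<sigma>(1) by (auto simp: A_def vec_eq_iff inj_eq)
      have upd2: "det (A (insert j J) (x(?i := y))) = f (y - x i0)" for y
        unfolding f_def using insert.hyps(2) i0(2) \<sigma>(1)
        by (intro arg_cong[of _ _ det]) (auto simp: A_def vec_eq_iff inj_eq)
      show "(\<integral>\<^sup>+y. indicator ?bad (x(?i := y)) \<partial>N ?i) = 0"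
      proof (cases "det (A J x) = 0")
        case True
        then have "indicator ?bad (x(?i := y)) = (0 :: ennreal)" for y by (simp add: indicator_def upd1)
        then show ?thesis by simp
      next
        case False
        have "f (axis j 1) = det (A J x)"
          unfolding f_def using insert.hyps(2) by (intro arg_cong[of _ _ det]) (auto simp: A_def vec_eq_iff)
        then have "w \<noteq> 0" using False fw by auto
        have "(\<integral>\<^sup>+y. indicator ?bad (x(?i := y)) \<partial>N ?i) \<le> (\<integral>\<^sup>+y. indicator {y. y \<bullet> w = x i0 \<bullet> w} y \<partial>N ?i)"
          by (intro nn_integral_mono) (auto simp: indicator_def upd2 fw inner_diff_left)
        also have "\<dots> = emeasure (N ?i) {y. y \<bullet> w = x i0 \<bullet> w}"
          by (rule nn_integral_indicator) (simp add: sets)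
        also have "\<dots> = 0" using hyp[OF \<open>w \<noteq> 0\<close>] .
        finally show ?thesis by simp
      qed
    qed
    finally have "emeasure (PiM I N) ?bad = 0" by simp
    then have "AE x in PiM I N. \<not> (det (A J x) \<noteq> 0 \<and> det (A (insert j J) x) = 0)"
      using bm by (subst AE_iff_measurable[OF _ refl]) auto
    with insert.IH show ?case by eventually_elim blast
  qed
  from this[of UNIV] show ?thesis by (simp add: A_def)
qed

lemma finite_window [simp]: "finite (window t n)"
  by (simp add: window_def)

lemma card_window [simp]: "card (window t n) = n"
  by (simp add: window_def)

lemma S_diffuse_eq:
  assumes "n \<ge> 2"
  shows "S_diffuse t n x = (\<Sum>i\<in>window t n. outer (x i - sample_mean t n x) (x i - sample_mean t n x))"
  using assms by (simp add: S_diffuse_def sample_cov_def)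

lemma sum_matrix_vector_mult: "(\<Sum>i\<in>I. A i) *v v = (\<Sum>i\<in>I. (A i :: real^'n^'m) *v v)"
  by (induction I rule: infinite_finite_induct) (simp_all add: matrix_vector_mult_add_rdistrib)

lemma trace_sum_mul: "trace ((\<Sum>i\<in>I. A i) ** B) = (\<Sum>i\<in>I. trace (A i ** (B :: real^'n^'n)))"
proof (induction I rule: infinite_finite_induct)
  case (insert a F)
  then show ?case by (simp add: matrix_add_rdistrib trace_add)
qed (simp_all add: trace_def matrix_matrix_mult_def)

lemma transpose_sum: "transpose (\<Sum>i\<in>I. A i) = (\<Sum>i\<in>I. transpose (A i :: real^'n^'m))"
  by (induction I rule: infinite_finite_induct) (simp_all add: transpose_add, simp_all add: transpose_def vec_eq_iff)

lemma S_diffuse_quadratic: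
  assumes "n \<ge> 2"
  shows "v \<bullet> (S_diffuse t n x *v v) = (\<Sum>i\<in>window t n. (v \<bullet> (x i - sample_mean t n x))\<^sup>2)"
  by (simp add: S_diffuse_eq[OF assms] sum_matrix_vector_mult inner_sum_right outer_mult_vec power2_eq_square inner_commute)

lemma S_diffuse_symmetric: "n \<ge> 2 \<Longrightarrow> transpose (S_diffuse t n x) = S_diffuse t n x"
  by (simp add: S_diffuse_eq transpose_sum transpose_outer)

text \<open>A vector in the kernel of the scatter matrix is orthogonal to all deviations from the mean, hence to all
  differences of observations.\<close>

lemma pos_def_S_diffuse_if_det:
  fixes x :: "int \<Rightarrow> real^'k"
  assumes n: "n \<ge> 2" and \<sigma>: "range \<sigma> \<subseteq> window t n" and i0: "i0 \<in> window t n"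
    and det: "det (\<chi> j :: 'k. x (\<sigma> j) - x i0) \<noteq> 0"
  shows "pos_def (S_diffuse t n x)"
  unfolding pos_def_def
proof safe
  show "transpose (S_diffuse t n x) = S_diffuse t n x" by (rule S_diffuse_symmetric[OF n])
  fix v :: "real^'k" assume v: "v \<noteq> 0"
  let ?q = "\<lambda>i. (v \<bullet> (x i - sample_mean t n x))\<^sup>2"
  have "(\<Sum>i\<in>window t n. ?q i) \<noteq> 0"
  proof
    assume "(\<Sum>i\<in>window t n. ?q i) = 0"
    then have 0: "v \<bullet> x i = v \<bullet> sample_mean t n x" if "i \<in> window t n" for i
      using that by (simp add: sum_nonneg_eq_0_iff inner_diff_right)
    have "(x (\<sigma> j) - x i0) \<bullet> v = 0" for j
    proof -
      have "\<sigma> j \<in> window t n" using \<sigma> by auto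
      then show ?thesis using 0[of "\<sigma> j"] 0[OF i0] by (simp add: inner_commute[of _ v] inner_diff_right)
    qed
    then have "(\<chi> j. x (\<sigma> j) - x i0) *v v = 0"
      by (simp add: matrix_vector_mult_def inner_vec_def vec_eq_iff)
    moreover have "invertible (\<chi> j. x (\<sigma> j) - x i0)" using det invertible_det_nz by blast
    ultimately show False using v
      by (metis matrix_inv_left matrix_vector_mul_assoc matrix_vector_mul_lid matrix_vector_mult_0_right)
  qed
  moreover have "(\<Sum>i\<in>window t n. ?q i) \<ge> 0" by (intro sum_nonneg) simp
  ultimately show "0 < v \<bullet> (S_diffuse t n x *v v)" by (simp add: S_diffuse_quadratic[OF n])
qed

theorem AE_pos_def_S_diffuse:
  fixes \<mu> :: "real^'k"
  assumes n: "CARD('k) < n" and \<Sigma>: "pos_def \<Sigma>"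
  shows "AE x in sampling_law t n \<mu> \<Sigma>. pos_def (S_diffuse t n x)"
proof -
  let ?N = "density lborel (\<lambda>y. ennreal (mvn_density \<mu> \<Sigma> y))"
  have n2: "n \<ge> 2" using n by (metis Suc_1 Suc_leI le_less_trans zero_less_card_finite less_eq_Suc_le One_nat_def order_le_less_trans)
  have fm [measurable]: "mvn_density \<mu> \<Sigma> \<in> borel_measurable borel" unfolding mvn_density_def[abs_def] by measurable
  have sf: "sigma_finite_measure ?N"
    by (subst sigma_finite_measure.sigma_finite_iff_density_finite[OF sigma_finite_lborel]) auto
  have hyp: "emeasure ?N {y. y \<bullet> w = c} = 0" if "w \<noteq> 0" for w c
  proof -
    have "{y. y \<bullet> w = c} \<in> null_sets lborel" using emeasure_hyperplane[OF that, of c] by (auto simp: null_sets_def)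
    then have "AE y in lborel. y \<notin> {y. y \<bullet> w = c}" by (rule AE_not_in)
    then have "AE y in ?N. y \<notin> {y. y \<bullet> w = c}" by (subst AE_density) auto
    moreover have "{y. y \<bullet> w = c} \<in> sets ?N" by simp
    ultimately show ?thesis by (subst (asm) AE_iff_measurable[OF _ refl]) auto
  qed
  have "t \<in> window t n" using n by (simp add: window_def)
  have "card (UNIV :: 'k set) \<le> card (window t n - {t})" using n \<open>t \<in> window t n\<close> by simp
  then obtain \<sigma> :: "'k \<Rightarrow> int" where \<sigma>: "range \<sigma> \<subseteq> window t n - {t}" "inj \<sigma>"
    using card_le_inj[of "UNIV :: 'k set" "window t n - {t}"] by auto
  have "AE x in sampling_law t n \<mu> \<Sigma>. det (\<chi> j. x (\<sigma> j) - x t) \<noteq> 0"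
    unfolding sampling_law_def
    by (rule AE_PiM_det_differences) (use \<sigma> \<open>t \<in> window t n\<close> sf hyp in auto)
  then show ?thesis
    by eventually_elim (rule pos_def_S_diffuse_if_det[OF n2 _ \<open>t \<in> window t n\<close>], use \<sigma> in auto)
qed

section \<open>The posterior density\<close>

text \<open>Expanding around the sample mean, the cross terms cancel.\<close>

lemma likelihood_eq:
  fixes \<mu> :: "real^'k"
  assumes \<Sigma>: "pos_def \<Sigma>" and n: "n \<ge> 2"
  shows "likelihood t n x \<mu> \<Sigma> = (1 / sqrt ((2 * pi) ^ CARD('k))) ^ n * det \<Sigma> powr (- real n / 2) *
    exp (- (1/2) * trace ((S_diffuse t n x + real n *\<^sub>R outer (\<mu> - sample_mean t n x) (\<mu> - sample_mean t n x)) ** matrix_inv \<Sigma>))"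
proof -
  let ?W = "window t n" and ?m = "sample_mean t n x" and ?V = "matrix_inv \<Sigma>"
  have d: "det \<Sigma> > 0" using det_pos_def[OF \<Sigma>] .
  have Vs: "transpose ?V = ?V" using pos_def_matrix_inv[OF \<Sigma>] by (simp add: pos_def_def)
  have sum0: "(\<Sum>i\<in>?W. x i - ?m) = 0"
    using n by (simp add: sum_subtractf sample_mean_def sum_constant_scaleR del: sum_constant)
  have "(\<Sum>i\<in>?W. (x i - \<mu>) \<bullet> (?V *v (x i - \<mu>))) =
     (\<Sum>i\<in>?W. (x i - ?m) \<bullet> (?V *v (x i - ?m)) + 2 * ((x i - ?m) \<bullet> (?V *v (?m - \<mu>))) + (\<mu> - ?m) \<bullet> (?V *v (\<mu> - ?m)))"
  proof (rule sum.cong[OF refl])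
    fix i
    have q: "(a + b) \<bullet> (?V *v (a + b)) = a \<bullet> (?V *v a) + 2 * (a \<bullet> (?V *v b)) + b \<bullet> (?V *v b)" for a b
    proof -
      have "b \<bullet> (?V *v a) = a \<bullet> (?V *v b)" using inner_mult_symmetric[OF Vs, of b a] by (simp add: inner_commute)
      then show ?thesis by (simp add: matrix_vector_right_distrib inner_add_left inner_add_right)
    qed
    have neg: "(?m - \<mu>) \<bullet> (?V *v (?m - \<mu>)) = (\<mu> - ?m) \<bullet> (?V *v (\<mu> - ?m))"
      by (simp add: matrix_vector_mult_diff_distrib inner_diff_left inner_diff_right)
    show "(x i - \<mu>) \<bullet> (?V *v (x i - \<mu>)) =
       (x i - ?m) \<bullet> (?V *v (x i - ?m)) + 2 * ((x i - ?m) \<bullet> (?V *v (?m - \<mu>))) + (\<mu> - ?m) \<bullet> (?V *v (\<mu> - ?m))"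
      using q[of "x i - ?m" "?m - \<mu>"] by (simp add: neg)
  qed
  also have "\<dots> = (\<Sum>i\<in>?W. (x i - ?m) \<bullet> (?V *v (x i - ?m))) + 2 * ((\<Sum>i\<in>?W. x i - ?m) \<bullet> (?V *v (?m - \<mu>))) + real n * ((\<mu> - ?m) \<bullet> (?V *v (\<mu> - ?m)))"
    by (simp add: sum.distrib inner_sum_left sum_distrib_left)
  also have "(\<Sum>i\<in>?W. (x i - ?m) \<bullet> (?V *v (x i - ?m))) = trace (S_diffuse t n x ** ?V)"
    by (simp add: S_diffuse_eq[OF n] trace_sum_mul trace_outer_mul)
  finally have Q: "(\<Sum>i\<in>?W. (x i - \<mu>) \<bullet> (?V *v (x i - \<mu>))) =
      trace ((S_diffuse t n x + real n *\<^sub>R outer (\<mu> - ?m) (\<mu> - ?m)) ** ?V)"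
    by (simp add: sum0 matrix_add_rdistrib trace_add matrix_mul_scaleR_left trace_scaleR trace_outer_mul)
  have "likelihood t n x \<mu> \<Sigma> = (\<Prod>i\<in>?W. exp (- (1/2) * ((x i - \<mu>) \<bullet> (?V *v (x i - \<mu>)))) * (1 / sqrt ((2 * pi) ^ CARD('k)) * det \<Sigma> powr (- 1/2)))"
    unfolding likelihood_def mvn_density_def using d
    by (intro prod.cong) (simp_all add: real_sqrt_mult powr_minus_divide powr_half_sqrt)
  also have "\<dots> = exp (- (1/2) * (\<Sum>i\<in>?W. (x i - \<mu>) \<bullet> (?V *v (x i - \<mu>)))) * ((1 / sqrt ((2 * pi) ^ CARD('k))) ^ n * (det \<Sigma> powr (- 1/2)) ^ n)"
    by (simp only: prod.distrib exp_sum[symmetric] finite_window sum_distrib_left[symmetric] prod_constant card_window power_mult_distrib)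
  also have "(det \<Sigma> powr (- 1/2)) ^ n = det \<Sigma> powr (- real n / 2)"
    using d by (subst powr_realpow[symmetric]) (auto simp: powr_powr)
  finally show ?thesis unfolding Q by (simp add: mult_ac)
qed

lemma sets_prior_space: "sets (lborel \<Otimes>\<^sub>M lebesgue_sym) = sets (borel \<Otimes>\<^sub>M borel)"
  by (rule sets_pair_measure_cong) auto

lemma likelihood_measurable [measurable]:
  "(\<lambda>(\<mu>, \<Sigma>). ennreal (likelihood t n x \<mu> \<Sigma>)) \<in> borel_measurable (borel \<Otimes>\<^sub>M borel)"
  unfolding likelihood_def mvn_density_def case_prod_beta by measurable

theorem diffuse_posterior_density:
  fixes x :: "int \<Rightarrow> real^'k" and F :: "(real^'k) \<times> (real^'k^'k) \<Rightarrow> ennreal"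
  assumes n: "n \<ge> 2" and F [measurable]: "F \<in> borel_measurable (borel \<Otimes>\<^sub>M borel)"
  shows "(\<integral>\<^sup>+p. F p \<partial>density diffuse_prior (\<lambda>(\<mu>, \<Sigma>). ennreal (likelihood t n x \<mu> \<Sigma>))) =
    ennreal ((1 / sqrt ((2 * pi) ^ CARD('k))) ^ n) *
    (\<integral>\<^sup>+\<mu>. \<integral>\<^sup>+X. F (\<mu>, X) * ennreal (iw_kernel (real n + real CARD('k) + 1)
      (S_diffuse t n x + real n *\<^sub>R outer (\<mu> - sample_mean t n x) (\<mu> - sample_mean t n x)) X) \<partial>lebesgue_sym \<partial>lborel)"
proof -
  interpret S: sigma_finite_measure "lebesgue_sym :: (real^'k^'k) measure" by (rule sigma_finite_lebesgue_sym)
  note [measurable_cong] = sets_prior_space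
  let ?c = "(1 / sqrt ((2 * pi) ^ CARD('k))) ^ n"
  let ?K = "\<lambda>\<mu> X. iw_kernel (real n + real CARD('k) + 1) (S_diffuse t n x + real n *\<^sub>R outer (\<mu> - sample_mean t n x) (\<mu> - sample_mean t n x)) X"
  let ?p = "\<lambda>(\<mu> :: real^'k, \<Sigma> :: real^'k^'k). ennreal (if pos_def \<Sigma> then det \<Sigma> powr (- (real CARD('k) + 1)/2) else 0)"
  let ?l = "\<lambda>(\<mu>, \<Sigma>). ennreal (likelihood t n x \<mu> \<Sigma>)"
  have pm [measurable]: "?p \<in> borel_measurable (borel \<Otimes>\<^sub>M borel)" unfolding case_prod_beta by measurable
  have "(\<integral>\<^sup>+p. F p \<partial>density diffuse_prior ?l) = (\<integral>\<^sup>+p. ?p p * (?l p * F p) \<partial>(lborel \<Otimes>\<^sub>M lebesgue_sym))"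
    unfolding diffuse_prior_def
    by (subst nn_integral_density, measurable) (subst nn_integral_density, measurable)
  also have "\<dots> = (\<integral>\<^sup>+\<mu>. \<integral>\<^sup>+X. ?p (\<mu>, X) * (?l (\<mu>, X) * F (\<mu>, X)) \<partial>lebesgue_sym \<partial>lborel)"
    by (rule S.nn_integral_fst[symmetric]) measurable
  also have "\<dots> = (\<integral>\<^sup>+\<mu>. \<integral>\<^sup>+X. ennreal ?c * (F (\<mu>, X) * ennreal (?K \<mu> X)) \<partial>lebesgue_sym \<partial>lborel)"
  proof (intro nn_integral_cong)
    fix \<mu> :: "real^'k" and X :: "real^'k^'k"
    show "?p (\<mu>, X) * (?l (\<mu>, X) * F (\<mu>, X)) = ennreal ?c * (F (\<mu>, X) * ennreal (?K \<mu> X))"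
    proof (cases "pos_def X")
      case True
      have "det X powr (- (real CARD('k) + 1)/2) * likelihood t n x \<mu> X = ?c * ?K \<mu> X"
      proof -
        have "det X powr (- (real CARD('k) + 1)/2) * det X powr (- real n / 2) = det X powr (- (real n + real CARD('k) + 1) / 2)"
        proof -
          have "- (real CARD('k) + 1)/2 + - real n / 2 = - (real n + real CARD('k) + 1) / 2" by (simp add: field_simps)
          then show ?thesis by (simp only: powr_add[symmetric])
        qed
        then show ?thesis unfolding likelihood_eq[OF True n] iw_kernel_def using True by (simp add: mult_ac)
      qed
      then have "ennreal (det X powr (- (real CARD('k) + 1)/2)) * ennreal (likelihood t n x \<mu> X) = ennreal ?c * ennreal (?K \<mu> X)"
        by (simp only: ennreal_mult'[symmetric] ennreal_mult''[symmetric] iw_kernel_nonneg powr_ge_zero)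
      then show ?thesis using True by (simp add: mult.assoc[symmetric]) (simp add: mult_ac)
    qed (simp add: iw_kernel_def)
  qed
  also have "\<dots> = (\<integral>\<^sup>+\<mu>. ennreal ?c * (\<integral>\<^sup>+X. F (\<mu>, X) * ennreal (?K \<mu> X) \<partial>lebesgue_sym) \<partial>lborel)"
    by (intro nn_integral_cong nn_integral_cmult) measurable
  also have "\<dots> = ennreal ?c * (\<integral>\<^sup>+\<mu>. \<integral>\<^sup>+X. F (\<mu>, X) * ennreal (?K \<mu> X) \<partial>lebesgue_sym \<partial>lborel)"
    by (rule nn_integral_cmult) measurable
  finally show ?thesis .
qed

lemma inv_wishart_nn_integral:
  fixes S :: "real^'k^'k"
  assumes S: "pos_def S" and d: "d > 2 * real CARD('k)"
  obtains c where "c > 0" "\<And>h. h \<in> borel_measurable borel \<Longrightarrow>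
    (\<integral>\<^sup>+X. h X \<partial>inv_wishart d S) = ennreal c * (\<integral>\<^sup>+X. h X * ennreal (iw_kernel d S X) \<partial>lebesgue_sym)"
proof -
  have "iw_mass d S \<noteq> 0 \<and> iw_mass d S < \<infinity>"
    using iw_mass_scale[OF S, of d] iw_mass_finite[OF d] iw_mass_nonzero[of d, where 'n = 'k] det_pos_def[OF S]
    by (simp add: ennreal_mult_less_top)
  then obtain z where z: "iw_mass d S = ennreal z" "z > 0"
    by (cases "iw_mass d S") (auto simp: less_le)
  let ?U = "density lebesgue_sym (\<lambda>X. ennreal (iw_kernel d S X))"
  have eq: "inv_wishart d S = normalized ?U" by (simp add: inv_wishart_def iw_kernel_def[abs_def])
  have "emeasure ?U (space ?U) = ennreal z"
    using z(1) by (subst emeasure_density) (auto cong: nn_integral_cong)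
  then have N: "normalized ?U = scale_measure (ennreal (1 / z)) ?U"
    using z(2) by (simp add: normalized_def divide_ennreal[symmetric])
  have "(\<integral>\<^sup>+X. h X \<partial>inv_wishart d S) = ennreal (1 / z) * (\<integral>\<^sup>+X. h X * ennreal (iw_kernel d S X) \<partial>lebesgue_sym)"
    if [measurable]: "h \<in> borel_measurable borel" for h
  proof -
    have "(\<integral>\<^sup>+X. h X \<partial>inv_wishart d S) = ennreal (1 / z) * (\<integral>\<^sup>+X. h X \<partial>?U)"
      unfolding eq N by (rule nn_integral_scale_measure) simp
    also have "(\<integral>\<^sup>+X. h X \<partial>?U) = (\<integral>\<^sup>+X. ennreal (iw_kernel d S X) * h X \<partial>lebesgue_sym)"
      by (rule nn_integral_density) measurable
    finally show ?thesis by (simp add: mult.commute)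
  qed
  then show thesis using that[of "1 / z"] z(2) by simp
qed

lemma sets_inv_wishart [simp, measurable_cong]: "sets (inv_wishart d S) = sets borel"
  by (simp add: inv_wishart_def normalized_def)

text \<open>Completing the square in \<open>\<mu>\<close>. The remainder is the rank-one term in the conjugate scale matrix.\<close>

lemma conjugate_exponent:
  fixes V :: "real^'k^'k" and \<mu> m0 a :: "real^'k"
  assumes V: "transpose V = V" and n: "n + r0 > 0"
  defines "mc \<equiv> (1 / (n + r0)) *\<^sub>R (n *\<^sub>R a + r0 *\<^sub>R m0)"
  shows "n * ((\<mu> - a) \<bullet> (V *v (\<mu> - a))) + r0 * ((\<mu> - m0) \<bullet> (V *v (\<mu> - m0))) =
    (n + r0) * ((\<mu> - mc) \<bullet> (V *v (\<mu> - mc))) + n * r0 / (n + r0) * ((m0 - a) \<bullet> (V *v (m0 - a)))"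
proof -
  define p where "p = \<mu> - a"
  define q where "q = \<mu> - m0"
  have s: "q \<bullet> (V *v p) = p \<bullet> (V *v q)" using inner_mult_symmetric[OF V, of q p] by (simp add: inner_commute)
  have "(n + r0) *\<^sub>R mc = n *\<^sub>R a + r0 *\<^sub>R m0" using n by (simp add: mc_def)
  then have "(n + r0) *\<^sub>R (\<mu> - mc) = n *\<^sub>R p + r0 *\<^sub>R q"
    by (simp add: scaleR_diff_right) (simp add: p_def q_def algebra_simps)
  then have "\<mu> - mc = (1 / (n + r0)) *\<^sub>R (n *\<^sub>R p + r0 *\<^sub>R q)"
    using n by (metis (no_types, lifting) divide_self_if less_numeral_extra(3) mult.commute scaleR_one scaleR_scaleR times_divide_eq_left mult_1)
  then have "(n + r0) * ((\<mu> - mc) \<bullet> (V *v (\<mu> - mc))) =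
     (1 / (n + r0)) * ((n *\<^sub>R p + r0 *\<^sub>R q) \<bullet> (V *v (n *\<^sub>R p + r0 *\<^sub>R q)))"
    using n by (simp add: matrix_vector_mult_scaleR)
  also have "(n *\<^sub>R p + r0 *\<^sub>R q) \<bullet> (V *v (n *\<^sub>R p + r0 *\<^sub>R q)) =
     n * n * (p \<bullet> (V *v p)) + 2 * n * r0 * (p \<bullet> (V *v q)) + r0 * r0 * (q \<bullet> (V *v q))"
    by (simp add: matrix_vector_right_distrib matrix_vector_mult_scaleR inner_add_left inner_add_right s algebra_simps)
  finally have A: "(n + r0) * ((\<mu> - mc) \<bullet> (V *v (\<mu> - mc))) =
    (1 / (n + r0)) * (n * n * (p \<bullet> (V *v p)) + 2 * n * r0 * (p \<bullet> (V *v q)) + r0 * r0 * (q \<bullet> (V *v q)))" .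
  have "m0 - a = p - q" by (simp add: p_def q_def)
  then have B: "(m0 - a) \<bullet> (V *v (m0 - a)) = p \<bullet> (V *v p) - 2 * (p \<bullet> (V *v q)) + q \<bullet> (V *v q)"
    by (simp add: matrix_vector_mult_diff_distrib inner_diff_left inner_diff_right s)
  have id: "n * P + r0 * Q = (1 / (n + r0)) * (n * n * P + 2 * n * r0 * X + r0 * r0 * Q) + n * r0 / (n + r0) * (P - 2 * X + Q)"
    for P Q X :: real
  proof -
    have "(1 / (n + r0)) * (n * n * P + 2 * n * r0 * X + r0 * r0 * Q) + n * r0 / (n + r0) * (P - 2 * X + Q) =
      ((n * n * P + 2 * n * r0 * X + r0 * r0 * Q) + n * r0 * (P - 2 * X + Q)) / (n + r0)"
      by (simp add: add_divide_distrib)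
    also have "(n * n * P + 2 * n * r0 * X + r0 * r0 * Q) + n * r0 * (P - 2 * X + Q) = (n + r0) * (n * P + r0 * Q)"
      by (simp add: algebra_simps)
    finally show ?thesis using n by simp
  qed
  show ?thesis unfolding A B p_def[symmetric] q_def[symmetric] by (rule id)
qed

theorem conjugate_posterior_density:
  fixes x :: "int \<Rightarrow> real^'k" and m0 :: "real^'k"
  assumes n: "n \<ge> 2" and r0: "r0 > 0" and d0: "d0 > 2 * real CARD('k)" and S0: "pos_def S0"
  obtains c where "c > 0" "\<And>F :: (real^'k) \<times> (real^'k^'k) \<Rightarrow> ennreal. F \<in> borel_measurable (borel \<Otimes>\<^sub>M borel) \<Longrightarrow>
    (\<integral>\<^sup>+p. F p \<partial>density (conjugate_prior m0 r0 d0 S0) (\<lambda>(\<mu>, \<Sigma>). ennreal (likelihood t n x \<mu> \<Sigma>))) =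
    ennreal c * (\<integral>\<^sup>+\<mu>. \<integral>\<^sup>+X. F (\<mu>, X) * ennreal (iw_kernel (real n + d0 + 1)
      (S_conj m0 r0 S0 t n x + (real n + r0) *\<^sub>R outer (\<mu> - mean_conj m0 r0 t n x) (\<mu> - mean_conj m0 r0 t n x)) X) \<partial>lebesgue_sym \<partial>lborel)"
proof -
  let ?k = "CARD('k)"
  obtain cw where cw: "cw > 0" "\<And>h. h \<in> borel_measurable borel \<Longrightarrow>
    (\<integral>\<^sup>+X. h X \<partial>inv_wishart d0 S0) = ennreal cw * (\<integral>\<^sup>+X. h X * ennreal (iw_kernel d0 S0 X) \<partial>lebesgue_sym)"
    using inv_wishart_nn_integral[OF S0 d0] by blast
  have "emeasure (inv_wishart d0 S0) (space (inv_wishart d0 S0)) \<noteq> \<infinity>"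
  proof -
    have "emeasure (inv_wishart d0 S0) (space (inv_wishart d0 S0)) = ennreal cw * iw_mass d0 S0"
      using cw(2)[of "\<lambda>_. 1"] by simp
    then show ?thesis
      using iw_mass_scale[OF S0, of d0] iw_mass_finite[OF d0] by (auto simp: ennreal_mult_eq_top_iff)
  qed
  then interpret W: finite_measure "inv_wishart d0 S0" by (rule finite_measureI)
  note [measurable_cong] = sets_pair_measure_cong[OF sets_lborel sets_inv_wishart[of d0 S0]]
  define cl where "cl = (1 / sqrt ((2 * pi) ^ ?k)) ^ n"
  define cm where "cm = 1 / sqrt ((2 * pi) ^ ?k * (1 / r0) ^ ?k)"
  have pos: "cl > 0" "cm > 0" using r0 by (auto simp: cl_def cm_def)
  let ?l = "\<lambda>(\<mu>, \<Sigma>). ennreal (likelihood t n x \<mu> \<Sigma>)"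
  let ?m = "\<lambda>(\<mu>, \<Sigma>). ennreal (mvn_density m0 ((1/r0) *\<^sub>R \<Sigma>) \<mu>)"
  let ?K = "\<lambda>\<mu> X. iw_kernel (real n + d0 + 1)
      (S_conj m0 r0 S0 t n x + (real n + r0) *\<^sub>R outer (\<mu> - mean_conj m0 r0 t n x) (\<mu> - mean_conj m0 r0 t n x)) X"
  have mm [measurable]: "?m \<in> borel_measurable (borel \<Otimes>\<^sub>M borel)" unfolding mvn_density_def case_prod_beta by measurable
  have key: "mvn_density m0 ((1/r0) *\<^sub>R X) \<mu> * likelihood t n x \<mu> X * iw_kernel d0 S0 X = cm * cl * ?K \<mu> X"
    if X: "pos_def X" for \<mu> X
  proof -
    let ?V = "matrix_inv X" and ?a = "sample_mean t n x" and ?mc = "mean_conj m0 r0 t n x"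
    have dX: "det X > 0" using det_pos_def[OF X] .
    have Vs: "transpose ?V = ?V" using pos_def_matrix_inv[OF X] by (simp add: pos_def_def)
    have iV: "matrix_inv ((1/r0) *\<^sub>R X) = r0 *\<^sub>R ?V"
      using r0 matrix_inv_right[OF pos_def_imp_invertible[OF X]]
      by (intro matrix_inv_eqI) (simp add: matrix_mul_scaleR_left matrix_mul_scaleR_right)
    have dr: "det ((1/r0) *\<^sub>R X) = (1/r0) ^ ?k * det X"
    proof -
      have "(1/r0) *\<^sub>R X = diag_matrix (\<lambda>_. 1/r0) ** X"
      proof -
        have "diag_matrix (\<lambda>_. 1/r0) = (1/r0) *\<^sub>R (mat 1 :: real^'k^'k)"
          by (simp add: diag_matrix_def mat_def vec_eq_iff)
        then show ?thesis by (simp add: matrix_mul_scaleR_left)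
      qed
      then show ?thesis by (simp add: det_mul det_diag_matrix)
    qed
    have M: "mvn_density m0 ((1/r0) *\<^sub>R X) \<mu> = cm * det X powr (- 1/2) * exp (- (1/2) * (r0 * ((\<mu> - m0) \<bullet> (?V *v (\<mu> - m0)))))"
      using dX r0 unfolding mvn_density_def iV dr
      by (simp add: cm_def real_sqrt_mult powr_minus_divide powr_half_sqrt scaleR_matrix_vector_assoc[symmetric] mult.assoc)
    have pw: "det X powr (- 1/2) * det X powr (- real n / 2) * det X powr (- d0/2) = det X powr (- (real n + d0 + 1) / 2)"
    proof -
      have "- 1/2 + - real n / 2 + - d0/2 = - (real n + d0 + 1) / 2" by (simp add: field_simps)
      then show ?thesis by (simp only: powr_add[symmetric])
    qed
    have "trace ((S_conj m0 r0 S0 t n x + (real n + r0) *\<^sub>R outer (\<mu> - ?mc) (\<mu> - ?mc)) ** ?V) =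
       trace (S_diffuse t n x ** ?V) + trace (S0 ** ?V) +
       (real n * r0 / (real n + r0) * ((m0 - ?a) \<bullet> (?V *v (m0 - ?a))) + (real n + r0) * ((\<mu> - ?mc) \<bullet> (?V *v (\<mu> - ?mc))))"
      by (simp add: S_conj_def matrix_add_rdistrib trace_add matrix_mul_scaleR_left trace_scaleR trace_outer_mul)
    also have "real n * r0 / (real n + r0) * ((m0 - ?a) \<bullet> (?V *v (m0 - ?a))) + (real n + r0) * ((\<mu> - ?mc) \<bullet> (?V *v (\<mu> - ?mc))) =
       real n * ((\<mu> - ?a) \<bullet> (?V *v (\<mu> - ?a))) + r0 * ((\<mu> - m0) \<bullet> (?V *v (\<mu> - m0)))"
      using conjugate_exponent[OF Vs, of "real n" r0 \<mu> ?a m0] r0 by (simp add: mean_conj_def add.commute)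
    finally have T: "trace ((S_conj m0 r0 S0 t n x + (real n + r0) *\<^sub>R outer (\<mu> - ?mc) (\<mu> - ?mc)) ** ?V) =
       r0 * ((\<mu> - m0) \<bullet> (?V *v (\<mu> - m0))) + (trace (S_diffuse t n x ** ?V) + real n * ((\<mu> - ?a) \<bullet> (?V *v (\<mu> - ?a)))) + trace (S0 ** ?V)"
      by simp
    have E: "exp (- (1/2) * a) * exp (- (1/2) * b) * exp (- (1/2) * c) = exp (- (1/2) * (a + b + c))" for a b c :: real
      by (simp only: exp_add[symmetric] distrib_left)
    have lk: "likelihood t n x \<mu> X = cl * det X powr (- real n / 2) *
        exp (- (1/2) * (trace (S_diffuse t n x ** ?V) + real n * ((\<mu> - ?a) \<bullet> (?V *v (\<mu> - ?a)))))"
      unfolding likelihood_eq[OF X n] cl_def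
      by (simp only: matrix_add_rdistrib trace_add matrix_mul_scaleR_left trace_scaleR trace_outer_mul)
    have iw: "iw_kernel d S X = det X powr (- d/2) * exp (- (1/2) * trace (S ** ?V))" for d S
      using X by (simp add: iw_kernel_def)
    have "mvn_density m0 ((1/r0) *\<^sub>R X) \<mu> * likelihood t n x \<mu> X * iw_kernel d0 S0 X =
      cm * cl * (det X powr (- 1/2) * det X powr (- real n / 2) * det X powr (- d0/2)) *
      (exp (- (1/2) * (r0 * ((\<mu> - m0) \<bullet> (?V *v (\<mu> - m0))))) *
       exp (- (1/2) * (trace (S_diffuse t n x ** ?V) + real n * ((\<mu> - ?a) \<bullet> (?V *v (\<mu> - ?a))))) *
       exp (- (1/2) * trace (S0 ** ?V)))"
      unfolding M lk iw by (simp only: mult_ac)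
    also have "\<dots> = cm * cl * ?K \<mu> X" unfolding E pw iw T by (simp only: mult.assoc)
    finally show ?thesis .
  qed
  have "(\<integral>\<^sup>+p. F p \<partial>density (conjugate_prior m0 r0 d0 S0) ?l) = ennreal (cw * (cm * cl)) *
    (\<integral>\<^sup>+\<mu>. \<integral>\<^sup>+X. F (\<mu>, X) * ennreal (?K \<mu> X) \<partial>lebesgue_sym \<partial>lborel)"
    if [measurable]: "F \<in> borel_measurable (borel \<Otimes>\<^sub>M borel)" for F
  proof -
    interpret S: sigma_finite_measure "lebesgue_sym :: (real^'k^'k) measure" by (rule sigma_finite_lebesgue_sym)
    have "(\<integral>\<^sup>+p. F p \<partial>density (conjugate_prior m0 r0 d0 S0) ?l) = (\<integral>\<^sup>+p. ?m p * (?l p * F p) \<partial>(lborel \<Otimes>\<^sub>M inv_wishart d0 S0))"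
      unfolding conjugate_prior_def
      by (subst nn_integral_density, measurable) (subst nn_integral_density, measurable)
    also have "\<dots> = (\<integral>\<^sup>+\<mu>. \<integral>\<^sup>+X. ?m (\<mu>, X) * (?l (\<mu>, X) * F (\<mu>, X)) \<partial>inv_wishart d0 S0 \<partial>lborel)"
      by (rule W.nn_integral_fst[symmetric]) measurable
    also have "\<dots> = (\<integral>\<^sup>+\<mu>. ennreal cw * (\<integral>\<^sup>+X. ?m (\<mu>, X) * (?l (\<mu>, X) * F (\<mu>, X)) * ennreal (iw_kernel d0 S0 X) \<partial>lebesgue_sym) \<partial>lborel)"
    proof (rule nn_integral_cong, rule cw(2))
      fix \<mu> :: "real^'k"
      have "(\<lambda>p. ?m p * (?l p * F p)) \<in> borel_measurable (borel \<Otimes>\<^sub>M borel)" by measurable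
      then show "(\<lambda>X. ?m (\<mu>, X) * (?l (\<mu>, X) * F (\<mu>, X))) \<in> borel_measurable borel"
        by (rule measurable_compose[rotated]) measurable
    qed
    also have "\<dots> = (\<integral>\<^sup>+\<mu>. ennreal cw * (\<integral>\<^sup>+X. ennreal (cm * cl) * (F (\<mu>, X) * ennreal (?K \<mu> X)) \<partial>lebesgue_sym) \<partial>lborel)"
    proof (rule nn_integral_cong, rule arg_cong[where f = "\<lambda>z. ennreal cw * z"], rule nn_integral_cong)
      fix \<mu> :: "real^'k" and X :: "real^'k^'k"
      show "?m (\<mu>, X) * (?l (\<mu>, X) * F (\<mu>, X)) * ennreal (iw_kernel d0 S0 X) = ennreal (cm * cl) * (F (\<mu>, X) * ennreal (?K \<mu> X))"
      proof (cases "pos_def X")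
        case True
        have l0: "likelihood t n x \<mu> X \<ge> 0"
          unfolding likelihood_eq[OF True n] by (intro mult_nonneg_nonneg) auto
        have "ennreal (mvn_density m0 ((1/r0) *\<^sub>R X) \<mu>) * ennreal (likelihood t n x \<mu> X) * ennreal (iw_kernel d0 S0 X) = ennreal (cm * cl) * ennreal (?K \<mu> X)"
          using key[OF True, of \<mu>] l0 by (simp only: ennreal_mult''[symmetric] iw_kernel_nonneg)
        then show ?thesis by (simp add: mult_ac)
      qed (simp add: iw_kernel_def)
    qed
    also have "\<dots> = (\<integral>\<^sup>+\<mu>. ennreal cw * (ennreal (cm * cl) * (\<integral>\<^sup>+X. F (\<mu>, X) * ennreal (?K \<mu> X) \<partial>lebesgue_sym)) \<partial>lborel)"
      by (intro nn_integral_cong arg_cong[where f = "\<lambda>z. ennreal cw * z"] nn_integral_cmult) measurable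
    also have "\<dots> = ennreal cw * (ennreal (cm * cl) * (\<integral>\<^sup>+\<mu>. \<integral>\<^sup>+X. F (\<mu>, X) * ennreal (?K \<mu> X) \<partial>lebesgue_sym \<partial>lborel))"
      by (subst nn_integral_cmult, measurable) (subst nn_integral_cmult, measurable)
    finally show ?thesis using cw(1) pos by (simp add: ennreal_mult' mult.assoc)
  qed
  moreover have "cw * (cm * cl) > 0" using cw(1) pos by simp
  ultimately show thesis using that by blast
qed

text \<open>The scatter matrix is positive semidefinite for all data, so the prior scale matrix makes the sum positive
  definite.\<close>

lemma pos_def_S_conj:
  fixes x :: "int \<Rightarrow> real^'k"
  assumes n: "n \<ge> 2" and r0: "r0 > 0" and S0: "pos_def S0"
  shows "pos_def (S_conj m0 r0 S0 t n x)"
proof -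
  have "v \<bullet> ((S_diffuse t n x + S0) *v v) > 0" if "v \<noteq> 0" for v
  proof -
    have "v \<bullet> (S_diffuse t n x *v v) \<ge> 0" unfolding S_diffuse_quadratic[OF n] by (intro sum_nonneg) simp
    moreover have "v \<bullet> (S0 *v v) > 0" using S0 that by (simp add: pos_def_def)
    ultimately show ?thesis by (simp add: matrix_vector_mult_add_rdistrib inner_add_right)
  qed
  then have "pos_def (S_diffuse t n x + S0)"
    using S0 by (simp add: pos_def_def transpose_add S_diffuse_symmetric[OF n])
  then show ?thesis unfolding S_conj_def using r0 by (intro pos_def_add_outer) auto
qed

theorem theorem2:
  fixes L :: "real^'k^'p" and \<gamma> W C r :: real and rf :: "int \<Rightarrow> real" and t T :: int and n :: nat
  assumes "0 \<le> t" and "t < T" and "\<gamma> > 0" and "CARD('k) < n"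
    and C: "C = C_const \<gamma> W rf t T" and r: "r = rf (t + 1)"
  shows
    "((\<forall>(\<mu> :: real^'k) \<Sigma>. pos_def \<Sigma> \<longrightarrow> (AE x in sampling_law t n \<mu> \<Sigma>. pos_def (S_diffuse t n x))) \<and>
      (\<forall>(x :: int \<Rightarrow> real^'k) (M :: 'w measure) \<eta> z0 Q u.
         pos_def (S_diffuse t n x) \<longrightarrow>
         driving_variables M (real n) (real n - real CARD('k)) \<eta> z0 Q u \<longrightarrow>
         distr (posterior diffuse_prior t n x) borel (\<lambda>(\<mu>, \<Sigma>). L *v weights C r \<mu> \<Sigma>) =
         distr M borel (\<lambda>\<omega>.
           let m = sample_mean t n x; S = S_diffuse t n x; \<nu> = real n - real CARD('k) in
             weights_rep C L (eps_rep m S (real n) \<nu> r (Q \<omega>) (u \<omega>))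
               (zeta_rep m S (real n) \<nu> r (Q \<omega>) (u \<omega>)) (Upsilon_rep S \<nu> (Q \<omega>) (u \<omega>))
               (z0 \<omega>) (\<eta> \<omega>))))
     \<and>
     (\<forall>(m0 :: real^'k) r0 d0 S0 (x :: int \<Rightarrow> real^'k) (M :: 'w measure) \<eta> z0 Q u.
         r0 > 0 \<longrightarrow> d0 > 2 * real CARD('k) \<longrightarrow> pos_def S0 \<longrightarrow>
         driving_variables M (real n + d0 - real CARD('k)) (real n + d0 - 2 * real CARD('k)) \<eta> z0 Q u \<longrightarrow>
         distr (posterior (conjugate_prior m0 r0 d0 S0) t n x) borel (\<lambda>(\<mu>, \<Sigma>). L *v weights C r \<mu> \<Sigma>) =
         distr M borel (\<lambda>\<omega>.
           let m = mean_conj m0 r0 t n x; S = S_conj m0 r0 S0 t n x;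
               \<nu> = real n + d0 - 2 * real CARD('k) in
             weights_rep C L (eps_rep m S (real n + r0) \<nu> r (Q \<omega>) (u \<omega>))
               (zeta_rep m S (real n + r0) \<nu> r (Q \<omega>) (u \<omega>)) (Upsilon_rep S \<nu> (Q \<omega>) (u \<omega>))
               (z0 \<omega>) (\<eta> \<omega>)))"
proof (intro conjI allI impI)
  have "CARD('k) > 0" by simp
  then have n: "n \<ge> 2" using assms(4) by linarith
  show "AE x in sampling_law t n \<mu> \<Sigma>. pos_def (S_diffuse t n x)" if "pos_def \<Sigma>" for \<mu> :: "real^'k" and \<Sigma>
    using AE_pos_def_S_diffuse[OF assms(4) that] .
  show "distr (posterior diffuse_prior t n x) borel (\<lambda>(\<mu>, \<Sigma>). L *v weights C r \<mu> \<Sigma>) =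
         distr M borel (\<lambda>\<omega>.
           let m = sample_mean t n x; S = S_diffuse t n x; \<nu> = real n - real CARD('k) in
             weights_rep C L (eps_rep m S (real n) \<nu> r (Q \<omega>) (u \<omega>))
               (zeta_rep m S (real n) \<nu> r (Q \<omega>) (u \<omega>)) (Upsilon_rep S \<nu> (Q \<omega>) (u \<omega>))
               (z0 \<omega>) (\<eta> \<omega>))"
    if S: "pos_def (S_diffuse t n x)" and dv: "driving_variables M (real n) (real n - real CARD('k)) \<eta> z0 Q u"
    for x :: "int \<Rightarrow> real^'k" and M :: "'w measure" and \<eta> z0 Q u
  proof -
    let ?D = "real n + real CARD('k) + 1"
    have e: "?D - real CARD('k) - 1 = real n" "?D - 2 * real CARD('k) - 1 = real n - real CARD('k)" by simp_all
    have D: "?D > 2 * real CARD('k) + 1" using assms(4) by simp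
    have c: "(1 / sqrt ((2 * pi) ^ CARD('k))) ^ n > 0" by simp
    have N: "real n > 0" using n by simp
    have U: "sets (density diffuse_prior (\<lambda>(\<mu>, \<Sigma>). ennreal (likelihood t n x \<mu> \<Sigma>))) = sets (borel \<Otimes>\<^sub>M borel)"
      by (simp add: diffuse_prior_def sets_prior_space)
    show ?thesis
      using weights_law_of_joint_kernel[OF S N D, unfolded e, OF dv U c diffuse_posterior_density[OF n]]
      unfolding posterior_def Let_def .
  qed
  show "distr (posterior (conjugate_prior m0 r0 d0 S0) t n x) borel (\<lambda>(\<mu>, \<Sigma>). L *v weights C r \<mu> \<Sigma>) =
         distr M borel (\<lambda>\<omega>.
           let m = mean_conj m0 r0 t n x; S = S_conj m0 r0 S0 t n x;
               \<nu> = real n + d0 - 2 * real CARD('k) in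
             weights_rep C L (eps_rep m S (real n + r0) \<nu> r (Q \<omega>) (u \<omega>))
               (zeta_rep m S (real n + r0) \<nu> r (Q \<omega>) (u \<omega>)) (Upsilon_rep S \<nu> (Q \<omega>) (u \<omega>))
               (z0 \<omega>) (\<eta> \<omega>))"
    if r0: "r0 > 0" and d0: "d0 > 2 * real CARD('k)" and S0: "pos_def S0"
      and dv: "driving_variables M (real n + d0 - real CARD('k)) (real n + d0 - 2 * real CARD('k)) \<eta> z0 Q u"
    for m0 :: "real^'k" and r0 d0 S0 and x :: "int \<Rightarrow> real^'k" and M :: "'w measure" and \<eta> z0 Q u
  proof -
    let ?D = "real n + d0 + 1"
    have e: "?D - real CARD('k) - 1 = real n + d0 - real CARD('k)"
      "?D - 2 * real CARD('k) - 1 = real n + d0 - 2 * real CARD('k)" by simp_all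
    have D: "?D > 2 * real CARD('k) + 1" using d0 n by simp
    have N: "real n + r0 > 0" using r0 by simp
    have U: "sets (density (conjugate_prior m0 r0 d0 S0) (\<lambda>(\<mu>, \<Sigma>). ennreal (likelihood t n x \<mu> \<Sigma>))) = sets (borel \<Otimes>\<^sub>M borel)"
      unfolding conjugate_prior_def sets_density by (rule sets_pair_measure_cong) simp_all
    obtain c where c: "c > 0" "\<And>F :: (real^'k) \<times> (real^'k^'k) \<Rightarrow> ennreal. F \<in> borel_measurable (borel \<Otimes>\<^sub>M borel) \<Longrightarrow>
      (\<integral>\<^sup>+p. F p \<partial>density (conjugate_prior m0 r0 d0 S0) (\<lambda>(\<mu>, \<Sigma>). ennreal (likelihood t n x \<mu> \<Sigma>))) =
      ennreal c * (\<integral>\<^sup>+\<mu>. \<integral>\<^sup>+X. F (\<mu>, X) * ennreal (iw_kernel (real n + d0 + 1)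
        (S_conj m0 r0 S0 t n x + (real n + r0) *\<^sub>R outer (\<mu> - mean_conj m0 r0 t n x) (\<mu> - mean_conj m0 r0 t n x)) X) \<partial>lebesgue_sym \<partial>lborel)"
      using conjugate_posterior_density[OF n r0 d0 S0, where t = t and x = x and ?m0.0 = m0] by blast
    show ?thesis
      using weights_law_of_joint_kernel[OF pos_def_S_conj[OF n r0 S0] N D, unfolded e, OF dv U c]
      unfolding posterior_def Let_def .
  qed
qed

end
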